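(* (Case (r15).) Let $H(x,y)=\frac{y^2}{2}+\frac{x^2(3x^2+8x+6)}{12}$ and, for $h\in(0,1/12)$, let $\gamma_h$ be the oval surrounding the origin inside the level curve $\{H(x,y)=h\}$, in the period annulus of the origin whose projection on the $x$-axis is $(-1,1/3)$. For $i=0,1,2$ define $$\widetilde I_i(h)=\int_{\gamma_h}(x+1)^{i-4}\,y\,dx .$$ Then $\{\widetilde I_0,\widetilde I_1,\widetilde I_2\}$ is an ECT-system on $(0,1/12)$.
   Context: The origin is a local minimum of $H$, and the period annulus is the punctured neighbourhood of the origin foliated by the closed curves (ovals) $\gamma_h\subset\{H=h\}$ surrounding the origin. An ordered tuple $(f_0,\ldots,f_{n-1})$ of analytic functions on an open interval $L$ is an extended complete Chebyshev system (ECT-system) on $L$ if, for all $k=1,\ldots,n$, any nontrivial linear combination $\alpha_0f_0+\cdots+\alpha_{k-1}f_{k-1}$ (which is understood not to vanish identically) has at most $k-1$ isolated zeros on $L$ counted with multiplicities; equivalently, the Wronskian $\det(f_j^{(i)}(x))_{0\le i,j\le k-1}\neq0$ for all $k=1,\ldots,n$ and all $x\in L$. A set $\{f_0,\ldots,f_{n-1}\}$ is called an ECT-system on $L$ if its elements form an ECT-system on $L$ when taken in some order. *)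

theory Defs
  imports "HOL-Complex_Analysis.Winding_Numbers" "HOL-Combinatorics.Permutations"
    "HOL-Library.Extended_Nat"
begin

definition real_analytic_on :: "(real \<Rightarrow> real) \<Rightarrow> real set \<Rightarrow> bool" where
  "real_analytic_on f L \<longleftrightarrow>
     (\<forall>x\<in>L. \<exists>r>0. \<exists>a::nat \<Rightarrow> real. \<forall>y. \<bar>y - x\<bar> < r \<longrightarrow> (\<lambda>n. a n * (y - x) ^ n) sums f y)"

(* The order of vanishing: 0 if f x is nonzero, and infinity if all derivatives vanish at x. *)
definition zero_multiplicity :: "(real \<Rightarrow> real) \<Rightarrow> real \<Rightarrow> enat" where
  "zero_multiplicity f x = (INF m\<in>{m. (deriv ^^ m) f x \<noteq> 0}. enat m)"

(* The ordered tuple (f 0, ..., f (n - 1)) on an open interval L. A linear combination is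
   nontrivial if some coefficient is nonzero; that it does not vanish identically on L is then
   part of the claim. For analytic functions on an interval all zeros are then isolated. *)
definition ECT_system :: "real set \<Rightarrow> nat \<Rightarrow> (nat \<Rightarrow> real \<Rightarrow> real) \<Rightarrow> bool" where
  "ECT_system L n f \<longleftrightarrow>
     open L \<and> is_interval L \<and> (\<forall>j<n. real_analytic_on (f j) L) \<and>
     (\<forall>k\<in>{1..n}. \<forall>\<alpha>::nat \<Rightarrow> real. (\<exists>j<k. \<alpha> j \<noteq> 0) \<longrightarrow>
        (let F = (\<lambda>x. \<Sum>j<k. \<alpha> j * f j x); Z = {x\<in>L. F x = 0} in
           (\<exists>x\<in>L. F x \<noteq> 0) \<and> finite Z \<and> (\<Sum>x\<in>Z. zero_multiplicity F x) \<le> enat (k - 1)))"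

(* The unordered version; as an indexed family, so that coinciding members are not merged. *)
definition ECT_system_unordered :: "real set \<Rightarrow> nat \<Rightarrow> (nat \<Rightarrow> real \<Rightarrow> real) \<Rightarrow> bool" where
  "ECT_system_unordered L n f \<longleftrightarrow> (\<exists>\<pi>. \<pi> permutes {..<n} \<and> ECT_system L n (f \<circ> \<pi>))"

definition Ham :: "real \<Rightarrow> real \<Rightarrow> real" where
  "Ham x y = y\<^sup>2 / 2 + x\<^sup>2 * (3 * x\<^sup>2 + 8 * x + 6) / 12"

(* The (x,y)-plane is identified with the complex numbers via x = Re z, y = Im z, in order to use
   the library's piecewise C1 paths and winding numbers. *)
definition oval :: "(real \<Rightarrow> real \<Rightarrow> real) \<Rightarrow> real \<Rightarrow> (real \<Rightarrow> complex) \<Rightarrow> bool" where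
  "oval H h g \<longleftrightarrow>
     valid_path g \<and> simple_path g \<and> pathfinish g = pathstart g \<and>
     path_image g \<subseteq> {z. H (Re z) (Im z) = h} \<and> 0 \<in> inside (path_image g)"

(* The line integral of the 1-form P(x,y) dx along the path g. *)
definition line_integral_dx :: "(real \<Rightarrow> complex) \<Rightarrow> (real \<Rightarrow> real \<Rightarrow> real) \<Rightarrow> real" where
  "line_integral_dx g P =
     integral {0..1} (\<lambda>t. P (Re (g t)) (Im (g t)) * Re (vector_derivative g (at t within {0..1})))"

definition I_tilde :: "(real \<Rightarrow> real \<Rightarrow> complex) \<Rightarrow> nat \<Rightarrow> real \<Rightarrow> real" where
  "I_tilde \<gamma> i h = line_integral_dx (\<gamma> h) (\<lambda>x y. (x + 1) powi (int i - 4) * y)"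

end

theory Submission
  imports Defs "HOL-Complex_Analysis.Riemann_Mapping" "HOL-Computational_Algebra.Polynomial"
begin

text \<open>Put \<open>u = x + 1\<close>.  The potential part of the Hamiltonian is
\<open>(u - 1)\<^sup>2 (3u\<^sup>2 + 2u + 1) / 12\<close>, so in the coordinate
\<open>z = (u - 1) sqrt ((3u\<^sup>2 + 2u + 1) / 6)\<close>, which increases analytically on \<open>0 < u < 4/3\<close>, the
Hamiltonian is \<open>(y\<^sup>2 + z\<^sup>2) / 2\<close> and the ovals are circles.  The integral of \<open>f(u) y dx\<close> over
the oval of level \<open>h\<close> is, up to a factor that depends only on the orientation, the integral of
\<open>G(z) (2h - z\<^sup>2)\<^sup>k\<^sup>-\<^sup>1\<^sup>/\<^sup>2\<close> over \<open>\<bar>z\<bar> \<le> sqrt (2h)\<close> with \<open>k = 1\<close> and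
\<open>G(z) = f(u(z)) u'(z)\<close>; it is called \<open>oval_integral k G h\<close> and only the even part of \<open>G\<close> matters
(\<open>line_integral_on_oval\<close>).

These integrals have, with multiplicity, at most as many zeros in \<open>h\<close> as \<open>G\<close> has sign changes in
\<open>z > 0\<close>, provided that this number is at most \<open>k\<close>.  Indeed, the derivative in \<open>h\<close> of
\<open>(2h - a\<^sup>2)\<^sup>1\<^sup>/\<^sup>2\<^sup>-\<^sup>k oval_integral k G h\<close> is a positive multiple of the integral with
index \<open>k - 1\<close> of \<open>(z\<^sup>2 - a\<^sup>2) G(z)\<close>; if \<open>a\<close> is a sign change of \<open>G\<close>, this density has one sign
change less, while Rolle's theorem costs one zero (\<open>variation_step\<close>).  Three functions require
\<open>k = 2\<close>.  As in the criterion of Grau, Manosas and Villadelprat, the exponent of \<open>y\<close> is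
therefore raised first: integration by parts turns \<open>4h\<close> times the integral with \<open>k = 1\<close> into one
with \<open>k = 2\<close> and a new even density \<open>L\<close> (\<open>oval_integral_density\<close>).

It remains to count the sign changes of \<open>L\<close> for a linear combination of the three integrals.
The two points \<open>u < 1 < v\<close> of equal potential are the two preimages of \<open>-z\<close> and \<open>z\<close>.  They form a
rational curve with parameter \<open>t = (v - u)\<^sup>2 / (u v)\<close>, and \<open>t\<close> increases with \<open>z\<close>.  In this
parameter \<open>L\<close> is a positive factor times a combination of three polynomials \<open>p0\<close>, \<open>p1\<close>, \<open>p2\<close>
(\<open>even_density_factor\<close>).  The polynomial \<open>p0\<close>, the Wronskian of \<open>p0, p1\<close> and that of
\<open>p0, p1, p2\<close> each have coefficients of one sign, so they do not vanish for \<open>t > 0\<close>.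
Division by \<open>p0\<close> and differentiation, done twice, then show that a combination of the
first \<open>k\<close> polynomials changes sign at most \<open>k - 1\<close> times (\<open>combination_two_sign_changes\<close>).\<close>

section \<open>Counting zeros with multiplicity\<close>

text \<open>Vanishing to order at least \<open>m\<close>.  The recursion through a derivative that exists near \<open>x\<close>
makes Rolle's theorem and multiplication by affine functions, the only operations
needed below, straightforward inductions.\<close>

fun vanishes :: "nat \<Rightarrow> (real \<Rightarrow> real) \<Rightarrow> real \<Rightarrow> bool" where
  "vanishes 0 f x = True"
| "vanishes (Suc m) f x = (f x = 0 \<and>
     (\<exists>f'. (\<forall>\<^sub>F y in nhds x. (f has_real_derivative f' y) (at y)) \<and> vanishes m f' x))"

lemma vanishes_SucI:
  assumes "f x = 0" "\<forall>\<^sub>F y in nhds x. (f has_real_derivative f' y) (at y)" "vanishes m f' x"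
  shows "vanishes (Suc m) f x"
  using assms by auto

lemma vanishes_cong:
  assumes "\<forall>\<^sub>F y in nhds x. f y = g y" "vanishes m f x"
  shows "vanishes m g x"
  using assms
proof (induction m arbitrary: f g)
  case (Suc m)
  then obtain f' where f': "\<forall>\<^sub>F y in nhds x. (f has_real_derivative f' y) (at y)" "vanishes m f' x"
    by auto
  have "\<forall>\<^sub>F y in nhds x. \<forall>\<^sub>F z in nhds y. f z = g z"
    using Suc.prems(1) by (simp add: eventually_eventually)
  hence "\<forall>\<^sub>F y in nhds x. (g has_real_derivative f' y) (at y)"
    using f'(1) by eventually_elim (auto simp: DERIV_cong_ev)
  moreover have "g x = 0"
    using Suc.prems eventually_nhds_x_imp_x by fastforce
  ultimately show ?case using f'(2) by auto
qed simp

lemma vanishes_imp_zero: "vanishes m f x \<Longrightarrow> m > 0 \<Longrightarrow> f x = 0"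
  by (cases m) auto

lemma vanishes_mono: "vanishes m f x \<Longrightarrow> n \<le> m \<Longrightarrow> vanishes n f x"
proof (induction m arbitrary: f n)
  case (Suc m)
  show ?case
  proof (cases n)
    case (Suc n')
    with Suc.prems Suc.IH show ?thesis by fastforce
  qed simp
qed simp

lemma vanishes_add:
  "vanishes m f x \<Longrightarrow> vanishes m g x \<Longrightarrow> vanishes m (\<lambda>y. f y + g y) x"
proof (induction m arbitrary: f g)
  case (Suc m)
  obtain f' g' where f': "\<forall>\<^sub>F y in nhds x. (f has_real_derivative f' y) (at y)" "vanishes m f' x"
    and g': "\<forall>\<^sub>F y in nhds x. (g has_real_derivative g' y) (at y)" "vanishes m g' x"
    using Suc.prems by auto
  have "\<forall>\<^sub>F y in nhds x. ((\<lambda>y. f y + g y) has_real_derivative f' y + g' y) (at y)"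
    using f'(1) g'(1) by eventually_elim (rule DERIV_add)
  with Suc.IH[OF f'(2) g'(2)] Suc.prems show ?case
    by (intro vanishes_SucI[where f' = "\<lambda>y. f' y + g' y"]) simp_all
qed simp

lemma vanishes_affine_mult:
  "vanishes m f x \<Longrightarrow> vanishes m (\<lambda>y. (c * y + d) * f y) x"
proof (induction m arbitrary: f c d)
  case (Suc m)
  obtain f' where f': "\<forall>\<^sub>F y in nhds x. (f has_real_derivative f' y) (at y)" "vanishes m f' x"
    using Suc.prems by auto
  have "\<forall>\<^sub>F y in nhds x. ((\<lambda>y. (c * y + d) * f y) has_real_derivative
      (0 * y + c) * f y + (c * y + d) * f' y) (at y)"
    using f'(1) by eventually_elim (auto intro!: derivative_eq_intros)
  moreover have "vanishes m (\<lambda>y. (0 * y + c) * f y + (c * y + d) * f' y) x"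
    by (intro vanishes_add Suc.IH f'(2) vanishes_mono[OF Suc.prems]) simp
  ultimately show ?case using Suc.prems
    by (intro vanishes_SucI[where f' = "\<lambda>y. (0 * y + c) * f y + (c * y + d) * f' y"]) simp_all
qed simp

lemma vanishes_deriv:
  assumes "vanishes (Suc m) f x" "\<forall>\<^sub>F y in nhds x. (f has_real_derivative f' y) (at y)"
  shows "vanishes m f' x"
proof -
  obtain f1 where f1: "\<forall>\<^sub>F y in nhds x. (f has_real_derivative f1 y) (at y)" "vanishes m f1 x"
    using assms by auto
  have "\<forall>\<^sub>F y in nhds x. f1 y = f' y"
    using f1(1) assms(2) by eventually_elim (rule DERIV_unique)
  thus ?thesis using f1(2) vanishes_cong by blast
qed

text \<open>The multiplicities enter through lower bounds \<open>\<mu>\<close> at finitely many points, so that neither the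
finiteness of the zero set nor that of the multiplicities has to be known beforehand.\<close>

definition at_most_zeros :: "nat \<Rightarrow> (real \<Rightarrow> real) \<Rightarrow> real set \<Rightarrow> bool" where
  "at_most_zeros n f S \<longleftrightarrow>
     (\<forall>X \<mu>. finite X \<longrightarrow> X \<subseteq> S \<longrightarrow> (\<forall>x\<in>X. vanishes (\<mu> x) f x) \<longrightarrow> sum \<mu> X \<le> n)"

lemma at_most_zerosD:
  assumes "at_most_zeros n f S" "finite X" "X \<subseteq> S" "\<And>x. x \<in> X \<Longrightarrow> vanishes (\<mu> x) f x"
  shows "sum \<mu> X \<le> n"
  using assms unfolding at_most_zeros_def by simp

lemma at_most_zerosI_nonzero:
  assumes "\<And>x. x \<in> S \<Longrightarrow> f x \<noteq> 0"
  shows "at_most_zeros 0 f S"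
  unfolding at_most_zeros_def
proof (intro allI impI)
  fix X and \<mu> :: "real \<Rightarrow> nat"
  assume X: "finite X" "X \<subseteq> S" "\<forall>x\<in>X. vanishes (\<mu> x) f x"
  have "\<mu> x = 0" if "x \<in> X" for x
    using X assms that vanishes_imp_zero[of "\<mu> x" f x] by blast
  thus "sum \<mu> X \<le> 0" by simp
qed

lemma at_most_zeros_subset:
  assumes "at_most_zeros n f S" "T \<subseteq> S"
  shows "at_most_zeros n f T"
  using assms unfolding at_most_zeros_def by (meson subset_trans)

lemma at_most_zeros_superset:
  assumes "at_most_zeros n f S" "\<And>x. x \<in> T - S \<Longrightarrow> f x \<noteq> 0"
  shows "at_most_zeros n f T"
  unfolding at_most_zeros_def
proof (intro allI impI)
  fix X and \<mu> :: "real \<Rightarrow> nat"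
  assume X: "finite X" "X \<subseteq> T" "\<forall>x\<in>X. vanishes (\<mu> x) f x"
  have 0: "\<mu> x = 0" if "x \<in> X - S" for x
    using X assms(2) that vanishes_imp_zero[of "\<mu> x" f x] by blast
  have "sum \<mu> X = sum \<mu> (X \<inter> S)"
    using 0 X by (intro sum.mono_neutral_right) auto
  also have "\<dots> \<le> n"
    using at_most_zerosD[OF assms(1), of "X \<inter> S" \<mu>] X by auto
  finally show "sum \<mu> X \<le> n" .
qed

lemma at_most_zeros_transfer:
  assumes "at_most_zeros n g S" "\<And>x m. x \<in> S \<Longrightarrow> vanishes m f x \<Longrightarrow> vanishes m g x"
  shows "at_most_zeros n f S"
  unfolding at_most_zeros_def
proof (intro allI impI)
  fix X and \<mu> :: "real \<Rightarrow> nat"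
  assume "finite X" "X \<subseteq> S" "\<forall>x\<in>X. vanishes (\<mu> x) f x"
  thus "sum \<mu> X \<le> n" using assms(2) by (intro at_most_zerosD[OF assms(1)]) auto
qed

lemma at_most_zeros_cong:
  assumes "at_most_zeros n g S" "open S" "\<And>x. x \<in> S \<Longrightarrow> g x = (c * x + d) * f x"
  shows "at_most_zeros n f S"
proof (rule at_most_zeros_transfer[OF assms(1)])
  fix x m assume x: "x \<in> S" and v: "vanishes m f x"
  have "\<forall>\<^sub>F y in nhds x. y \<in> S" using assms(2) x by (rule eventually_nhds_in_open)
  hence "\<forall>\<^sub>F y in nhds x. (c * y + d) * f y = g y" by eventually_elim (use assms(3) in auto)
  thus "vanishes m g x" by (rule vanishes_cong) (rule vanishes_affine_mult[OF v])
qed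

text \<open>Between \<open>n + 1\<close> points there are \<open>n\<close> gaps; the bounds by \<open>Min X\<close> and \<open>Max X\<close> are what
keeps the chosen points distinct in the induction.\<close>

lemma intermediate_points:
  fixes X :: "real set"
  assumes "finite X" "X \<noteq> {}"
    and "\<And>x y. x \<in> X \<Longrightarrow> y \<in> X \<Longrightarrow> x < y \<Longrightarrow> \<exists>z. x < z \<and> z < y \<and> P z"
  shows "\<exists>Y. finite Y \<and> Y \<inter> X = {} \<and> card X = Suc (card Y) \<and> (\<forall>y\<in>Y. P y \<and> Min X < y \<and> y < Max X)"
  using assms
proof (induction X rule: finite_linorder_max_induct)
  case (insert b A)
  show ?case
  proof (cases "A = {}")
    case True
    thus ?thesis by (intro exI[of _ "{}"]) auto
  next
    case False
    obtain Y where Y: "finite Y" "Y \<inter> A = {}" "card A = Suc (card Y)"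
      "\<forall>y\<in>Y. P y \<and> Min A < y \<and> y < Max A"
      using insert.IH[OF False] insert.prems by blast
    have mA: "Max A \<in> A" "Max A < b" using insert False by auto
    obtain z where z: "Max A < z" "z < b" "P z"
      using insert.prems(2)[of "Max A" b] mA by auto
    have zA: "z \<notin> A" using z(1) insert.hyps(1) Max_ge[of A z] by (meson leD)
    have zY: "z \<notin> Y" using z(1) Y(4) by force
    have bY: "b \<notin> Y" using Y(4) mA by force
    have bA: "b \<notin> A" using insert.hyps by auto
    have Mi: "Min A \<le> Max A" using insert.hyps False by simp
    have "Min (insert b A) = Min A" "Max (insert b A) = b"
      using insert.hyps(1) False mA Mi by (simp_all add: Min_insert Max_insert min_absorb2 max_absorb1)
    moreover have "\<forall>y\<in>insert z Y. P y \<and> Min A < y \<and> y < b"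
      using Y(4) z mA(2) Mi by force
    moreover have "card (insert b A) = Suc (card (insert z Y))"
      using Y(1,3) zY bA insert.hyps(1) by simp
    moreover have "insert z Y \<inter> insert b A = {}"
      using Y(2) zA z(2) bY by auto
    ultimately show ?thesis using Y(1) by (intro exI[of _ "insert z Y"]) simp
  qed
qed simp

text \<open>Rolle's theorem with multiplicities for \<open>(p f)' = q g\<close>.  At a zero of \<open>f\<close> of order \<open>m\<close> the
function \<open>g\<close> keeps a zero of order \<open>m - 1\<close>, and it gains a zero between any two neighbouring
zeros of \<open>f\<close>.\<close>

lemma at_most_zeros_Rolle:
  assumes S: "is_interval S"
    and g: "at_most_zeros n g S"
    and van: "\<And>x m. x \<in> S \<Longrightarrow> vanishes (Suc m) f x \<Longrightarrow> vanishes m g x"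
    and simple: "\<And>x. x \<in> S \<Longrightarrow> g x = 0 \<Longrightarrow> vanishes 1 g x"
    and der: "\<And>x. x \<in> S \<Longrightarrow> ((\<lambda>y. p y * f y) has_real_derivative q x * g x) (at x)"
    and q: "\<And>x. x \<in> S \<Longrightarrow> q x \<noteq> 0"
  shows "at_most_zeros (Suc n) f S"
  unfolding at_most_zeros_def
proof (intro allI impI)
  fix X0 and \<mu> :: "real \<Rightarrow> nat"
  assume X0: "finite X0" "X0 \<subseteq> S" "\<forall>x\<in>X0. vanishes (\<mu> x) f x"
  define X where "X = {x\<in>X0. \<mu> x > 0}"
  have X: "finite X" "X \<subseteq> S" "\<And>x. x \<in> X \<Longrightarrow> \<mu> x > 0" using X0 by (auto simp: X_def)
  have sumX: "sum \<mu> X0 = sum \<mu> X"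
    unfolding X_def using X0 by (intro sum.mono_neutral_right) auto
  show "sum \<mu> X0 \<le> Suc n"
  proof (cases "X = {}")
    case True
    thus ?thesis using sumX by simp
  next
    case False
    have fX: "f x = 0" if "x \<in> X" for x
      using X(3)[OF that] that X0(3) vanishes_imp_zero[of "\<mu> x" f x] by (auto simp: X_def)
    have rolle: "\<exists>z. x < z \<and> z < y \<and> (z \<in> S \<and> g z = 0)" if xy: "x \<in> X" "y \<in> X" "x < y" for x y
    proof -
      have in_S: "z \<in> S" if "x \<le> z" "z \<le> y" for z
        using S xy X(2) that unfolding is_interval_1 by blast
      have "\<exists>z>x. z < y \<and> (\<lambda>z. (*) (q z * g z)) z = (\<lambda>v. 0)"
      proof (rule Rolle_deriv[OF xy(3)])
        show "p x * f x = p y * f y" using fX xy by simp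
        show "continuous_on {x..y} (\<lambda>y. p y * f y)"
          by (rule continuous_at_imp_continuous_on) (use der in_S DERIV_isCont in force)
        show "((\<lambda>y. p y * f y) has_derivative (*) (q z * g z)) (at z)" if "x < z" "z < y" for z
          using der[of z] in_S[of z] that by (simp add: has_field_derivative_def)
      qed
      then obtain z where z: "x < z" "z < y" "(*) (q z * g z) = (\<lambda>v. 0)" by blast
      have "q z * g z * 1 = 0" by (rule fun_cong[OF z(3)])
      hence "g z = 0" using q[of z] in_S[of z] z(1,2) by simp
      moreover have "z \<in> S" using in_S[of z] z by simp
      ultimately show ?thesis using z by blast
    qed
    obtain Y where Y: "finite Y" "Y \<inter> X = {}" "card X = Suc (card Y)" "\<forall>y\<in>Y. y \<in> S \<and> g y = 0"
      using intermediate_points[OF X(1) False rolle] by blast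
    \<comment> \<open>lower bounds for the orders of the zeros of \<open>g\<close> in \<open>X \<union> Y\<close>\<close>
    define \<nu> where "\<nu> = (\<lambda>x. if x \<in> X then \<mu> x - 1 else 1)"
    have "sum \<nu> (X \<union> Y) \<le> n"
    proof -
      have "vanishes (\<nu> x) g x" if "x \<in> X \<union> Y" for x
      proof (cases "x \<in> X")
        case True
        have "vanishes (Suc (\<mu> x - 1)) f x" using True X(3)[OF True] X0(3) by (auto simp: X_def)
        thus ?thesis using van[of x "\<mu> x - 1"] True X(2) by (auto simp: \<nu>_def)
      next
        case False
        thus ?thesis using that Y(4) simple by (auto simp: \<nu>_def)
      qed
      moreover have "X \<union> Y \<subseteq> S" "finite (X \<union> Y)" using X Y by auto
      ultimately show ?thesis using at_most_zerosD[OF g] by blast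
    qed
    moreover have "sum \<nu> (X \<union> Y) = sum (\<lambda>x. \<mu> x - 1) X + card Y"
    proof -
      have "sum \<nu> (X \<union> Y) = sum \<nu> X + sum \<nu> Y"
        using X Y by (intro sum.union_disjoint) auto
      moreover have "sum \<nu> X = sum (\<lambda>x. \<mu> x - 1) X"
        by (intro sum.cong) (auto simp: \<nu>_def)
      moreover have "sum \<nu> Y = sum (\<lambda>_. 1) Y"
        using Y by (intro sum.cong) (auto simp: \<nu>_def)
      ultimately show ?thesis by simp
    qed
    moreover have "sum \<mu> X = sum (\<lambda>x. \<mu> x - 1) X + card X"
    proof -
      have "sum \<mu> X = sum (\<lambda>x. (\<mu> x - 1) + 1) X"
        using X(3) by (intro sum.cong) fastforce+
      thus ?thesis by (simp only: sum.distrib card_eq_sum)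
    qed
    ultimately show ?thesis using sumX Y(3) by linarith
  qed
qed


lemma real_analytic_on_cong:
  assumes "real_analytic_on f L" "open L" "\<And>x. x \<in> L \<Longrightarrow> f x = g x"
  shows "real_analytic_on g L"
  unfolding real_analytic_on_def
proof
  fix x assume x: "x \<in> L"
  obtain r a where r: "r > 0" "\<And>y. \<bar>y - x\<bar> < r \<Longrightarrow> (\<lambda>n. a n * (y - x) ^ n) sums f y"
    using assms(1)[unfolded real_analytic_on_def, rule_format, OF x] by auto
  obtain e where e: "e > 0" "ball x e \<subseteq> L" using assms(2) x by (auto simp: open_contains_ball)
  have "(\<lambda>n. a n * (y - x) ^ n) sums g y" if "\<bar>y - x\<bar> < min r e" for y
  proof -
    have "y \<in> L" using e(2) that by (auto simp: subset_iff dist_real_def abs_minus_commute)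
    thus ?thesis using r(2)[of y] that assms(3) by simp
  qed
  thus "\<exists>r>0. \<exists>a::nat \<Rightarrow> real. \<forall>y. \<bar>y - x\<bar> < r \<longrightarrow> (\<lambda>n. a n * (y - x) ^ n) sums g y"
    using r(1) e(1) by (intro exI[of _ "min r e"] conjI exI[of _ a]) auto
qed

lemma real_analytic_on_deriv:
  assumes "real_analytic_on f L" "x \<in> L"
  shows "\<forall>\<^sub>F y in nhds x. (f has_real_derivative deriv f y) (at y)"
    and "\<exists>r>0. \<exists>a::nat \<Rightarrow> real. \<forall>y. \<bar>y - x\<bar> < r \<longrightarrow> (\<lambda>n. a n * (y - x) ^ n) sums deriv f y"
proof -
  obtain r a where r: "r > 0" and a: "\<And>y. \<bar>y - x\<bar> < r \<Longrightarrow> (\<lambda>n. a n * (y - x) ^ n) sums f y"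
    using assms(1)[unfolded real_analytic_on_def, rule_format, OF assms(2)] by auto
  have main: "(f has_real_derivative (\<Sum>n. diffs a n * (y - x) ^ n)) (at y)
      \<and> summable (\<lambda>n. diffs a n * (y - x) ^ n)" if y: "\<bar>y - x\<bar> < r" for y
  proof -
    obtain K where K: "\<bar>y - x\<bar> < K" "K < r" using y dense by blast
    have sK: "summable (\<lambda>n. a n * K ^ n)"
      using a[of "x + K"] K by (auto simp: sums_iff)
    have "((\<lambda>z. \<Sum>n. a n * z ^ n) has_real_derivative (\<Sum>n. diffs a n * (y - x) ^ n)) (at (y - x))"
      by (rule termdiffs_strong[OF sK]) (use K in auto)
    hence "((\<lambda>z. \<Sum>n. a n * (z - x) ^ n) has_real_derivative (\<Sum>n. diffs a n * (y - x) ^ n)) (at y)"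
      using DERIV_shift[of "\<lambda>z. \<Sum>n. a n * z ^ n" _ y "-x"] by simp
    moreover have "\<forall>\<^sub>F z in nhds y. (\<Sum>n. a n * (z - x) ^ n) = f z"
    proof -
      have "\<forall>\<^sub>F z in nhds y. z \<in> {z. \<bar>z - x\<bar> < r}"
        by (rule eventually_nhds_in_open) (use y in \<open>auto intro!: open_Collect_less continuous_intros\<close>)
      thus ?thesis by eventually_elim (use a in \<open>auto simp: sums_iff\<close>)
    qed
    ultimately have "(f has_real_derivative (\<Sum>n. diffs a n * (y - x) ^ n)) (at y)"
      by (simp only: DERIV_cong_ev[OF refl _ refl])
    moreover have "summable (\<lambda>n. diffs a n * (y - x) ^ n)"
    proof (rule termdiff_converges[where K = r])
      show "norm (y - x) < r" using y by simp
      show "summable (\<lambda>n. a n * z ^ n)" if "norm z < r" for z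
        using a[of "x + z"] that by (auto simp: sums_iff)
    qed
    ultimately show ?thesis by blast
  qed
  have d: "deriv f y = (\<Sum>n. diffs a n * (y - x) ^ n)" if "\<bar>y - x\<bar> < r" for y
    using main[OF that] by (intro DERIV_imp_deriv) auto
  have "\<forall>\<^sub>F z in nhds x. z \<in> {z. \<bar>z - x\<bar> < r}"
    by (rule eventually_nhds_in_open) (use r in \<open>auto intro!: open_Collect_less continuous_intros\<close>)
  thus "\<forall>\<^sub>F y in nhds x. (f has_real_derivative deriv f y) (at y)"
    by eventually_elim (use main d in auto)
  show "\<exists>r>0. \<exists>a::nat \<Rightarrow> real. \<forall>y. \<bar>y - x\<bar> < r \<longrightarrow> (\<lambda>n. a n * (y - x) ^ n) sums deriv f y"
    using r main d by (intro exI[of _ r] conjI exI[of _ "diffs a"]) (auto simp: sums_iff)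
qed

text \<open>The link with iterated derivatives; analyticity provides the derivatives in a neighbourhood
that \<open>vanishes\<close> asks for.\<close>

lemma vanishes_if_higher_derivs_zero:
  assumes "real_analytic_on f L" "x \<in> L" "\<And>j. j < m \<Longrightarrow> (deriv ^^ j) f x = 0"
  shows "vanishes m f x"
  using assms
proof (induction m arbitrary: f)
  case (Suc m)
  show ?case
  proof (rule vanishes_SucI)
    show "f x = 0" using Suc.prems(3)[of 0] by simp
    show "\<forall>\<^sub>F y in nhds x. (f has_real_derivative deriv f y) (at y)"
      by (rule real_analytic_on_deriv[OF Suc.prems(1,2)])
    show "vanishes m (deriv f) x"
    proof (rule Suc.IH)
      show "real_analytic_on (deriv f) L"
        unfolding real_analytic_on_def by (intro ballI real_analytic_on_deriv(2)[OF Suc.prems(1)])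
      show "(deriv ^^ j) (deriv f) x = 0" if "j < m" for j
        using Suc.prems(3)[of "Suc j"] that by (simp add: funpow_swap1)
    qed fact
  qed
qed simp

lemma analytic_zero_vanishes:
  assumes "real_analytic_on f L" "x \<in> L" "f x = 0"
  shows "vanishes 1 f x"
  using vanishes_if_higher_derivs_zero[OF assms(1,2), of 1] assms(3) by simp

lemma at_most_zeros_imp_zero_multiplicity_bound:
  assumes an: "real_analytic_on F L" and z: "at_most_zeros n F L" and L: "infinite L"
  defines "Z \<equiv> {x\<in>L. F x = 0}"
  shows "\<exists>x\<in>L. F x \<noteq> 0" "finite Z" "(\<Sum>x\<in>Z. zero_multiplicity F x) \<le> enat n"
proof -
  have v: "vanishes m F x" if "x \<in> L" "enat m \<le> zero_multiplicity F x" for m x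
  proof (rule vanishes_if_higher_derivs_zero[OF an that(1)])
    fix j assume j: "j < m"
    show "(deriv ^^ j) F x = 0"
    proof (rule ccontr)
      assume "(deriv ^^ j) F x \<noteq> 0"
      hence "zero_multiplicity F x \<le> enat j"
        unfolding zero_multiplicity_def by (intro INF_lower) auto
      hence "enat m \<le> enat j" using that(2) by (rule order_trans[rotated])
      thus False using j by simp
    qed
  qed
  have v1: "vanishes 1 F x" if "x \<in> Z" for x
    using vanishes_if_higher_derivs_zero[OF an, of x 1] that by (simp add: Z_def)
  show fin: "finite Z"
  proof (rule ccontr)
    assume "infinite Z"
    then obtain X where X: "X \<subseteq> Z" "finite X" "card X = Suc n"
      using infinite_arbitrarily_large by blast
    have "sum (\<lambda>_. 1) X \<le> n"
      using X v1 by (intro at_most_zerosD[OF z]) (auto simp: Z_def)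
    thus False using X by simp
  qed
  show "\<exists>x\<in>L. F x \<noteq> 0"
  proof (rule ccontr)
    assume "\<not> ?thesis"
    hence "Z = L" by (auto simp: Z_def)
    thus False using fin L by simp
  qed
  have finm: "zero_multiplicity F x \<noteq> \<infinity>" if x: "x \<in> Z" for x
  proof
    assume "zero_multiplicity F x = \<infinity>"
    hence "vanishes (Suc n) F x" using v[of x "Suc n"] x by (simp add: Z_def)
    hence "sum (\<lambda>_. Suc n) {x} \<le> n"
      using x by (intro at_most_zerosD[OF z]) (auto simp: Z_def)
    thus False by simp
  qed
  define \<mu> where "\<mu> = (\<lambda>x. the_enat (zero_multiplicity F x))"
  have \<mu>: "zero_multiplicity F x = enat (\<mu> x)" if "x \<in> Z" for x
    using finm[OF that] by (auto simp: \<mu>_def)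
  have "(\<Sum>x\<in>Z. zero_multiplicity F x) = (\<Sum>x\<in>Z. enat (\<mu> x))"
    using \<mu> by (intro sum.cong) auto
  also have "\<dots> = enat (sum \<mu> Z)"
    using fin by (induction Z rule: finite_induct) (auto simp: zero_enat_def)
  also have "sum \<mu> Z \<le> n"
    using fin v \<mu> by (intro at_most_zerosD[OF z]) (auto simp: Z_def)
  finally show "(\<Sum>x\<in>Z. zero_multiplicity F x) \<le> enat n" by simp
qed

section \<open>Real functions with a holomorphic extension\<close>

text \<open>Real analyticity on \<open>(-R, R)\<close> in the form of one holomorphic extension.  With it, analyticity of
an integral in its parameter is differentiation under the integral sign over complex parameters.\<close>

definition real_holomorphic :: "real \<Rightarrow> (real \<Rightarrow> real) \<Rightarrow> bool" where
  "real_holomorphic R G \<longleftrightarrow>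
     (\<exists>\<Omega> g. open \<Omega> \<and> g holomorphic_on \<Omega> \<and>
        (\<forall>z. \<bar>z\<bar> < R \<longrightarrow> complex_of_real z \<in> \<Omega> \<and> g (of_real z) = of_real (G z)))"

lemma real_holomorphicI:
  assumes "open \<Omega>" "g holomorphic_on \<Omega>" "\<And>z. \<bar>z\<bar> < R \<Longrightarrow> complex_of_real z \<in> \<Omega>"
    "\<And>z. \<bar>z\<bar> < R \<Longrightarrow> g (of_real z) = of_real (G z)"
  shows "real_holomorphic R G"
  unfolding real_holomorphic_def by (rule exI[of _ \<Omega>], rule exI[of _ g]) (use assms in simp)

lemma real_holomorphicE:
  assumes "real_holomorphic R G"
  obtains \<Omega> g where "open \<Omega>" "g holomorphic_on \<Omega>"
    "\<And>z. \<bar>z\<bar> < R \<Longrightarrow> complex_of_real z \<in> \<Omega> \<and> g (of_real z) = of_real (G z)"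
proof -
  from assms obtain \<Omega> where "\<exists>g. open \<Omega> \<and> g holomorphic_on \<Omega> \<and>
        (\<forall>z. \<bar>z\<bar> < R \<longrightarrow> complex_of_real z \<in> \<Omega> \<and> g (of_real z) = of_real (G z))"
    unfolding real_holomorphic_def by (rule exE)
  then obtain g where "open \<Omega> \<and> g holomorphic_on \<Omega> \<and>
        (\<forall>z. \<bar>z\<bar> < R \<longrightarrow> complex_of_real z \<in> \<Omega> \<and> g (of_real z) = of_real (G z))"
    by (rule exE)
  thus thesis by (intro that[of \<Omega> g]) simp_all
qed

lemma real_holomorphic_const: "real_holomorphic R (\<lambda>_. c)"
  by (rule real_holomorphicI[of UNIV "\<lambda>_. of_real c"]) auto

lemma real_holomorphic_ident: "real_holomorphic R (\<lambda>z. z)"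
  by (rule real_holomorphicI[of UNIV "\<lambda>z. z"]) auto

lemma real_holomorphic_add:
  assumes "real_holomorphic R F" "real_holomorphic R G"
  shows "real_holomorphic R (\<lambda>z. F z + G z)"
proof -
  obtain \<Omega> f where
    f: "open \<Omega>" "f holomorphic_on \<Omega>" "\<And>z. \<bar>z\<bar> < R \<Longrightarrow> complex_of_real z \<in> \<Omega> \<and> f (of_real z) = of_real (F z)"
    by (rule real_holomorphicE[OF assms(1)]) (rule that, simp_all)
  obtain \<Omega>' g where
    g: "open \<Omega>'" "g holomorphic_on \<Omega>'" "\<And>z. \<bar>z\<bar> < R \<Longrightarrow> complex_of_real z \<in> \<Omega>' \<and> g (of_real z) = of_real (G z)"
    by (rule real_holomorphicE[OF assms(2)]) (rule that, simp_all)
  show ?thesis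
    by (rule real_holomorphicI[of "\<Omega> \<inter> \<Omega>'" "\<lambda>z. f z + g z"])
      (use f g in \<open>auto intro!: holomorphic_intros elim: holomorphic_on_subset\<close>)
qed

lemma real_holomorphic_mult:
  assumes "real_holomorphic R F" "real_holomorphic R G"
  shows "real_holomorphic R (\<lambda>z. F z * G z)"
proof -
  obtain \<Omega> f where
    f: "open \<Omega>" "f holomorphic_on \<Omega>" "\<And>z. \<bar>z\<bar> < R \<Longrightarrow> complex_of_real z \<in> \<Omega> \<and> f (of_real z) = of_real (F z)"
    by (rule real_holomorphicE[OF assms(1)]) (rule that, simp_all)
  obtain \<Omega>' g where
    g: "open \<Omega>'" "g holomorphic_on \<Omega>'" "\<And>z. \<bar>z\<bar> < R \<Longrightarrow> complex_of_real z \<in> \<Omega>' \<and> g (of_real z) = of_real (G z)"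
    by (rule real_holomorphicE[OF assms(2)]) (rule that, simp_all)
  show ?thesis
    by (rule real_holomorphicI[of "\<Omega> \<inter> \<Omega>'" "\<lambda>z. f z * g z"])
      (use f g in \<open>auto intro!: holomorphic_intros elim: holomorphic_on_subset\<close>)
qed

lemma real_holomorphic_cong:
  assumes "real_holomorphic R F" "\<And>z. \<bar>z\<bar> < R \<Longrightarrow> F z = G z"
  shows "real_holomorphic R G"
proof -
  obtain \<Omega> f where
    f: "open \<Omega>" "f holomorphic_on \<Omega>" "\<And>z. \<bar>z\<bar> < R \<Longrightarrow> complex_of_real z \<in> \<Omega> \<and> f (of_real z) = of_real (F z)"
    by (rule real_holomorphicE[OF assms(1)]) (rule that, simp_all)
  show ?thesis
    by (rule real_holomorphicI[of \<Omega> f]) (use f assms(2) in auto)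
qed

lemma real_holomorphic_power:
  "real_holomorphic R F \<Longrightarrow> real_holomorphic R (\<lambda>z. F z ^ n)"
  by (induction n) (auto intro: real_holomorphic_const real_holomorphic_mult)

lemma real_holomorphic_inverse:
  assumes "real_holomorphic R F" "\<And>z. \<bar>z\<bar> < R \<Longrightarrow> F z \<noteq> 0"
  shows "real_holomorphic R (\<lambda>z. inverse (F z))"
proof -
  obtain \<Omega> f where
    f: "open \<Omega>" "f holomorphic_on \<Omega>" "\<And>z. \<bar>z\<bar> < R \<Longrightarrow> complex_of_real z \<in> \<Omega> \<and> f (of_real z) = of_real (F z)"
    by (rule real_holomorphicE[OF assms(1)]) (rule that, simp_all)
  show ?thesis
  proof (rule real_holomorphicI[of "\<Omega> \<inter> f -` (- {0})" "\<lambda>z. inverse (f z)"])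
    show "open (\<Omega> \<inter> f -` (- {0}))"
      by (rule continuous_open_preimage[OF holomorphic_on_imp_continuous_on[OF f(2)] f(1)]) auto
    have "f holomorphic_on (\<Omega> \<inter> f -` (- {0}))"
      by (rule holomorphic_on_subset[OF f(2)]) auto
    thus "(\<lambda>z. inverse (f z)) holomorphic_on \<Omega> \<inter> f -` (- {0})"
      by (rule holomorphic_on_inverse) auto
  qed (use f(3) assms(2) in auto)
qed

lemma real_holomorphic_shift:
  assumes "real_holomorphic R L"
  shows "real_holomorphic R (\<lambda>z. (z\<^sup>2 - c) * L z)"
proof -
  have "real_holomorphic R (\<lambda>z. (z * z + - c) * L z)"
    by (intro real_holomorphic_mult real_holomorphic_add real_holomorphic_ident
        real_holomorphic_const assms)
  thus ?thesis by (simp add: power2_eq_square)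
qed

lemma real_holomorphic_reflect:
  assumes "real_holomorphic R F"
  shows "real_holomorphic R (\<lambda>z. F (- z))"
proof -
  obtain \<Omega> f where
    f: "open \<Omega>" "f holomorphic_on \<Omega>" "\<And>z. \<bar>z\<bar> < R \<Longrightarrow> complex_of_real z \<in> \<Omega> \<and> f (of_real z) = of_real (F z)"
    by (rule real_holomorphicE[OF assms]) (rule that, simp_all)
  show ?thesis
  proof (rule real_holomorphicI[of "uminus ` \<Omega>" "\<lambda>z. f (- z)"])
    show "(\<lambda>z. f (- z)) holomorphic_on uminus ` \<Omega>"
      by (rule holomorphic_on_compose_gen[of uminus _ f \<Omega>, unfolded o_def])
        (use f in \<open>auto intro!: holomorphic_intros\<close>)
    show "complex_of_real z \<in> uminus ` \<Omega>" if "\<bar>z\<bar> < R" for z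
      using f(3)[of "-z"] that by (intro image_eqI[of _ _ "- complex_of_real z"]) simp_all
    show "f (- complex_of_real z) = complex_of_real (F (- z))" if "\<bar>z\<bar> < R" for z
      using f(3)[of "-z"] that by auto
  qed (use f in \<open>auto intro: open_negations\<close>)
qed

lemma real_holomorphic_deriv:
  assumes "real_holomorphic R F"
  obtains F' where "real_holomorphic R F'" "\<And>z. \<bar>z\<bar> < R \<Longrightarrow> (F has_real_derivative F' z) (at z)"
proof -
  obtain \<Omega> f where
    f: "open \<Omega>" "f holomorphic_on \<Omega>" "\<And>z. \<bar>z\<bar> < R \<Longrightarrow> complex_of_real z \<in> \<Omega> \<and> f (of_real z) = of_real (F z)"
    by (rule real_holomorphicE[OF assms]) (rule that, simp_all)
  define F' where "F' = (\<lambda>z. Re (deriv f (of_real z)))"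
  have cd: "((\<lambda>x. complex_of_real (F x)) has_vector_derivative deriv f (of_real z)) (at z)" if z: "\<bar>z\<bar> < R" for z
  proof -
    have "(f has_field_derivative deriv f (of_real z)) (at (of_real z))"
      using f(3)[OF z] by (intro holomorphic_derivI[OF f(2,1)]) simp
    hence "((\<lambda>x. f (complex_of_real x)) has_vector_derivative deriv f (of_real z)) (at z)"
      by (rule has_vector_derivative_real_field)
    thus ?thesis
      by (rule has_vector_derivative_transform_within_open[where S = "{-R<..<R}"]) (use f z in auto)
  qed
  have re: "(F has_real_derivative F' z) (at z)" if z: "\<bar>z\<bar> < R" for z
  proof -
    have "((\<lambda>x. Re (complex_of_real (F x))) has_vector_derivative Re (deriv f (of_real z))) (at z)"
      by (rule bounded_linear.has_vector_derivative[OF bounded_linear_Re cd[OF z]])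
    thus ?thesis by (simp add: F'_def has_real_derivative_iff_has_vector_derivative)
  qed
  have im: "deriv f (of_real z) = of_real (F' z)" if z: "\<bar>z\<bar> < R" for z
  proof -
    have "((\<lambda>x. Im (complex_of_real (F x))) has_vector_derivative Im (deriv f (of_real z))) (at z)"
      by (rule bounded_linear.has_vector_derivative[OF bounded_linear_Im cd[OF z]])
    hence "((\<lambda>x. 0::real) has_vector_derivative Im (deriv f (of_real z))) (at z)" by simp
    hence "Im (deriv f (of_real z)) = 0"
      by (rule vector_derivative_unique_at) (rule has_vector_derivative_const)
    thus ?thesis by (simp add: F'_def complex_eq_iff)
  qed
  show thesis
  proof (rule that[OF _ re])
    show "real_holomorphic R F'"
      by (rule real_holomorphicI[of \<Omega> "deriv f"]) (use f im in \<open>auto intro: holomorphic_deriv\<close>)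
  qed
qed

lemma DERIV_imp_continuous_on_centred:
  fixes G :: "real \<Rightarrow> real"
  assumes der: "\<And>z. \<bar>z\<bar> < R \<Longrightarrow> (G has_real_derivative G' z) (at z)"
  shows "continuous_on {-R<..<R} G"
proof (intro continuous_at_imp_continuous_on ballI)
  fix z assume "z \<in> {-R<..<R}"
  hence "\<bar>z\<bar> < R" by auto
  from der[OF this] show "isCont G z" by (rule DERIV_isCont)
qed

lemma real_holomorphic_continuous:
  assumes "real_holomorphic R F"
  shows "continuous_on {-R<..<R} F"
proof -
  obtain F' where "\<And>z. \<bar>z\<bar> < R \<Longrightarrow> (F has_real_derivative F' z) (at z)"
    using real_holomorphic_deriv[OF assms] by blast
  thus ?thesis
    by (rule DERIV_imp_continuous_on_centred)
qed

section \<open>Integrals over concentric circles\<close>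

definition circle_mean :: "nat \<Rightarrow> (real \<Rightarrow> real) \<Rightarrow> real \<Rightarrow> real" where
  "circle_mean k G r = integral {0..pi} (\<lambda>\<theta>. G (r * cos \<theta>) * sin \<theta> ^ (2 * k))"

text \<open>The substitution \<open>z = sqrt (2h) cos \<theta>\<close> shows that this is the integral of
\<open>G(z) (2h - z\<^sup>2)\<^sup>k\<^sup>-\<^sup>1\<^sup>/\<^sup>2\<close> over \<open>\<bar>z\<bar> \<le> sqrt (2h)\<close>.  In the angular form
the interval is fixed and the integrand is smooth, even for \<open>k = 0\<close>.\<close>

definition oval_integral :: "nat \<Rightarrow> (real \<Rightarrow> real) \<Rightarrow> real \<Rightarrow> real" where
  "oval_integral k G h = (2 * h) ^ k * circle_mean k G (sqrt (2 * h))"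

lemma abs_mult_cos_less: "\<bar>r\<bar> < R \<Longrightarrow> \<bar>r * cos \<theta>\<bar> < (R::real)"
  using abs_cos_le_one[of \<theta>] mult_left_mono[of "\<bar>cos \<theta>\<bar>" 1 "\<bar>r\<bar>"] by (simp add: abs_mult)

lemma continuous_on_circle:
  fixes G :: "real \<Rightarrow> real"
  assumes "continuous_on {-R<..<R} G" "\<bar>r\<bar> < R"
  shows "continuous_on A (\<lambda>\<theta>. G (r * cos \<theta>))"
proof (rule continuous_on_compose2[OF assms(1), of A "\<lambda>\<theta>. r * cos \<theta>"])
  show "(\<lambda>\<theta>. r * cos \<theta>) ` A \<subseteq> {-R<..<R}"
    using abs_mult_cos_less[OF assms(2)] unfolding abs_less_iff by (auto simp: minus_less_iff)
qed (intro continuous_intros)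

lemma circle_mean_integrable:
  fixes G :: "real \<Rightarrow> real"
  assumes "continuous_on {-R<..<R} G" "\<bar>r\<bar> < R"
  shows "(\<lambda>\<theta>. G (r * cos \<theta>) * sin \<theta> ^ n) integrable_on {0..pi}"
  by (intro integrable_continuous_real continuous_intros continuous_on_circle[OF assms])

lemma circle_mean_DERIV:
  assumes der: "\<And>z. \<bar>z\<bar> < R \<Longrightarrow> (G has_real_derivative G' z) (at z)"
    and cont: "continuous_on {-R<..<R} G'" and r: "\<bar>r\<bar> < R"
  shows "(circle_mean k G has_real_derivative
           integral {0..pi} (\<lambda>\<theta>. G' (r * cos \<theta>) * cos \<theta> * sin \<theta> ^ (2 * k))) (at r)"
proof -
  have G: "continuous_on {-R<..<R} G"
    using der by (rule DERIV_imp_continuous_on_centred)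
  have "((\<lambda>r. integral (cbox 0 pi) (\<lambda>\<theta>. G (r * cos \<theta>) * sin \<theta> ^ (2 * k))) has_real_derivative
      integral (cbox 0 pi) (\<lambda>\<theta>. G' (r * cos \<theta>) * cos \<theta> * sin \<theta> ^ (2 * k))) (at r within {-R<..<R})"
  proof (rule leibniz_rule_field_derivative)
    fix x \<theta> assume x: "x \<in> {-R<..<R}"
    have "(G has_real_derivative G' (x * cos \<theta>)) (at (x * cos \<theta>))"
      using der abs_mult_cos_less[of x R \<theta>] x by auto
    hence "((\<lambda>x. G (x * cos \<theta>)) has_real_derivative G' (x * cos \<theta>) * cos \<theta>) (at x)"
      by (rule DERIV_chain2) (auto intro!: derivative_eq_intros)
    thus "((\<lambda>x. G (x * cos \<theta>) * sin \<theta> ^ (2 * k)) has_real_derivative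
        G' (x * cos \<theta>) * cos \<theta> * sin \<theta> ^ (2 * k)) (at x within {-R<..<R})"
      by (intro has_field_derivative_at_within[OF DERIV_cmult_right])
  next
    fix x assume x: "x \<in> {-R<..<R}"
    show "(\<lambda>\<theta>. G (x * cos \<theta>) * sin \<theta> ^ (2 * k)) integrable_on cbox 0 pi"
      using circle_mean_integrable[OF G, of x] x by auto
  next
    have "continuous_on ({-R<..<R} \<times> cbox 0 pi) (\<lambda>p. G' (fst p * cos (snd p)))"
    proof (rule continuous_on_compose2[OF cont])
      show "(\<lambda>p. fst p * cos (snd p)) ` ({-R<..<R} \<times> cbox 0 pi) \<subseteq> {-R<..<R}"
      proof clarsimp
        fix a b :: real assume "- R < a" "a < R"
        hence "\<bar>a * cos b\<bar> < R" by (intro abs_mult_cos_less) auto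
        thus "- R < a * cos b \<and> a * cos b < R" by linarith
      qed
    qed (intro continuous_intros)
    thus "continuous_on ({-R<..<R} \<times> cbox 0 pi) (\<lambda>(x, \<theta>). G' (x * cos \<theta>) * cos \<theta> * sin \<theta> ^ (2 * k))"
      by (auto simp: split_beta intro!: continuous_intros)
  qed (use r in auto)
  moreover have "at r within {-R<..<R} = at r" using r by (intro at_within_open) auto
  ultimately show ?thesis unfolding circle_mean_def by simp
qed

text \<open>Formally this differentiates the power in \<open>G(z) (2h - z\<^sup>2)\<^sup>k\<^sup>+\<^sup>1\<^sup>/\<^sup>2\<close>.  In the angular form the
chain rule produces \<open>G'\<close>, which integration by parts in \<open>\<theta>\<close> removes again.\<close>

lemma oval_integral_DERIV:
  assumes G: "real_holomorphic R G" and h: "0 < h" "h < R\<^sup>2 / 2" and R: "R > 0"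
  shows "(oval_integral (Suc k) G has_real_derivative (2 * k + 1) * oval_integral k G h) (at h)"
proof -
  obtain G' where G': "real_holomorphic R G'" "\<And>z. \<bar>z\<bar> < R \<Longrightarrow> (G has_real_derivative G' z) (at z)"
    using real_holomorphic_deriv[OF G] by blast
  note cG = real_holomorphic_continuous[OF G] and cG' = real_holomorphic_continuous[OF G'(1)]
  define r where "r = sqrt (2 * h)"
  have r: "r > 0" "r\<^sup>2 = 2 * h" using h by (auto simp: r_def)
  have "r\<^sup>2 < R\<^sup>2" using r h by simp
  hence rR: "\<bar>r\<bar> < R" using R r(1) by (simp add: power2_less_imp_less)
  define A where "A = integral {0..pi} (\<lambda>\<theta>. G' (r * cos \<theta>) * cos \<theta> * sin \<theta> ^ (2 * Suc k))"
  define B where "B = circle_mean (Suc k) G r"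
  define C where "C = circle_mean k G r"
  have iA: "((\<lambda>\<theta>. G' (r * cos \<theta>) * cos \<theta> * sin \<theta> ^ (2 * Suc k)) has_integral A) {0..pi}"
    unfolding A_def by (intro integrable_integral integrable_continuous_real continuous_intros
      continuous_on_circle[OF cG' rR])
  have iB: "((\<lambda>\<theta>. G (r * cos \<theta>) * sin \<theta> ^ (2 * Suc k)) has_integral B) {0..pi}"
    unfolding B_def circle_mean_def by (intro integrable_integral circle_mean_integrable[OF cG rR])
  have iC: "((\<lambda>\<theta>. G (r * cos \<theta>) * sin \<theta> ^ (2 * k)) has_integral C) {0..pi}"
    unfolding C_def circle_mean_def by (intro integrable_integral circle_mean_integrable[OF cG rR])
  have "((\<lambda>\<theta>. (2 * k + 1) * (G (r * cos \<theta>) * sin \<theta> ^ (2 * k))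
       - (2 * k + 2) * (G (r * cos \<theta>) * sin \<theta> ^ (2 * Suc k))
       - r * (G' (r * cos \<theta>) * cos \<theta> * sin \<theta> ^ (2 * Suc k))) has_integral
      (2 * k + 1) * C - (2 * k + 2) * B - r * A) {0..pi}"
    by (intro has_integral_diff has_integral_mult_right iA iB iC)
  moreover have "((\<lambda>\<theta>. (2 * k + 1) * (G (r * cos \<theta>) * sin \<theta> ^ (2 * k))
       - (2 * k + 2) * (G (r * cos \<theta>) * sin \<theta> ^ (2 * Suc k))
       - r * (G' (r * cos \<theta>) * cos \<theta> * sin \<theta> ^ (2 * Suc k))) has_integral
      G (r * cos pi) * cos pi * sin pi ^ (2 * k + 1) - G (r * cos 0) * cos 0 * sin 0 ^ (2 * k + 1)) {0..pi}"
  proof (rule fundamental_theorem_of_calculus)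
    fix \<theta> :: real
    have "(G has_real_derivative G' (r * cos \<theta>)) (at (r * cos \<theta>))"
      using G'(2) abs_mult_cos_less[OF rR] by blast
    hence "((\<lambda>\<theta>. G (r * cos \<theta>)) has_real_derivative G' (r * cos \<theta>) * (- (r * sin \<theta>))) (at \<theta>)"
      by (rule DERIV_chain2) (auto intro!: derivative_eq_intros)
    note d = this
    have "((\<lambda>\<theta>. sin \<theta> ^ (2 * k + 1)) has_real_derivative (2 * k + 1) * sin \<theta> ^ (2 * k) * cos \<theta>) (at \<theta>)"
      by (rule derivative_eq_intros refl)+ simp
    from DERIV_mult[OF DERIV_mult[OF d DERIV_cos] this]
    have "((\<lambda>\<theta>. G (r * cos \<theta>) * cos \<theta> * sin \<theta> ^ (2 * k + 1)) has_real_derivative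
       (G' (r * cos \<theta>) * (- (r * sin \<theta>)) * cos \<theta> + G (r * cos \<theta>) * (- sin \<theta>)) * sin \<theta> ^ (2 * k + 1)
        + G (r * cos \<theta>) * cos \<theta> * ((2 * k + 1) * sin \<theta> ^ (2 * k) * cos \<theta>)) (at \<theta>)"
      by (simp add: algebra_simps)
    moreover have "(G' (r * cos \<theta>) * (- (r * sin \<theta>)) * cos \<theta> + G (r * cos \<theta>) * (- sin \<theta>)) * sin \<theta> ^ (2 * k + 1)
        + G (r * cos \<theta>) * cos \<theta> * ((2 * k + 1) * sin \<theta> ^ (2 * k) * cos \<theta>)
       = (2 * k + 1) * (G (r * cos \<theta>) * sin \<theta> ^ (2 * k))
       - (2 * k + 2) * (G (r * cos \<theta>) * sin \<theta> ^ (2 * Suc k))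
       - r * (G' (r * cos \<theta>) * cos \<theta> * sin \<theta> ^ (2 * Suc k))"
    proof -
      have c: "cos \<theta> * cos \<theta> = 1 - sin \<theta> * sin \<theta>"
        using sin_cos_squared_add[of \<theta>] by (simp add: power2_eq_square)
      have "G (r * cos \<theta>) * cos \<theta> * ((2 * k + 1) * sin \<theta> ^ (2 * k) * cos \<theta>)
        = (2 * k + 1) * G (r * cos \<theta>) * sin \<theta> ^ (2 * k) * (cos \<theta> * cos \<theta>)"
        by (simp only: ac_simps)
      thus ?thesis unfolding c by (simp add: algebra_simps)
    qed
    ultimately show "((\<lambda>\<theta>. G (r * cos \<theta>) * cos \<theta> * sin \<theta> ^ (2 * k + 1)) has_vector_derivative
       (2 * k + 1) * (G (r * cos \<theta>) * sin \<theta> ^ (2 * k))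
       - (2 * k + 2) * (G (r * cos \<theta>) * sin \<theta> ^ (2 * Suc k))
       - r * (G' (r * cos \<theta>) * cos \<theta> * sin \<theta> ^ (2 * Suc k))) (at \<theta> within {0..pi})"
      by (simp only: has_real_derivative_iff_has_vector_derivative[symmetric])
        (rule has_field_derivative_at_within, simp)
  qed simp
  ultimately have "(2 * k + 1) * C - (2 * k + 2) * B - r * A =
      G (r * cos pi) * cos pi * sin pi ^ (2 * k + 1) - G (r * cos 0) * cos 0 * sin 0 ^ (2 * k + 1)"
    by (rule has_integral_unique)
  hence parts: "r * A = (2 * k + 1) * C - (2 * k + 2) * B" by simp
  have "(circle_mean (Suc k) G has_real_derivative A) (at (sqrt (2 * h)))"
    using circle_mean_DERIV[OF G'(2) cG' rR, of "Suc k"] by (simp add: A_def r_def)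
  hence "((\<lambda>h. circle_mean (Suc k) G (sqrt (2 * h))) has_real_derivative A * (1 / r)) (at h)"
    by (rule DERIV_chain2) (use h in \<open>auto intro!: derivative_eq_intros simp: r_def field_simps\<close>)
  note d = this
  have "((\<lambda>h. (2 * h) ^ Suc k) has_real_derivative 2 * (Suc k) * (2 * h) ^ k) (at h)"
    by (rule derivative_eq_intros refl)+ simp
  from DERIV_mult[OF this d]
  have "((\<lambda>h. (2 * h) ^ Suc k * circle_mean (Suc k) G (sqrt (2 * h))) has_real_derivative
     (2 * h) ^ Suc k * (A * (1 / r)) + (2 * (Suc k) * (2 * h) ^ k) * B) (at h)"
    by (simp add: B_def r_def mult.commute add.commute)
  also have "(2 * h) ^ Suc k * (A * (1 / r)) + (2 * (Suc k) * (2 * h) ^ k) * B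
    = (2 * h) ^ k * (r * A + (2 * k + 2) * B)"
    using r by (simp add: r(2)[symmetric] power2_eq_square field_simps)
  also have "\<dots> = (2 * k + 1) * oval_integral k G h"
    unfolding parts by (simp add: oval_integral_def C_def r_def)
  finally show ?thesis unfolding oval_integral_def[abs_def] by (simp only: of_nat_add of_nat_mult of_nat_numeral of_nat_1)
qed


lemma circle_mean_add:
  fixes F G :: "real \<Rightarrow> real"
  assumes "continuous_on {-R<..<R} F" "continuous_on {-R<..<R} G" "\<bar>r\<bar> < R"
  shows "circle_mean k (\<lambda>z. a * F z + b * G z) r = a * circle_mean k F r + b * circle_mean k G r"
proof -
  have "((\<lambda>\<theta>. a * (F (r * cos \<theta>) * sin \<theta> ^ (2 * k)) + b * (G (r * cos \<theta>) * sin \<theta> ^ (2 * k)))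
    has_integral a * circle_mean k F r + b * circle_mean k G r) {0..pi}"
    unfolding circle_mean_def
    by (intro has_integral_add has_integral_mult_right integrable_integral
        circle_mean_integrable[of R] assms)
  thus ?thesis unfolding circle_mean_def by (intro integral_unique) (simp add: algebra_simps)
qed

lemma sqrt_level_less:
  assumes "0 < h" "h < R\<^sup>2 / 2" "R > 0"
  shows "\<bar>sqrt (2 * h)\<bar> < R"
proof -
  have "sqrt (2 * h) < sqrt (R\<^sup>2)" using assms by (intro real_sqrt_less_mono) auto
  thus ?thesis using assms by simp
qed

lemma oval_integral_add:
  fixes F G :: "real \<Rightarrow> real"
  assumes "real_holomorphic R F" "real_holomorphic R G" "0 < h" "h < R\<^sup>2 / 2" "R > 0"
  shows "oval_integral k (\<lambda>z. a * F z + b * G z) h = a * oval_integral k F h + b * oval_integral k G h"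
  unfolding oval_integral_def
  using circle_mean_add[OF real_holomorphic_continuous[OF assms(1)] real_holomorphic_continuous[OF assms(2)]
      sqrt_level_less[OF assms(3-5)]]
  by (simp add: algebra_simps)

text \<open>In terms of the kernel: \<open>z\<^sup>2 - c = (2h - c) - (2h - z\<^sup>2)\<close>.\<close>

lemma oval_integral_shift:
  fixes G :: "real \<Rightarrow> real"
  assumes "real_holomorphic R G" "0 < h" "h < R\<^sup>2 / 2" "R > 0"
  shows "oval_integral k (\<lambda>z. (z\<^sup>2 - c) * G z) h = (2 * h - c) * oval_integral k G h - oval_integral (Suc k) G h"
proof -
  define r where "r = sqrt (2 * h)"
  have r: "r\<^sup>2 = 2 * h" "\<bar>r\<bar> < R"
    using assms sqrt_level_less[OF assms(2-4)] by (auto simp: r_def)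
  note i = circle_mean_integrable[OF real_holomorphic_continuous[OF assms(1)] r(2)]
  have "((\<lambda>\<theta>. (r\<^sup>2 - c) * (G (r * cos \<theta>) * sin \<theta> ^ (2 * k)) - r\<^sup>2 * (G (r * cos \<theta>) * sin \<theta> ^ (2 * Suc k)))
    has_integral (r\<^sup>2 - c) * circle_mean k G r - r\<^sup>2 * circle_mean (Suc k) G r) {0..pi}"
    unfolding circle_mean_def
    by (intro has_integral_diff has_integral_mult_right integrable_integral i)
  moreover have "(r\<^sup>2 - c) * (G (r * cos \<theta>) * sin \<theta> ^ (2 * k)) - r\<^sup>2 * (G (r * cos \<theta>) * sin \<theta> ^ (2 * Suc k))
    = ((r * cos \<theta>)\<^sup>2 - c) * G (r * cos \<theta>) * sin \<theta> ^ (2 * k)" for \<theta>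
    by (simp add: power_mult_distrib cos_squared_eq algebra_simps) (simp add: power2_eq_square)
  ultimately have "circle_mean k (\<lambda>z. (z\<^sup>2 - c) * G z) r = (r\<^sup>2 - c) * circle_mean k G r - r\<^sup>2 * circle_mean (Suc k) G r"
    unfolding circle_mean_def by (intro integral_unique) simp
  thus ?thesis by (simp add: oval_integral_def r_def[symmetric] r(1)) (simp add: algebra_simps)
qed

text \<open>Integration by parts against the antiderivative of \<open>z (2h - z\<^sup>2)\<^sup>k\<^sup>-\<^sup>1\<^sup>/\<^sup>2\<close>; this is how the
exponent of the kernel is raised without changing \<open>h\<close>.\<close>

lemma oval_integral_by_parts:
  fixes K :: "real \<Rightarrow> real"
  assumes "real_holomorphic R K'" "\<And>z. \<bar>z\<bar> < R \<Longrightarrow> (K has_real_derivative K' z) (at z)"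
    and h: "0 < h" "h < R\<^sup>2 / 2" "R > 0"
  shows "oval_integral (Suc k) K' h = (2 * k + 1) * oval_integral k (\<lambda>z. z * K z) h"
proof -
  define r where "r = sqrt (2 * h)"
  have r: "r\<^sup>2 = 2 * h" "r > 0" "\<bar>r\<bar> < R"
    using h sqrt_level_less[OF h] by (auto simp: r_def)
  have cK: "continuous_on {-R<..<R} K"
    using assms(2) by (rule DERIV_imp_continuous_on_centred)
  have czK: "continuous_on {-R<..<R} (\<lambda>z. z * K z)"
    by (intro continuous_intros cK)
  note i' = circle_mean_integrable[OF real_holomorphic_continuous[OF assms(1)] r(3)]
  note i = circle_mean_integrable[OF czK r(3)]
  have "((\<lambda>\<theta>. (2 * k + 1) / r * (r * cos \<theta> * K (r * cos \<theta>) * sin \<theta> ^ (2 * k))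
       - r * (K' (r * cos \<theta>) * sin \<theta> ^ (2 * Suc k)))
    has_integral (2 * k + 1) / r * circle_mean k (\<lambda>z. z * K z) r - r * circle_mean (Suc k) K' r) {0..pi}"
    unfolding circle_mean_def
    by (intro has_integral_diff has_integral_mult_right integrable_integral i i')
  moreover have "((\<lambda>\<theta>. (2 * k + 1) / r * (r * cos \<theta> * K (r * cos \<theta>) * sin \<theta> ^ (2 * k))
       - r * (K' (r * cos \<theta>) * sin \<theta> ^ (2 * Suc k)))
    has_integral K (r * cos pi) * sin pi ^ (2 * k + 1) - K (r * cos 0) * sin 0 ^ (2 * k + 1)) {0..pi}"
  proof (rule fundamental_theorem_of_calculus)
    fix \<theta> :: real
    have "(K has_real_derivative K' (r * cos \<theta>)) (at (r * cos \<theta>))"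
      using assms(2) abs_mult_cos_less[OF r(3)] by blast
    hence d: "((\<lambda>\<theta>. K (r * cos \<theta>)) has_real_derivative K' (r * cos \<theta>) * (- (r * sin \<theta>))) (at \<theta>)"
      by (rule DERIV_chain2) (auto intro!: derivative_eq_intros)
    have "((\<lambda>\<theta>. sin \<theta> ^ (2 * k + 1)) has_real_derivative (2 * k + 1) * sin \<theta> ^ (2 * k) * cos \<theta>) (at \<theta>)"
      by (rule derivative_eq_intros refl)+ simp
    from DERIV_mult[OF d this]
    have "((\<lambda>\<theta>. K (r * cos \<theta>) * sin \<theta> ^ (2 * k + 1)) has_real_derivative
      (2 * k + 1) / r * (r * cos \<theta> * K (r * cos \<theta>) * sin \<theta> ^ (2 * k))
       - r * (K' (r * cos \<theta>) * sin \<theta> ^ (2 * Suc k))) (at \<theta>)"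
      by (rule DERIV_cong) (use r(2) in \<open>simp add: field_simps\<close>)
    thus "((\<lambda>\<theta>. K (r * cos \<theta>) * sin \<theta> ^ (2 * k + 1)) has_vector_derivative
      (2 * k + 1) / r * (r * cos \<theta> * K (r * cos \<theta>) * sin \<theta> ^ (2 * k))
       - r * (K' (r * cos \<theta>) * sin \<theta> ^ (2 * Suc k))) (at \<theta> within {0..pi})"
      by (simp only: has_real_derivative_iff_has_vector_derivative[symmetric])
        (rule has_field_derivative_at_within, simp)
  qed simp
  ultimately have "(2 * k + 1) / r * circle_mean k (\<lambda>z. z * K z) r - r * circle_mean (Suc k) K' r =
      K (r * cos pi) * sin pi ^ (2 * k + 1) - K (r * cos 0) * sin 0 ^ (2 * k + 1)"
    by (rule has_integral_unique)
  hence "r\<^sup>2 * circle_mean (Suc k) K' r = (2 * k + 1) * circle_mean k (\<lambda>z. z * K z) r"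
    using r(2) by (simp add: field_simps power2_eq_square)
  hence "2 * h * circle_mean (Suc k) K' r = (2 * k + 1) * circle_mean k (\<lambda>z. z * K z) r"
    unfolding r(1) .
  hence "(2 * h) ^ k * (2 * h * circle_mean (Suc k) K' r) =
      (2 * h) ^ k * ((2 * k + 1) * circle_mean k (\<lambda>z. z * K z) r)"
    by (rule arg_cong)
  thus ?thesis unfolding oval_integral_def r_def[symmetric] by (simp add: mult.assoc mult.left_commute add.commute)
qed

text \<open>The reflection \<open>\<theta> \<mapsto> \<pi> - \<theta>\<close>.  Hence only the even part of a density contributes.\<close>

lemma oval_integral_reflect:
  "oval_integral k (\<lambda>z. G (- z)) h = oval_integral k G h"
proof -
  define r where "r = sqrt (2 * h)"
  define f where "f = (\<lambda>\<theta>. G (r * cos \<theta>) * sin \<theta> ^ (2 * k))"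
  have "circle_mean k (\<lambda>z. G (- z)) r = integral {0..pi} (\<lambda>\<theta>. f (pi - \<theta>))"
    by (simp add: circle_mean_def f_def)
  also have "\<dots> = integral {- pi..- 0} (\<lambda>\<theta>. f (pi - (- \<theta>)))"
    by (rule Henstock_Kurzweil_Integration.integral_reflect_real[symmetric])
  also have "\<dots> = integral {pi * 0 - pi..pi - pi} (\<lambda>\<theta>. f (\<theta> + pi))"
    by (simp only: diff_minus_eq_add add.commute[of pi] minus_zero mult_zero_right diff_self diff_0)
  also have "\<dots> = integral {0..pi} f"
    using integral_shift_real_ivl[of "pi * 0" pi pi f] by (simp only: mult_zero_right)
  finally show ?thesis by (simp add: oval_integral_def circle_mean_def f_def r_def)
qed

lemma oval_integral_pos:
  fixes G :: "real \<Rightarrow> real"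
  assumes G: "real_holomorphic R G" and h: "0 < h" "h < R\<^sup>2 / 2" "R > 0"
    and nonneg: "\<And>z. \<bar>z\<bar> \<le> sqrt (2 * h) \<Longrightarrow> G z \<ge> 0"
    and w: "\<bar>w\<bar> < sqrt (2 * h)" "G w \<noteq> 0"
  shows "oval_integral k G h > 0"
proof -
  define r where "r = sqrt (2 * h)"
  have r: "r\<^sup>2 = 2 * h" "r > 0" "\<bar>r\<bar> < R"
    using h sqrt_level_less[OF h] by (auto simp: r_def)
  have cont: "continuous_on {0..pi} (\<lambda>\<theta>. G (r * cos \<theta>) * sin \<theta> ^ (2 * k))"
    by (intro continuous_intros continuous_on_circle[OF real_holomorphic_continuous[OF G] r(3)])
  have le: "\<bar>r * cos \<theta>\<bar> \<le> sqrt (2 * h)" for \<theta>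
    using r(2) abs_cos_le_one[of \<theta>] mult_left_mono[of "\<bar>cos \<theta>\<bar>" 1 "\<bar>r\<bar>"] by (simp add: abs_mult r_def)
  have ge: "G (r * cos \<theta>) * sin \<theta> ^ (2 * k) \<ge> 0" for \<theta>
    using nonneg[OF le] by (intro mult_nonneg_nonneg) (auto simp: power_mult)
  have "circle_mean k G r \<ge> 0"
    unfolding circle_mean_def using ge
    by (intro integral_nonneg integrable_continuous_real cont) auto
  moreover have "circle_mean k G r \<noteq> 0"
  proof
    assume 0: "circle_mean k G r = 0"
    define \<theta> where "\<theta> = arccos (w / r)"
    have wr: "- 1 < w / r" "w / r < 1" using w(1) r(2) unfolding r_def[symmetric] abs_less_iff by (auto simp: field_simps)
    have \<theta>: "0 < \<theta>" "\<theta> < pi" "r * cos \<theta> = w"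
      using arccos_lt_bounded[OF wr] wr r(2) by (auto simp: \<theta>_def)
    have "G (r * cos \<theta>) * sin \<theta> ^ (2 * k) = 0"
      using integral_eq_0_iff[OF cont _ ge] 0 \<theta> unfolding circle_mean_def by auto
    thus False using \<theta> w(2) sin_gt_zero[of \<theta>] by simp
  qed
  ultimately show ?thesis using h by (simp add: oval_integral_def r_def)
qed

text \<open>The circle mean is holomorphic in complex radii near the given one, since \<open>r cos \<theta>\<close> stays
in the domain of the extension by compactness; \<open>h\<close> enters through a branch of the square root.\<close>

lemma oval_integral_analytic:
  fixes G :: "real \<Rightarrow> real"
  assumes G: "real_holomorphic R G" and R: "R > 0"
  shows "real_analytic_on (oval_integral k G) {0<..<R\<^sup>2 / 2}"
  unfolding real_analytic_on_def
proof
  fix h assume "h \<in> {0<..<R\<^sup>2 / 2}"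
  hence h: "0 < h" "h < R\<^sup>2 / 2" by auto
  obtain \<Omega> g where g: "open \<Omega>" "g holomorphic_on \<Omega>"
    "\<And>z. \<bar>z\<bar> < R \<Longrightarrow> complex_of_real z \<in> \<Omega> \<and> g (of_real z) = of_real (G z)"
    by (rule real_holomorphicE[OF G]) (rule that, simp_all)
  define r where "r = sqrt (2 * h)"
  have r: "r > 0" "\<bar>r\<bar> < R" using h sqrt_level_less[OF h R] by (auto simp: r_def)
  define C where "C = complex_of_real ` {-r..r}"
  have "compact C" unfolding C_def by (intro compact_continuous_image continuous_intros) auto
  moreover have "C \<subseteq> \<Omega>" using g(3) r by (auto simp: C_def)
  ultimately obtain e where e: "e > 0" "(\<Union>x\<in>C. ball x e) \<subseteq> \<Omega>"
    using compact_subset_open_imp_ball_epsilon_subset[of C \<Omega>] g(1) by metis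
  have in\<Omega>: "x * complex_of_real (cos \<theta>) \<in> \<Omega>" if x: "x \<in> ball (of_real r) e" for x \<theta>
  proof -
    have "\<bar>r * cos \<theta>\<bar> \<le> r"
      using r(1) abs_cos_le_one[of \<theta>] mult_left_mono[of "\<bar>cos \<theta>\<bar>" 1 r] by (simp add: abs_mult)
    hence "complex_of_real (r * cos \<theta>) \<in> C" unfolding C_def by (intro imageI) auto
    moreover have "dist (complex_of_real (r * cos \<theta>)) (x * of_real (cos \<theta>)) < e"
    proof -
      have "dist (complex_of_real (r * cos \<theta>)) (x * of_real (cos \<theta>)) = norm (complex_of_real r - x) * \<bar>cos \<theta>\<bar>"
        by (simp add: dist_norm norm_mult flip: left_diff_distrib)
      also have "\<dots> \<le> norm (complex_of_real r - x)"
        using abs_cos_le_one[of \<theta>] by (intro mult_left_le) auto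
      also have "\<dots> < e" using x by (simp add: dist_norm)
      finally show ?thesis .
    qed
    ultimately show ?thesis using e(2) by (auto simp only: subset_iff UN_iff mem_ball)
  qed
  define M where "M = (\<lambda>x. integral (cbox 0 pi) (\<lambda>\<theta>. g (x * complex_of_real (cos \<theta>)) * complex_of_real (sin \<theta> ^ (2 * k))))"
  have "M holomorphic_on ball (of_real r) e"
    unfolding M_def
  proof (rule leibniz_rule_holomorphic)
    fix x \<theta> assume x: "x \<in> ball (complex_of_real r) e"
    have "(g has_field_derivative deriv g (x * complex_of_real (cos \<theta>))) (at (x * complex_of_real (cos \<theta>)))"
      by (rule holomorphic_derivI[OF g(2,1) in\<Omega>[OF x]])
    hence "((\<lambda>x. g (x * complex_of_real (cos \<theta>))) has_field_derivative
        deriv g (x * complex_of_real (cos \<theta>)) * complex_of_real (cos \<theta>)) (at x)"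
      by (rule DERIV_chain2) (auto intro!: derivative_eq_intros)
    thus "((\<lambda>x. g (x * complex_of_real (cos \<theta>)) * complex_of_real (sin \<theta> ^ (2 * k))) has_field_derivative
        deriv g (x * complex_of_real (cos \<theta>)) * complex_of_real (cos \<theta>) * complex_of_real (sin \<theta> ^ (2 * k)))
        (at x within ball (complex_of_real r) e)"
      by (intro has_field_derivative_at_within[OF DERIV_cmult_right])
  next
    fix x assume x: "x \<in> ball (complex_of_real r) e"
    have "continuous_on (cbox 0 pi) (\<lambda>\<theta>. g (x * complex_of_real (cos \<theta>)))"
      by (rule continuous_on_compose2[OF holomorphic_on_imp_continuous_on[OF g(2)]])
        (use in\<Omega>[OF x] in \<open>auto intro!: continuous_intros\<close>)
    thus "(\<lambda>\<theta>. g (x * complex_of_real (cos \<theta>)) * complex_of_real (sin \<theta> ^ (2 * k))) integrable_on cbox 0 pi"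
      by (intro integrable_continuous continuous_intros)
  next
    have "continuous_on (ball (complex_of_real r) e \<times> cbox 0 pi)
       (\<lambda>p. deriv g (fst p * complex_of_real (cos (snd p))))"
      by (rule continuous_on_compose2[OF holomorphic_on_imp_continuous_on[OF holomorphic_deriv[OF g(2,1)]]])
        (use in\<Omega> in \<open>auto intro!: continuous_intros\<close>)
    thus "continuous_on (ball (complex_of_real r) e \<times> cbox 0 pi) (\<lambda>(x, \<theta>).
       deriv g (x * complex_of_real (cos \<theta>)) * complex_of_real (cos \<theta>) * complex_of_real (sin \<theta> ^ (2 * k)))"
      by (auto simp: split_beta intro!: continuous_intros)
  qed auto
  have "isCont csqrt (complex_of_real (2 * h))"
    using h by (intro continuous_at_csqrt) (simp add: complex_nonpos_Reals_iff)
  hence "isCont (\<lambda>w. csqrt (2 * w)) (complex_of_real h)"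
    by (intro isCont_o2[where f = "\<lambda>w. 2 * w" and g = csqrt] continuous_intros) simp
  moreover have "csqrt (2 * complex_of_real h) = complex_of_real r"
    using h csqrt_of_real_nonneg[of "complex_of_real (2 * h)"] by (simp add: r_def)
  ultimately obtain d where d: "d > 0" "\<And>w. dist w (complex_of_real h) < d \<Longrightarrow> dist (csqrt (2 * w)) (complex_of_real r) < e"
    unfolding continuous_at_eps_delta using e(1) by metis
  define \<rho> where "\<rho> = min d (min h (R\<^sup>2 / 2 - h))"
  have \<rho>: "\<rho> > 0" "\<rho> \<le> d" "\<rho> \<le> h" "\<rho> \<le> R\<^sup>2 / 2 - h" using d h by (auto simp: \<rho>_def)
  define F where "F = (\<lambda>w. (2 * w) ^ k * M (csqrt (2 * w)))"
  have Repos: "Re w > 0" if "w \<in> ball (complex_of_real h) \<rho>" for w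
  proof -
    have "\<bar>Re (complex_of_real h - w)\<bar> < \<rho>"
      using that abs_Re_le_cmod[of "complex_of_real h - w"] by (simp add: dist_norm)
    thus ?thesis using \<rho> by simp
  qed
  have "(\<lambda>w. M (csqrt (2 * w))) holomorphic_on ball (of_real h) \<rho>"
  proof (rule holomorphic_on_compose_gen[of "\<lambda>w. csqrt (2 * w)" _ M "ball (of_real r) e", unfolded o_def])
    show "(\<lambda>w. csqrt (2 * w)) holomorphic_on ball (of_real h) \<rho>"
    proof (rule holomorphic_on_csqrt')
      fix w assume "w \<in> ball (complex_of_real h) \<rho>"
      hence "Re (2 * w) > 0" using Repos by simp
      thus "2 * w \<notin> \<real>\<^sub>\<le>\<^sub>0" by (auto simp: complex_nonpos_Reals_iff)
    qed (intro holomorphic_intros)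
    show "(\<lambda>w. csqrt (2 * w)) ` ball (complex_of_real h) \<rho> \<subseteq> ball (complex_of_real r) e"
      using d(2) \<rho>(2) by (auto simp: dist_commute)
  qed fact
  hence F: "F holomorphic_on ball (of_real h) \<rho>"
    unfolding F_def by (intro holomorphic_intros)
  have FG: "F (of_real y) = of_real (oval_integral k G y)" if y: "\<bar>y - h\<bar> < \<rho>" for y
  proof -
    have y0: "0 < y" "y < R\<^sup>2 / 2" using y \<rho> by auto
    define s where "s = sqrt (2 * y)"
    have s: "\<bar>s\<bar> < R" using sqrt_level_less[OF y0 R] by (simp add: s_def)
    have cs: "csqrt (2 * complex_of_real y) = of_real s"
      using y0 csqrt_of_real_nonneg[of "complex_of_real (2 * y)"] by (simp add: s_def)
    have "M (of_real s) = integral {0..pi} (\<lambda>\<theta>. complex_of_real (G (s * cos \<theta>) * sin \<theta> ^ (2 * k)))"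
      unfolding M_def using g(3)[OF abs_mult_cos_less[OF s]] by simp
    also have "\<dots> = of_real (circle_mean k G s)"
    proof (rule integral_unique)
      have "((\<lambda>\<theta>. G (s * cos \<theta>) * sin \<theta> ^ (2 * k)) has_integral circle_mean k G s) {0..pi}"
        unfolding circle_mean_def
        by (intro integrable_integral circle_mean_integrable[OF real_holomorphic_continuous[OF G] s])
      from has_integral_linear[OF this bounded_linear_of_real]
      show "((\<lambda>\<theta>. complex_of_real (G (s * cos \<theta>) * sin \<theta> ^ (2 * k))) has_integral of_real (circle_mean k G s)) {0..pi}"
        by (simp add: o_def)
    qed
    finally show ?thesis by (simp add: F_def cs oval_integral_def s_def)
  qed
  define a where "a = (\<lambda>n. Re ((deriv ^^ n) F (of_real h) / fact n))"
  have "(\<lambda>n. a n * (y - h) ^ n) sums oval_integral k G y" if y: "\<bar>y - h\<bar> < \<rho>" for y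
  proof -
    have "complex_of_real y \<in> ball (of_real h) \<rho>"
      using y by (simp add: dist_norm abs_minus_commute norm_of_real flip: of_real_diff)
    from holomorphic_power_series[OF F this]
    have "(\<lambda>n. (deriv ^^ n) F (of_real h) / fact n * (of_real y - of_real h) ^ n) sums F (of_real y)" .
    hence "(\<lambda>n. Re ((deriv ^^ n) F (of_real h) / fact n * (of_real y - of_real h) ^ n)) sums Re (F (of_real y))"
      by (rule sums_Re)
    moreover have "Re ((deriv ^^ n) F (of_real h) / fact n * (of_real y - of_real h) ^ n) = a n * (y - h) ^ n" for n
    proof -
      have "(complex_of_real y - of_real h) ^ n = of_real ((y - h) ^ n)" by simp
      moreover have "Re (z * of_real t) = Re z * t" for z t by simp
      ultimately show ?thesis by (simp only: a_def)
    qed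
    ultimately show ?thesis by (simp only: FG[OF y] Re_complex_of_real)
  qed
  thus "\<exists>r>0. \<exists>a::nat \<Rightarrow> real. \<forall>y. \<bar>y - h\<bar> < r \<longrightarrow> (\<lambda>n. a n * (y - h) ^ n) sums oval_integral k G y"
    using \<rho>(1) by (intro exI[of _ \<rho>] conjI exI[of _ a]) auto
qed

section \<open>Sign changes of the density and zeros of the integral\<close>

lemma oval_integral_even_pos:
  assumes L: "real_holomorphic R L" and even: "\<And>z. L (- z) = L z"
    and fin: "finite {z \<in> {0<..<R}. L z = 0}"
    and h: "0 < h" "h < R\<^sup>2 / 2" "R > 0"
    and sgn: "\<And>z. 0 < z \<Longrightarrow> z < sqrt (2 * h) \<Longrightarrow> L z \<ge> 0"
  shows "oval_integral k L h > 0"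
proof -
  define r where "r = sqrt (2 * h)"
  have r: "0 < r" "r < R" using h sqrt_level_less[OF h] by (auto simp: r_def)
  have ge: "L z \<ge> 0" if "0 \<le> z" "z \<le> r" for z
  proof (rule continuous_ge_on_closure[where f = L and S = "{0<..<r}"])
    show "continuous_on (closure {0<..<r}) L"
      by (rule continuous_on_subset[OF real_holomorphic_continuous[OF L]]) (use r in auto)
  qed (use that r sgn in \<open>auto simp: r_def\<close>)
  have "infinite {0<..<r}" using r by simp
  hence "\<not> {0<..<r} \<subseteq> {z \<in> {0<..<R}. L z = 0}" using fin finite_subset by blast
  then obtain w where w: "w \<in> {0<..<r}" "L w \<noteq> 0" using r by force
  show ?thesis
  proof (rule oval_integral_pos[OF L h])
    show "L z \<ge> 0" if "\<bar>z\<bar> \<le> sqrt (2 * h)" for z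
      using ge[of "\<bar>z\<bar>"] that even[of z] by (auto simp: r_def abs_if split: if_splits)
    show "\<bar>w\<bar> < sqrt (2 * h)" using w by (auto simp: r_def)
  qed (fact w)
qed

text \<open>By the rules for differentiation and shift, the derivative of
\<open>(2h - b\<^sup>2)\<^sup>p oval_integral (j + 1) L h\<close> with \<open>p = - (2j + 1) / 2\<close> is
\<open>(2j + 1) (2h - b\<^sup>2)\<^sup>p\<^sup>-\<^sup>1\<close> times the integral with index \<open>j\<close> of \<open>(z\<^sup>2 - b\<^sup>2) L(z)\<close>.\<close>

lemma variation_step:
  assumes L: "real_holomorphic R L" and R: "R > 0" and b: "0 \<le> b"
    and g: "at_most_zeros n (oval_integral j (\<lambda>z. (z\<^sup>2 - b\<^sup>2) * L z)) {b\<^sup>2 / 2<..<R\<^sup>2 / 2}"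
  shows "at_most_zeros (Suc n) (oval_integral (Suc j) L) {b\<^sup>2 / 2<..<R\<^sup>2 / 2}"
proof (rule at_most_zeros_Rolle[OF _ g])
  note L' = real_holomorphic_shift[OF L, of "b\<^sup>2"]
  let ?S = "{b\<^sup>2 / 2<..<R\<^sup>2 / 2}"
  show "is_interval ?S" by (simp add: is_interval_1)
  fix h assume hS: "h \<in> ?S"
  have "0 < h" using hS zero_le_power2[of b] unfolding greaterThanLessThan_iff by linarith
 have h: "0 < h" "h < R\<^sup>2 / 2" using hS \<open>0 < h\<close> by auto
  define p where "p = - (2 * real j + 1) / 2"
  have D: "(oval_integral (Suc j) L has_real_derivative (2 * real j + 1) * oval_integral j L h) (at h)"
    if "0 < h" "h < R\<^sup>2 / 2" for h by (rule oval_integral_DERIV[OF L that R])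
  show "((\<lambda>y. (2 * y - b\<^sup>2) powr p * oval_integral (Suc j) L y) has_real_derivative
      ((2 * real j + 1) * (2 * h - b\<^sup>2) powr (p - 1)) * oval_integral j (\<lambda>z. (z\<^sup>2 - b\<^sup>2) * L z) h) (at h)"
  proof -
    have pos: "2 * h - b\<^sup>2 > 0" using hS by auto
    have "((\<lambda>y. (2 * y - b\<^sup>2) powr p) has_real_derivative p * (2 * h - b\<^sup>2) powr (p - 1) * 2) (at h)"
      by (rule derivative_eq_intros refl pos | simp add: pos)+
    from DERIV_mult[OF this D[OF h]] show ?thesis
    proof (rule DERIV_cong)
      have e: "(2 * h - b\<^sup>2) powr p = (2 * h - b\<^sup>2) powr (p - 1) * (2 * h - b\<^sup>2)"
        using pos powr_add[of "2 * h - b\<^sup>2" "p - 1" 1] by simp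
      show "p * (2 * h - b\<^sup>2) powr (p - 1) * 2 * oval_integral (Suc j) L h +
          (2 * real j + 1) * oval_integral j L h * (2 * h - b\<^sup>2) powr p =
          ((2 * real j + 1) * (2 * h - b\<^sup>2) powr (p - 1)) * oval_integral j (\<lambda>z. (z\<^sup>2 - b\<^sup>2) * L z) h"
      proof -
        have p2: "p * W * 2 = - ((2 * real j + 1) * W)" for W
        proof -
          have "p * 2 = - (2 * real j + 1)" by (simp add: p_def)
          hence "p * 2 * W = - (2 * real j + 1) * W" by (rule arg_cong)
          thus ?thesis by (simp only: mult_minus_left mult.commute mult.left_commute)
        qed
        show ?thesis unfolding oval_integral_shift[OF L h R] e p2
          by (simp only: left_diff_distrib right_diff_distrib) (simp add: mult.commute mult.left_commute)
      qed
    qed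
  qed
  show "(2 * real j + 1) * (2 * h - b\<^sup>2) powr (p - 1) \<noteq> 0" using hS by auto
  show "vanishes 1 (oval_integral j (\<lambda>z. (z\<^sup>2 - b\<^sup>2) * L z)) h"
    if "oval_integral j (\<lambda>z. (z\<^sup>2 - b\<^sup>2) * L z) h = 0"
    using analytic_zero_vanishes[OF oval_integral_analytic[OF L' R] _ that] h by auto
  show "vanishes m (oval_integral j (\<lambda>z. (z\<^sup>2 - b\<^sup>2) * L z)) h"
    if v: "vanishes (Suc m) (oval_integral (Suc j) L) h" for m
  proof -
    have near: "\<forall>\<^sub>F y in nhds h. y \<in> {0<..<R\<^sup>2 / 2}"
      by (rule eventually_nhds_in_open) (use h in auto)
    have "\<forall>\<^sub>F y in nhds h. (oval_integral (Suc j) L has_real_derivative (2 * real j + 1) * oval_integral j L y) (at y)"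
      using near by eventually_elim (use D in auto)
    hence "vanishes m (\<lambda>y. (2 * real j + 1) * oval_integral j L y) h"
      by (rule vanishes_deriv[OF v])
    hence "vanishes m (\<lambda>y. (2 / (2 * real j + 1) * y + - b\<^sup>2 / (2 * real j + 1)) * ((2 * real j + 1) * oval_integral j L y)
        + (0 * y + - 1) * oval_integral (Suc j) L y) h"
      using vanishes_mono[OF v, of m] by (intro vanishes_add vanishes_affine_mult) auto
    thus ?thesis
    proof (rule vanishes_cong[rotated])
      show "\<forall>\<^sub>F y in nhds h. (2 / (2 * real j + 1) * y + - b\<^sup>2 / (2 * real j + 1)) * ((2 * real j + 1) * oval_integral j L y)
        + (0 * y + - 1) * oval_integral (Suc j) L y = oval_integral j (\<lambda>z. (z\<^sup>2 - b\<^sup>2) * L z) y"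
        using near
      proof eventually_elim
        fix y assume y: "y \<in> {0<..<R\<^sup>2 / 2}"
        have "(2 / (2 * real j + 1) * y + - b\<^sup>2 / (2 * real j + 1)) * ((2 * real j + 1) * oval_integral j L y)
          = (2 * y - b\<^sup>2) * oval_integral j L y"
        proof -
          have "(2 / c * y + - b\<^sup>2 / c) * (c * N) = (2 * y - b\<^sup>2) * N" if "c > 0" for c N :: real
            using that by (simp add: field_simps)
          thus ?thesis by simp
        qed
        thus "(2 / (2 * real j + 1) * y + - b\<^sup>2 / (2 * real j + 1)) * ((2 * real j + 1) * oval_integral j L y)
        + (0 * y + - 1) * oval_integral (Suc j) L y = oval_integral j (\<lambda>z. (z\<^sup>2 - b\<^sup>2) * L z) y"
          using oval_integral_shift[OF L _ _ R, of y j "b\<^sup>2"] y by simp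
      qed
    qed
  qed
qed

text \<open>The possible values \<open>b = 0\<close> and \<open>b \<ge> R\<close> cover densities of constant sign.  Levels up to
\<open>b\<^sup>2 / 2\<close> see only the part of the density before the sign change, so zeros can occur only
beyond, where Rolle's theorem applies.\<close>

lemma one_sign_change:
  assumes L: "real_holomorphic R L" and even: "\<And>z. L (- z) = L z"
    and fin: "finite {z \<in> {0<..<R}. L z = 0}" and R: "R > 0" and b: "0 \<le> b"
    and sgn: "\<And>z. 0 < z \<Longrightarrow> z < R \<Longrightarrow> (z\<^sup>2 - b\<^sup>2) * L z \<ge> 0"
  shows "at_most_zeros 1 (oval_integral (Suc j) L) {0<..<R\<^sup>2 / 2}"
proof (rule at_most_zeros_superset)
  have "at_most_zeros 0 (oval_integral j (\<lambda>z. (z\<^sup>2 - b\<^sup>2) * L z)) {b\<^sup>2 / 2<..<R\<^sup>2 / 2}"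
  proof (rule at_most_zerosI_nonzero)
    fix h assume hS: "h \<in> {b\<^sup>2 / 2<..<R\<^sup>2 / 2}"
    have "0 < h" using hS zero_le_power2[of b] unfolding greaterThanLessThan_iff by linarith
 have h: "0 < h" "h < R\<^sup>2 / 2" using hS \<open>0 < h\<close> by auto
    have "oval_integral j (\<lambda>z. (z\<^sup>2 - b\<^sup>2) * L z) h > 0"
    proof (rule oval_integral_even_pos[OF real_holomorphic_shift[OF L] _ _ h R])
      have "{z \<in> {0<..<R}. (z\<^sup>2 - b\<^sup>2) * L z = 0} \<subseteq> {z \<in> {0<..<R}. L z = 0} \<union> {b}"
        using b by (auto simp: power2_eq_iff)
      thus "finite {z \<in> {0<..<R}. (z\<^sup>2 - b\<^sup>2) * L z = 0}" using fin by (auto dest: finite_subset)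
      show "(z\<^sup>2 - b\<^sup>2) * L z \<ge> 0" if "0 < z" "z < sqrt (2 * h)" for z
        using sgn[of z] that sqrt_level_less[OF h R] by auto
    qed (use even in auto)
    thus "oval_integral j (\<lambda>z. (z\<^sup>2 - b\<^sup>2) * L z) h \<noteq> 0" by simp
  qed
  from variation_step[OF L R b this]
  show "at_most_zeros 1 (oval_integral (Suc j) L) {b\<^sup>2 / 2<..<R\<^sup>2 / 2}" by simp
next
  fix h assume hS: "h \<in> {0<..<R\<^sup>2 / 2} - {b\<^sup>2 / 2<..<R\<^sup>2 / 2}"
  hence h: "0 < h" "h < R\<^sup>2 / 2" "2 * h \<le> b\<^sup>2" by auto
  have "sqrt (2 * h) \<le> b" using h(3) b real_sqrt_le_mono[OF h(3)] by simp
  have "oval_integral (Suc j) (\<lambda>z. -1 * L z) h > 0"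
  proof (rule oval_integral_even_pos[OF real_holomorphic_mult[OF real_holomorphic_const L] _ _ h(1,2) R])
    show "-1 * L z \<ge> 0" if z: "0 < z" "z < sqrt (2 * h)" for z
    proof -
      have "z < b" using z \<open>sqrt (2 * h) \<le> b\<close> by simp
      hence "z\<^sup>2 - b\<^sup>2 < 0" using z by (simp add: power_strict_mono)
      moreover have "z < R" using z sqrt_level_less[OF h(1,2) R] by simp
      ultimately show ?thesis using sgn[OF z(1)] by (simp add: zero_le_mult_iff)
    qed
  qed (use even fin in auto)
  moreover have "oval_integral (Suc j) (\<lambda>z. -1 * L z) h = - oval_integral (Suc j) L h"
    using oval_integral_add[OF L L h(1,2) R, of "Suc j" "-1" 0] by simp
  ultimately show "oval_integral (Suc j) L h \<noteq> 0" by simp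
qed

text \<open>The density \<open>(z\<^sup>2 - a\<^sup>2) L(z)\<close> has the single sign change \<open>b\<close>.  The two steps use up two
units of the index, which is why it has the form \<open>j + 2\<close>.\<close>

lemma two_sign_changes:
  assumes L: "real_holomorphic R L" and even: "\<And>z. L (- z) = L z"
    and fin: "finite {z \<in> {0<..<R}. L z = 0}" and R: "R > 0" and ab: "0 \<le> a" "a \<le> b"
    and sgn: "\<And>z. 0 < z \<Longrightarrow> z < R \<Longrightarrow> (z\<^sup>2 - a\<^sup>2) * (z\<^sup>2 - b\<^sup>2) * L z \<ge> 0"
  shows "at_most_zeros 2 (oval_integral (Suc (Suc j)) L) {0<..<R\<^sup>2 / 2}"
proof (rule at_most_zeros_superset)
  have "at_most_zeros 1 (oval_integral (Suc j) (\<lambda>z. (z\<^sup>2 - a\<^sup>2) * L z)) {0<..<R\<^sup>2 / 2}"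
  proof (rule one_sign_change[OF real_holomorphic_shift[OF L] _ _ R, where b = b])
    have "{z \<in> {0<..<R}. (z\<^sup>2 - a\<^sup>2) * L z = 0} \<subseteq> {z \<in> {0<..<R}. L z = 0} \<union> {a}"
      using ab by (auto simp: power2_eq_iff)
    thus "finite {z \<in> {0<..<R}. (z\<^sup>2 - a\<^sup>2) * L z = 0}" using fin by (auto dest: finite_subset)
    show "(z\<^sup>2 - b\<^sup>2) * ((z\<^sup>2 - a\<^sup>2) * L z) \<ge> 0" if "0 < z" "z < R" for z
      using sgn[OF that] by (simp add: mult_ac)
  qed (use even ab in auto)
  hence "at_most_zeros 1 (oval_integral (Suc j) (\<lambda>z. (z\<^sup>2 - a\<^sup>2) * L z)) {a\<^sup>2 / 2<..<R\<^sup>2 / 2}"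
  proof (rule at_most_zeros_subset)
    have "0 \<le> a\<^sup>2 / 2" by simp
    thus "{a\<^sup>2 / 2<..<R\<^sup>2 / 2} \<subseteq> {0<..<R\<^sup>2 / 2}" by (meson greaterThanLessThan_subseteq_greaterThanLessThan order_refl)
  qed
  from variation_step[OF L R ab(1) this]
  show "at_most_zeros 2 (oval_integral (Suc (Suc j)) L) {a\<^sup>2 / 2<..<R\<^sup>2 / 2}" by (simp add: numeral_2_eq_2)
next
  fix h assume hS: "h \<in> {0<..<R\<^sup>2 / 2} - {a\<^sup>2 / 2<..<R\<^sup>2 / 2}"
  hence h: "0 < h" "h < R\<^sup>2 / 2" "2 * h \<le> a\<^sup>2" by auto
  have "sqrt (2 * h) \<le> a" using h(3) ab real_sqrt_le_mono[OF h(3)] by simp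
  have "oval_integral (Suc (Suc j)) L h > 0"
  proof (rule oval_integral_even_pos[OF L even fin h(1,2) R])
    fix z assume z: "0 < z" "z < sqrt (2 * h)"
    have "z < a" using z \<open>sqrt (2 * h) \<le> a\<close> by simp
    hence "z\<^sup>2 - a\<^sup>2 < 0" "z\<^sup>2 - b\<^sup>2 < 0" using z ab by (auto simp: power_strict_mono)
    hence "(z\<^sup>2 - a\<^sup>2) * (z\<^sup>2 - b\<^sup>2) > 0" by (rule mult_neg_neg)
    moreover have "z < R" using z sqrt_level_less[OF h(1,2) R] by simp
    ultimately show "L z \<ge> 0" using sgn[OF z(1)] by (simp add: zero_le_mult_iff)
  qed
  thus "oval_integral (Suc (Suc j)) L h \<noteq> 0" by simp
qed

section \<open>The coordinate that makes the ovals circular\<close>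

text \<open>The Noshiro-Warschawski theorem: along a segment from \<open>a\<close> to \<open>b\<close> the real part of
\<open>f / (b - a)\<close> is strictly increasing.\<close>

lemma inj_on_if_Re_deriv_pos:
  assumes "convex S" and der: "\<And>z. z \<in> S \<Longrightarrow> (f has_field_derivative f' z) (at z)"
    and pos: "\<And>z. z \<in> S \<Longrightarrow> Re (f' z) > 0"
  shows "inj_on f S"
proof (rule inj_onI, rule ccontr)
  fix a b assume ab: "a \<in> S" "b \<in> S" "f a = f b" "a \<noteq> b"
  define d where "d = b - a"
  have d: "d \<noteq> 0" using ab by (simp add: d_def)
  define g where "g = (\<lambda>t. Re (f (a + of_real t * d) / d))"
  have "g 0 < g 1"
  proof (rule DERIV_pos_imp_increasing[of 0 1 g])
    fix t :: real assume t: "0 \<le> t" "t \<le> 1"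
    have "a + of_real t * d = (1 - t) *\<^sub>R a + t *\<^sub>R b"
      by (simp add: d_def scaleR_conv_of_real algebra_simps)
    hence in_S: "a + of_real t * d \<in> S" using assms(1) ab t by (simp add: convexD_alt)
    have "((\<lambda>s. f (a + s * d)) has_field_derivative f' (a + of_real t * d) * d) (at (of_real t))"
      by (rule DERIV_chain2[where g = "\<lambda>s. a + s * d", OF der[OF in_S]]) (auto intro!: derivative_eq_intros)
    from DERIV_cdivide[OF this, of d]
    have "((\<lambda>s. f (a + s * d) / d) has_field_derivative f' (a + of_real t * d)) (at (of_real t))"
      using d by simp
    hence "((\<lambda>t. f (a + of_real t * d) / d) has_vector_derivative f' (a + of_real t * d)) (at t)"
      by (rule has_vector_derivative_real_field)
    from bounded_linear.has_vector_derivative[OF bounded_linear_Re this]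
    have "(g has_real_derivative Re (f' (a + of_real t * d))) (at t)"
      by (simp add: g_def has_real_derivative_iff_has_vector_derivative)
    thus "\<exists>y. (g has_real_derivative y) (at t) \<and> y > 0" using pos[OF in_S] by blast
  qed simp
  thus False using ab(3) by (simp add: g_def d_def)
qed

text \<open>The opening is small enough for \<open>u\<^sup>2\<close> to have an argument below \<open>\<pi>/4\<close> in absolute value, which
makes the real part of \<open>u\<^sup>2 / sqrt q(u)\<close> positive in \<open>cnormal_coord_inj\<close>.\<close>

definition sector :: "complex set" where
  "sector = {u. 3 * \<bar>Im u\<bar> < Re u}"

lemma convex_sector: "convex sector"
proof -
  have eq: "sector = {u. Complex (-1) 3 \<bullet> u < 0} \<inter> {u. Complex (-1) (-3) \<bullet> u < 0}"
    by (auto simp: sector_def inner_complex_def abs_if)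
  show ?thesis unfolding eq by (intro convex_Int convex_halfspace_lt)
qed

lemma open_sector: "open sector"
  unfolding sector_def by (intro open_Collect_less continuous_intros)

definition cquad :: "complex \<Rightarrow> complex" where
  "cquad u = (3 * u\<^sup>2 + 2 * u + 1) / 6"

lemma sector_bounds:
  assumes "u \<in> sector"
  shows "u \<noteq> 0" "\<bar>Im (u\<^sup>2)\<bar> < Re (u\<^sup>2)" "Re (cquad u) > 0"
proof -
  obtain a b where u: "u = Complex a b" by (cases u)
  have ab: "3 * \<bar>b\<bar> < a" using assms by (simp add: sector_def u)
  hence a: "a > 0" by linarith
  show "u \<noteq> 0" using a by (auto simp: u complex_eq_iff)
  have "3 * (a * \<bar>b\<bar>) < a * a" using mult_strict_left_mono[OF ab a] by (simp add: mult_ac)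
  moreover have "(3 * \<bar>b\<bar>) * (3 * \<bar>b\<bar>) < a * a" by (rule mult_strict_mono'[OF ab ab]) auto
  hence "9 * (b * b) < a * a" by (simp add: abs_mult_self_eq mult_ac)
  moreover have "\<bar>a * b\<bar> = a * \<bar>b\<bar>" using a by (simp add: abs_mult)
  ultimately have *: "2 * \<bar>a * b\<bar> < a * a - b * b" by linarith
  thus "\<bar>Im (u\<^sup>2)\<bar> < Re (u\<^sup>2)" by (simp add: u power2_eq_square)
  have "Re (cquad u) = (3 * (a * a - b * b) + 2 * a + 1) / 6"
    by (simp add: cquad_def u power2_eq_square)
  also have "\<dots> > 0" using * a abs_ge_zero[of "a * b"] by simp
  finally show "Re (cquad u) > 0" .
qed

definition cnormal_coord :: "complex \<Rightarrow> complex" where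
  "cnormal_coord u = (u - 1) * csqrt (cquad u)"

lemma cnormal_coord_DERIV:
  assumes u: "u \<in> sector"
  shows "(cnormal_coord has_field_derivative u\<^sup>2 / csqrt (cquad u)) (at u)"
proof -
  have nz: "cquad u \<notin> \<real>\<^sub>\<le>\<^sub>0" using sector_bounds(3)[OF u] by (simp add: complex_nonpos_Reals_iff)
  hence s0: "csqrt (cquad u) \<noteq> 0" using sector_bounds(3)[OF u] by auto
  have "(cquad has_field_derivative (6 * u + 2) / 6) (at u)"
    unfolding cquad_def by (rule derivative_eq_intros refl)+ simp_all
  from DERIV_chain2[OF has_field_derivative_csqrt[OF nz] this]
  have s: "((\<lambda>u. csqrt (cquad u)) has_field_derivative inverse (2 * csqrt (cquad u)) * ((6 * u + 2) / 6)) (at u)" .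
  have "((\<lambda>u. u - 1) has_field_derivative 1) (at u)"
    by (auto intro!: derivative_eq_intros)
  from DERIV_mult[OF this s]
  have "(cnormal_coord has_field_derivative (1 * csqrt (cquad u) + inverse (2 * csqrt (cquad u)) * ((6 * u + 2) / 6) * (u - 1))) (at u)"
    unfolding cnormal_coord_def .
  moreover have "1 * csqrt (cquad u) + inverse (2 * csqrt (cquad u)) * ((6 * u + 2) / 6) * (u - 1) = u\<^sup>2 / csqrt (cquad u)"
  proof -
    have "csqrt (cquad u) * (1 * csqrt (cquad u) + inverse (2 * csqrt (cquad u)) * ((6 * u + 2) / 6) * (u - 1))
      = (csqrt (cquad u))\<^sup>2 + (6 * u + 2) * (u - 1) / 12"
      using s0 by (simp add: field_simps power2_eq_square)
    also have "\<dots> = u\<^sup>2" unfolding power2_csqrt by (simp add: cquad_def field_simps power2_eq_square)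
    finally show ?thesis using s0 by (simp add: field_simps)
  qed
  ultimately show ?thesis by simp
qed

text \<open>The derivative is a number with argument below \<open>\<pi>/4\<close> divided by a square root of a number of
positive real part, hence it has positive real part.\<close>

lemma cnormal_coord_inj: "inj_on cnormal_coord sector"
proof (rule inj_on_if_Re_deriv_pos[OF convex_sector cnormal_coord_DERIV])
  fix u assume u: "u \<in> sector"
  note b = sector_bounds[OF u]
  define s where "s = csqrt (cquad u)"
  have s2: "s\<^sup>2 = cquad u" by (simp add: s_def)
  have "Re (s\<^sup>2) = (Re s)\<^sup>2 - (Im s)\<^sup>2" by (simp add: power2_eq_square)
  hence lt: "(Im s)\<^sup>2 < (Re s)\<^sup>2" using b(3) s2 by simp
  have "Re s \<ge> 0" using csqrt_principal[of "cquad u"] by (auto simp: s_def)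
  hence s: "\<bar>Im s\<bar> < Re s" using lt by (metis abs_of_nonneg power2_less_imp_less power2_abs)
  hence "0 < Re s" by linarith
  have "\<bar>Im (u\<^sup>2) * Im s\<bar> < Re (u\<^sup>2) * Re s"
    unfolding abs_mult by (rule mult_strict_mono'[OF b(2) s]) auto
  hence "Re (u\<^sup>2) * Re s + Im (u\<^sup>2) * Im s > 0" by linarith
  moreover have "(Re s)\<^sup>2 + (Im s)\<^sup>2 > 0" using \<open>0 < Re s\<close> by (simp add: add_pos_nonneg)
  ultimately show "Re (u\<^sup>2 / csqrt (cquad u)) > 0"
    unfolding s_def[symmetric] by (simp add: Re_divide)
qed

text \<open>The signed square root of twice the potential, as a function of \<open>u = x + 1\<close>.\<close>

definition normal_coord :: "real \<Rightarrow> real" where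
  "normal_coord u = (u - 1) * sqrt ((3 * u\<^sup>2 + 2 * u + 1) / 6)"

lemma quad_pos: "(3 * u\<^sup>2 + 2 * u + 1) / 6 > (0::real)"
proof -
  have "3 * u\<^sup>2 + 2 * u + 1 = 2 * u\<^sup>2 + (u + 1)\<^sup>2" by (simp add: power2_eq_square algebra_simps)
  moreover have "u = 0 \<Longrightarrow> u + 1 \<noteq> 0" by simp
  ultimately show ?thesis by (metis add_pos_nonneg add_nonneg_pos divide_pos_pos mult_nonneg_nonneg
      mult_pos_pos zero_le_power2 zero_less_numeral zero_less_power2 zero_le_numeral)
qed

lemma of_real_in_sector: "u > 0 \<Longrightarrow> complex_of_real u \<in> sector"
  by (simp add: sector_def)

lemma cnormal_coord_of_real: "u > 0 \<Longrightarrow> cnormal_coord (of_real u) = of_real (normal_coord u)"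
proof -
  define q where "q = (3 * u\<^sup>2 + 2 * u + 1) / 6"
  have "cquad (of_real u) = of_real q" by (simp add: cquad_def q_def)
  moreover have "csqrt (of_real q) = of_real (sqrt q)"
    using quad_pos[of u] csqrt_of_real_nonneg[of "complex_of_real q"] by (simp add: q_def)
  ultimately have "csqrt (cquad (of_real u)) = of_real (sqrt ((3 * u\<^sup>2 + 2 * u + 1) / 6))"
    by (simp only: q_def)
  thus ?thesis by (simp add: cnormal_coord_def normal_coord_def)
qed

lemma normal_coord_inj: "0 < u \<Longrightarrow> 0 < v \<Longrightarrow> normal_coord u = normal_coord v \<Longrightarrow> u = v"
  using inj_onD[OF cnormal_coord_inj, of "of_real u" "of_real v"] of_real_in_sector
  by (auto simp: cnormal_coord_of_real)

text \<open>The values of \<open>normal_coord\<close> at \<open>u = 0\<close> and \<open>u = 4/3\<close>, the ends of the period annulus, are \<open>\<plusminus>radius\<close>,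
and \<open>radius\<^sup>2 / 2 = 1/12\<close>.\<close>

abbreviation radius :: real where "radius \<equiv> sqrt (1 / 6)"

lemma normal_coord_surj:
  assumes "\<bar>z\<bar> < radius"
  shows "\<exists>u. 0 < u \<and> u < 4 / 3 \<and> normal_coord u = z"
proof -
  have e: "normal_coord 0 = - radius" "normal_coord (4 / 3) = radius"
  proof -
    show "normal_coord 0 = - radius" by (simp add: normal_coord_def)
    have "normal_coord (4 / 3) = (1 / 3) * sqrt (9 / 6)" by (simp add: normal_coord_def power2_eq_square)
    also have "\<dots> = radius"
      by (rule real_sqrt_unique[symmetric]) (simp_all add: power_mult_distrib power2_eq_square)
    finally show "normal_coord (4 / 3) = radius" .
  qed
  have "\<exists>u. 0 \<le> u \<and> u \<le> 4 / 3 \<and> normal_coord u = z"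
  proof (rule IVT')
    show "continuous_on {0..4 / 3} normal_coord" unfolding normal_coord_def by (intro continuous_intros) auto
  qed (use e assms in auto)
  then obtain u where u: "0 \<le> u" "u \<le> 4 / 3" "normal_coord u = z" by blast
  have "z = - radius" if "u = 0" using e(1) u(3) unfolding that by simp
  hence "u \<noteq> 0" using assms by auto
  moreover have "z = radius" if "u = 4 / 3" using e(2) u(3) unfolding that by simp
  hence "u \<noteq> 4 / 3" using assms by (metis abs_of_nonneg abs_ge_zero abs_of_neg less_irrefl real_sqrt_ge_0_iff zero_le_divide_1_iff zero_le_numeral)
  ultimately show ?thesis using u by (intro exI[of _ u]) auto
qed

definition normal_coord_inv :: "real \<Rightarrow> real" where
  "normal_coord_inv z = (THE u. 0 < u \<and> normal_coord u = z)"

lemma normal_coord_inv_normal_coord: "u > 0 \<Longrightarrow> normal_coord_inv (normal_coord u) = u"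
  unfolding normal_coord_inv_def using normal_coord_inj by (intro the_equality) auto

lemma normal_coord_inv:
  assumes "\<bar>z\<bar> < radius"
  shows "0 < normal_coord_inv z" "normal_coord_inv z < 4 / 3" "normal_coord (normal_coord_inv z) = z"
  using normal_coord_surj[OF assms] normal_coord_inv_normal_coord by auto

lemma normal_coord_inv_real_holomorphic: "real_holomorphic radius normal_coord_inv"
proof -
  have hol: "cnormal_coord holomorphic_on sector"
    using cnormal_coord_DERIV open_sector by (auto simp: holomorphic_on_open)
  obtain g where g: "g holomorphic_on (cnormal_coord ` sector)" "\<And>z. z \<in> sector \<Longrightarrow> g (cnormal_coord z) = z"
    using holomorphic_has_inverse[OF hol open_sector cnormal_coord_inj] by metis
  have op: "open (cnormal_coord ` sector)"
    by (rule open_mapping_thm3[OF hol open_sector cnormal_coord_inj])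
  have *: "complex_of_real z = cnormal_coord (of_real (normal_coord_inv z))" "complex_of_real (normal_coord_inv z) \<in> sector"
    if "\<bar>z\<bar> < radius" for z
    using normal_coord_inv[OF that] by (auto simp: cnormal_coord_of_real of_real_in_sector)
  show ?thesis
  proof (rule real_holomorphicI[OF op g(1)])
    fix z :: real assume z: "\<bar>z\<bar> < radius"
    show "complex_of_real z \<in> cnormal_coord ` sector" using *[OF z] by blast
    show "g (complex_of_real z) = complex_of_real (normal_coord_inv z)" using *[OF z] g(2) by metis
  qed
qed

lemma normal_coord_DERIV:
  "(normal_coord has_real_derivative u\<^sup>2 / sqrt ((3 * u\<^sup>2 + 2 * u + 1) / 6)) (at u)"
proof -
  let ?q = "(3 * u\<^sup>2 + 2 * u + 1) / 6"
  have s0: "sqrt ?q > 0" "(sqrt ?q)\<^sup>2 = ?q" using quad_pos[of u] by auto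
  have "((\<lambda>u. (3 * u\<^sup>2 + 2 * u + 1) / 6) has_real_derivative (6 * u + 2) / 6) (at u)"
    by (rule derivative_eq_intros refl)+ simp_all
  from DERIV_chain2[OF DERIV_real_sqrt[OF quad_pos] this]
  have s: "((\<lambda>u. sqrt ((3 * u\<^sup>2 + 2 * u + 1) / 6)) has_real_derivative inverse (sqrt ?q) / 2 * ((6 * u + 2) / 6)) (at u)" .
  have "((\<lambda>u. u - 1) has_real_derivative 1) (at u)"
    by (auto intro!: derivative_eq_intros)
  from DERIV_mult[OF this s]
  have "(normal_coord has_real_derivative (1 * sqrt ?q + inverse (sqrt ?q) / 2 * ((6 * u + 2) / 6) * (u - 1))) (at u)"
    unfolding normal_coord_def .
  moreover have "1 * sqrt ?q + inverse (sqrt ?q) / 2 * ((6 * u + 2) / 6) * (u - 1) = u\<^sup>2 / sqrt ?q"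
  proof -
    have "S * (1 * S + inverse S / 2 * ((6 * u + 2) / 6) * (u - 1)) = S\<^sup>2 + (6 * u + 2) * (u - 1) / 12"
      if "S > 0" for S using that by (simp add: field_simps power2_eq_square)
    from this[OF s0(1)] have "sqrt ?q * (1 * sqrt ?q + inverse (sqrt ?q) / 2 * ((6 * u + 2) / 6) * (u - 1)) = u\<^sup>2"
      unfolding s0(2) by (simp add: field_simps power2_eq_square)
    thus ?thesis using s0(1) by (simp add: nonzero_eq_divide_eq mult.commute)
  qed
  ultimately show ?thesis by simp
qed

lemma normal_coord_inv_DERIV:
  assumes z: "\<bar>z\<bar> < radius"
  shows "(normal_coord_inv has_real_derivative sqrt ((3 * (normal_coord_inv z)\<^sup>2 + 2 * normal_coord_inv z + 1) / 6) / (normal_coord_inv z)\<^sup>2) (at z)"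
proof -
  obtain U' where U': "\<And>z. \<bar>z\<bar> < radius \<Longrightarrow> (normal_coord_inv has_real_derivative U' z) (at z)"
    using real_holomorphic_deriv[OF normal_coord_inv_real_holomorphic] by metis
  let ?u = "normal_coord_inv z"
  note u = normal_coord_inv[OF z]
  have "(normal_coord has_real_derivative ?u\<^sup>2 / sqrt ((3 * ?u\<^sup>2 + 2 * ?u + 1) / 6)) (at ?u)" by (rule normal_coord_DERIV)
  from DERIV_chain2[OF this U'[OF z]]
  have "((\<lambda>z. normal_coord (normal_coord_inv z)) has_real_derivative ?u\<^sup>2 / sqrt ((3 * ?u\<^sup>2 + 2 * ?u + 1) / 6) * U' z) (at z)" .
  moreover have "((\<lambda>z. normal_coord (normal_coord_inv z)) has_real_derivative 1) (at z)"
  proof (rule has_field_derivative_transform_within_open[where f = "\<lambda>z. z" and S = "{-radius<..<radius}"])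
    show "((\<lambda>z. z) has_real_derivative 1) (at z)" by (rule DERIV_ident)
  qed (use z normal_coord_inv(3) in auto)
  ultimately have "?u\<^sup>2 / sqrt ((3 * ?u\<^sup>2 + 2 * ?u + 1) / 6) * U' z = 1"
    by (rule DERIV_unique)
  hence "U' z = sqrt ((3 * ?u\<^sup>2 + 2 * ?u + 1) / 6) / ?u\<^sup>2"
    using u(1) quad_pos[of ?u] by (simp add: field_simps)
  thus ?thesis using U'[OF z] by simp
qed

section \<open>Line integrals along the ovals\<close>

lemma Ham_eq_normal_coord: "2 * Ham x y = (normal_coord (x + 1))\<^sup>2 + y\<^sup>2"
proof -
  have "(normal_coord (x + 1))\<^sup>2 = x\<^sup>2 * ((3 * (x + 1)\<^sup>2 + 2 * (x + 1) + 1) / 6)"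
    using quad_pos[of "x + 1"] by (simp add: normal_coord_def power_mult_distrib)
  thus ?thesis by (simp add: Ham_def power2_eq_square field_simps)
qed

text \<open>Both \<open>F(x + 2\<pi>) - F(x)\<close> and \<open>F(-x) + F(x)\<close> are constant.\<close>

lemma closed_polar_integral:
  fixes P :: "real \<Rightarrow> real"
  assumes F: "\<And>x. (F has_real_derivative P x) (at x)"
    and per: "\<And>x. P (x + 2 * pi) = P x" and even: "\<And>x. P (- x) = P x"
  shows "F (a + 2 * pi) - F a = 2 * integral {0..pi} P"
proof -
  have "((\<lambda>x. F (x + 2 * pi) - F x) has_real_derivative 0) (at x)" for x
  proof -
    have "((\<lambda>x. F (x + 2 * pi)) has_real_derivative P (x + 2 * pi) * 1) (at x)"
      by (rule DERIV_chain2[OF F]) (auto intro!: derivative_eq_intros)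
    from DERIV_diff[OF this F] show ?thesis using per by simp
  qed
  hence "F (a + 2 * pi) - F a = F (- pi + 2 * pi) - F (- pi)"
    using DERIV_isconst_all[of "\<lambda>x. F (x + 2 * pi) - F x"] by blast
  also have "- pi + 2 * pi = pi" by simp
  finally have 1: "F (a + 2 * pi) - F a = F pi - F (- pi)" .
  have "((\<lambda>x. F (- x) + F x) has_real_derivative 0) (at x)" for x
  proof -
    have "((\<lambda>x. F (- x)) has_real_derivative P (- x) * - 1) (at x)"
      by (rule DERIV_chain2[OF F]) (auto intro!: derivative_eq_intros)
    from DERIV_add[OF this F] show ?thesis using even by simp
  qed
  hence "F (- pi) + F pi = F (- 0) + F 0"
    using DERIV_isconst_all[of "\<lambda>x. F (- x) + F x"] by blast
  moreover have "(P has_integral F pi - F 0) {0..pi}"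
    using F by (intro fundamental_theorem_of_calculus)
      (auto simp: has_real_derivative_iff_has_vector_derivative[symmetric] intro: has_field_derivative_at_within)
  hence "integral {0..pi} P = F pi - F 0" by (rule integral_unique)
  ultimately show ?thesis using 1 by simp
qed

text \<open>A continuous logarithm agrees near \<open>t\<close> with the principal branch applied to \<open>p s / p t\<close>.\<close>

lemma continuous_log_has_vector_derivative:
  fixes p q :: "real \<Rightarrow> complex"
  assumes q: "continuous_on {0..1} q" and pq: "\<And>t. t \<in> {0..1} \<Longrightarrow> p t = exp (q t)"
    and t: "t \<in> {0<..<1}" and p: "(p has_vector_derivative p') (at t)"
  shows "(q has_vector_derivative p' / p t) (at t)"
proof -
  have p0: "p t \<noteq> 0" using pq[of t] t by simp
  have "isCont q t" using q t by (auto intro: continuous_on_interior)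
  then obtain d where d: "d > 0" "\<And>s. dist s t < d \<Longrightarrow> dist (q s) (q t) < 1"
    unfolding continuous_at_eps_delta using zero_less_one by blast
  define A where "A = {0<..<1} \<inter> ball t d"
  have A: "open A" "t \<in> A" using t d by (auto simp: A_def)
  have eq: "q t + Ln (p s / p t) = q s" if "s \<in> A" for s
  proof -
    have "\<bar>Im (q s - q t)\<bar> < 1"
      using d(2)[of s] that abs_Im_le_cmod[of "q s - q t"] by (auto simp: A_def dist_commute dist_norm)
    hence "- pi < Im (q s - q t)" "Im (q s - q t) \<le> pi" using pi_gt3 by auto
    hence "Ln (exp (q s - q t)) = q s - q t" by (rule Ln_exp)
    thus ?thesis using pq[of s] pq[of t] t that by (simp add: exp_diff A_def)
  qed
  have "((\<lambda>z. q t + Ln (z / p t)) has_field_derivative 1 / p t) (at (p t))"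
    using p0 by (auto intro!: derivative_eq_intros simp: divide_simps)
  from field_vector_diff_chain_at[OF p this]
  have "((\<lambda>s. q t + Ln (p s / p t)) has_vector_derivative p' / p t) (at t)" by (simp add: o_def)
  thus ?thesis by (rule has_vector_derivative_transform_within_open[OF _ A eq])
qed

text \<open>In the coordinates \<open>(normal_coord (x + 1), y)\<close> the path runs on the circle of radius \<open>sqrt (2h)\<close>, so a
continuous logarithm writes it as \<open>r exp (\<i>\<theta>(t))\<close>.  The one-form becomes \<open>- r\<^sup>2 P(\<theta>) d\<theta>\<close> with a
\<open>2\<pi>\<close>-periodic even \<open>P\<close>, whose integral depends only on the increment of \<open>\<theta>\<close>, that is, on the
winding number.\<close>

lemma line_integral_on_oval:
  assumes ov: "oval Ham h g" and h: "0 < h" "h < 1 / 12"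
    and proj: "\<And>t. t \<in> {0..1} \<Longrightarrow> Re (g t) \<in> {-1<..<1 / 3}"
    and G: "continuous_on {-radius<..<radius} G"
    and Gf: "\<And>z. \<bar>z\<bar> < radius \<Longrightarrow>
      G z = f (normal_coord_inv z) * (sqrt ((3 * (normal_coord_inv z)\<^sup>2 + 2 * normal_coord_inv z + 1) / 6) / (normal_coord_inv z)\<^sup>2)"
  shows "line_integral_dx g (\<lambda>x y. f (x + 1) * y) =
      - 2 * Re (winding_number g 0) * oval_integral 1 G h"
    and "winding_number g 0 \<in> {1, -1}"
proof -
  have vp: "valid_path g" and sp: "simple_path g" and closed: "pathfinish g = pathstart g"
    and ins: "0 \<in> inside (path_image g)" and img0: "path_image g \<subseteq> {z. Ham (Re z) (Im z) = h}"
    using ov by (simp_all add: oval_def)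
  have img: "Ham (Re (g t)) (Im (g t)) = h" if "t \<in> {0..1}" for t
    using img0 that unfolding path_image_def by blast
  show wn: "winding_number g 0 \<in> {1, -1}"
    by (rule simple_closed_path_winding_number_inside[OF sp]) (use ins in auto)
  define r where "r = sqrt (2 * h)"
  have R: "radius > 0" "radius\<^sup>2 / 2 = 1 / 12" by auto
  have r: "r > 0" "\<bar>r\<bar> < radius" "r\<^sup>2 = 2 * h"
    using h sqrt_level_less[of h radius] by (auto simp: r_def)
  define x where "x = (\<lambda>t. Re (g t))"
  define y where "y = (\<lambda>t. Im (g t))"
  define p where "p = (\<lambda>t. Complex (normal_coord (x t + 1)) (y t))"
  have xpos: "0 < x t + 1" if "t \<in> {0..1}" for t using proj[OF that] by (simp add: x_def)
  have level: "(normal_coord (x t + 1))\<^sup>2 + (y t)\<^sup>2 = r\<^sup>2" if "t \<in> {0..1}" for t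
    using img[OF that] Ham_eq_normal_coord[of "Re (g t)" "Im (g t)"] by (simp add: x_def y_def r(3))
  have pathg: "path g" using vp by (rule valid_path_imp_path)
  hence contg: "continuous_on {0..1} g" by (simp add: path_def)
  have contp: "continuous_on {0..1} p"
    unfolding p_def x_def y_def normal_coord_def Complex_eq
    by (intro continuous_intros contg) auto
  have pathp: "path p" using contp by (simp add: path_def)
  have closedp: "pathfinish p = pathstart p"
    using closed by (simp add: pathfinish_def pathstart_def p_def x_def y_def)
  have normp: "norm (p t) = r" if "t \<in> {0..1}" for t
    using level[OF that] r(1) by (simp add: p_def cmod_def)
  \<comment> \<open>\<open>normal_coord (x + 1)\<close> has the sign of \<open>x\<close>, so the straight homotopy from \<open>g\<close> to \<open>p\<close> avoids \<open>0\<close>\<close>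
  have wnp: "winding_number p 0 = winding_number g 0"
  proof (rule winding_number_loops_linear_eq[OF pathg pathp closed closedp])
    fix t :: real assume t: "t \<in> {0..1}"
    show "0 \<notin> closed_segment (g t) (p t)"
    proof
      assume "0 \<in> closed_segment (g t) (p t)"
      then obtain s where s: "0 \<le> s" "s \<le> 1" "0 = (1 - s) *\<^sub>R g t + s *\<^sub>R p t"
        by (auto simp: in_segment)
      define Q where "Q = sqrt ((3 * (x t + 1)\<^sup>2 + 2 * (x t + 1) + 1) / 6)"
      have Q: "Q > 0" using quad_pos[of "x t + 1"] by (simp add: Q_def)
      have "0 = (1 - s) * y t + s * y t" using arg_cong[OF s(3), of Im] by (simp add: y_def p_def)
      hence y0: "y t = 0" by (simp add: algebra_simps)
      have "0 = (1 - s) * x t + s * (x t * Q)"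
        using arg_cong[OF s(3), of Re] by (simp add: x_def p_def normal_coord_def Q_def)
      hence "((1 - s) + s * Q) * x t = 0" by (simp add: algebra_simps)
      moreover have "(1 - s) + s * Q > 0"
        using s(1,2) Q by (cases "s = 0") (auto intro: add_nonneg_pos)
      ultimately have "x t = 0" by simp
      hence "normal_coord (x t + 1) = 0" by (simp add: normal_coord_def)
      thus False using level[OF t] y0 r(1) by simp
    qed
  qed
  have "p t \<noteq> 0" if "t \<in> {0..1}" for t using normp[OF that] r(1) by auto
  hence "0 \<notin> path_image p" unfolding path_image_def by (metis imageE)
  then obtain q where q: "path q" "pathfinish q - pathstart q = 2 * of_real pi * \<i> * winding_number p 0"
    "\<And>t. t \<in> {0..1} \<Longrightarrow> p t = exp (q t)"
    using winding_number_as_continuous_log[OF pathp] by (metis add_0)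
  have contq: "continuous_on {0..1} q" using q(1) by (simp add: path_def)
  define \<theta> where "\<theta> = (\<lambda>t. Im (q t))"
  have polar: "normal_coord (x t + 1) = r * cos (\<theta> t)" "y t = r * sin (\<theta> t)" if "t \<in> {0..1}" for t
  proof -
    have "exp (Re (q t)) = r" using normp[OF that] q(3)[OF that] by simp
    thus "normal_coord (x t + 1) = r * cos (\<theta> t)" "y t = r * sin (\<theta> t)"
      using arg_cong[OF q(3)[OF that], of Re] arg_cong[OF q(3)[OF that], of Im]
      by (auto simp: p_def \<theta>_def Re_exp Im_exp)
  qed
  define P where "P = (\<lambda>\<phi>. G (r * cos \<phi>) * sin \<phi> ^ 2)"
  have "isCont P \<phi>" for \<phi>
  proof -
    have "continuous_on UNIV P" unfolding P_def
      by (intro continuous_intros continuous_on_circle[OF G r(2)])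
    thus ?thesis by (simp add: continuous_on_eq_continuous_at)
  qed
  then obtain F where F: "\<And>\<phi>. (F has_real_derivative P \<phi>) (at \<phi>)"
    using einterval_antiderivative[of "-\<infinity>" \<infinity> P]
    by (auto simp: has_real_derivative_iff_has_vector_derivative)
  have polarint: "F (a + 2 * pi) - F a = 2 * circle_mean 1 G r" for a
    using closed_polar_integral[OF F, of a] by (simp add: P_def circle_mean_def sin_add cos_add)
  obtain k :: real where k: "k \<in> {1, -1}" "winding_number g 0 = of_real k" using wn by force
  have \<theta>k: "\<theta> 1 = \<theta> 0 + 2 * pi * k"
    using arg_cong[OF q(2), of Im] by (simp add: wnp k(2) \<theta>_def pathfinish_def pathstart_def)
  have Fdiff: "F (\<theta> 1) - F (\<theta> 0) = k * (2 * circle_mean 1 G r)"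
    using k(1) polarint[of "\<theta> 0"] polarint[of "\<theta> 0 - 2 * pi"] by (auto simp: \<theta>k)
  obtain S where S: "finite S" "g C1_differentiable_on ({0..1} - S)"
    using vp by (auto simp: valid_path_def piecewise_C1_differentiable_on_def)
  have main: "((\<lambda>t. - r\<^sup>2 * F (\<theta> t)) has_vector_derivative
      f (x t + 1) * y t * Re (vector_derivative g (at t within {0..1}))) (at t)"
    if t: "t \<in> {0<..<1} - S" for t
  proof -
    have t01: "t \<in> {0..1}" "t \<in> {0<..<1}" using t by auto
    define g' where "g' = vector_derivative g (at t)"
    have gd: "(g has_vector_derivative g') (at t)"
      using S(2) t unfolding g'_def C1_differentiable_on_eq
      by (auto simp: vector_derivative_works)
    have wi: "vector_derivative g (at t within {0..1}) = g'"
      by (rule vector_derivative_at_within_ivl[OF gd]) (use t in auto)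
    have xd: "(x has_real_derivative Re g') (at t)"
      using bounded_linear.has_vector_derivative[OF bounded_linear_Re gd]
      by (simp add: x_def has_real_derivative_iff_has_vector_derivative)
    have yd: "(y has_real_derivative Im g') (at t)"
      using bounded_linear.has_vector_derivative[OF bounded_linear_Im gd]
      by (simp add: y_def has_real_derivative_iff_has_vector_derivative)
    obtain z' where zd: "((\<lambda>t. normal_coord (x t + 1)) has_real_derivative z') (at t)"
      using DERIV_chain2[OF normal_coord_DERIV DERIV_add[OF xd DERIV_const]] by blast
    have "((\<lambda>t. of_real (normal_coord (x t + 1)) + \<i> * of_real (y t)) has_vector_derivative
        of_real z' + \<i> * of_real (Im g')) (at t)"
      using zd yd unfolding has_real_derivative_iff_has_vector_derivative
      by (intro has_vector_derivative_add has_vector_derivative_mult_right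
          bounded_linear.has_vector_derivative[OF bounded_linear_of_real])
    hence "(p has_vector_derivative (of_real z' + \<i> * of_real (Im g'))) (at t)"
      unfolding p_def Complex_eq .
    from continuous_log_has_vector_derivative[OF contq q(3) t01(2) this]
    obtain q' where "(q has_vector_derivative q') (at t)" by blast
    from bounded_linear.has_vector_derivative[OF bounded_linear_Im this]
    obtain \<theta>' where \<theta>d: "(\<theta> has_real_derivative \<theta>') (at t)"
      by (auto simp: \<theta>_def has_real_derivative_iff_has_vector_derivative)
    define w where "w = r * cos (\<theta> t)"
    have w: "\<bar>w\<bar> < radius" unfolding w_def by (rule abs_mult_cos_less[OF r(2)])
    have wd: "((\<lambda>t. r * cos (\<theta> t)) has_real_derivative - (r * sin (\<theta> t) * \<theta>')) (at t)"
      using \<theta>d by (auto intro!: derivative_eq_intros)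
    define U' where "U' = sqrt ((3 * (normal_coord_inv w)\<^sup>2 + 2 * normal_coord_inv w + 1) / 6) / (normal_coord_inv w)\<^sup>2"
    have "((\<lambda>t. normal_coord_inv (r * cos (\<theta> t))) has_real_derivative U' * - (r * sin (\<theta> t) * \<theta>')) (at t)"
      using DERIV_chain2[OF normal_coord_inv_DERIV[OF w, unfolded w_def] wd] by (simp add: U'_def w_def)
    moreover have "normal_coord_inv (r * cos (\<theta> s)) = x s + 1" if "s \<in> {0<..<1}" for s
      using polar(1)[of s] normal_coord_inv_normal_coord[OF xpos[of s]] that by simp
    ultimately have "((\<lambda>t. x t + 1) has_real_derivative U' * - (r * sin (\<theta> t) * \<theta>')) (at t)"
      using t01(2) by (elim has_field_derivative_transform_within_open[of _ _ _ "{0<..<1}"]) auto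
    moreover have "((\<lambda>t. x t + 1) has_real_derivative Re g' + 0) (at t)"
      by (rule DERIV_add[OF xd DERIV_const])
    ultimately have Reg': "Re g' = U' * - (r * sin (\<theta> t) * \<theta>')" using DERIV_unique by force
    have "normal_coord_inv w = x t + 1"
      unfolding w_def using polar(1)[OF t01(1)] normal_coord_inv_normal_coord[OF xpos[OF t01(1)]] by simp
    hence Gw: "G w = f (x t + 1) * U'" using Gf[OF w] by (simp add: U'_def)
    have "((\<lambda>t. - r\<^sup>2 * F (\<theta> t)) has_real_derivative - r\<^sup>2 * (P (\<theta> t) * \<theta>')) (at t)"
      by (intro DERIV_cmult DERIV_chain2[OF F \<theta>d])
    also have "- r\<^sup>2 * (P (\<theta> t) * \<theta>') = f (x t + 1) * y t * Re g'"
      unfolding Reg' polar(2)[OF t01(1)] P_def w_def[symmetric] Gw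
      by (simp add: power2_eq_square algebra_simps)
    finally show ?thesis unfolding wi by (simp add: has_real_derivative_iff_has_vector_derivative)
  qed
  have "continuous_on {0..1} (\<lambda>t. - r\<^sup>2 * F (\<theta> t))"
  proof -
    have "isCont F \<phi>" for \<phi> by (rule DERIV_isCont[OF F])
    hence cF: "continuous_on UNIV F" by (intro continuous_at_imp_continuous_on) auto
    have "continuous_on {0..1} (\<lambda>t. F (\<theta> t))"
      by (rule continuous_on_compose2[OF cF]) (use contq in \<open>auto simp: \<theta>_def intro!: continuous_intros\<close>)
    thus ?thesis by (intro continuous_intros)
  qed
  from fundamental_theorem_of_calculus_interior_strong[OF S(1) zero_le_one main this]
  have "((\<lambda>t. f (x t + 1) * y t * Re (vector_derivative g (at t within {0..1}))) has_integral
      - r\<^sup>2 * F (\<theta> 1) - - r\<^sup>2 * F (\<theta> 0)) {0..1}" by simp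
  hence "line_integral_dx g (\<lambda>x y. f (x + 1) * y) = - r\<^sup>2 * (F (\<theta> 1) - F (\<theta> 0))"
    unfolding line_integral_dx_def x_def y_def by (simp add: integral_unique algebra_simps)
  also have "\<dots> = - 2 * k * oval_integral 1 G h"
    unfolding Fdiff r(3) by (simp add: oval_integral_def r_def)
  finally show "line_integral_dx g (\<lambda>x y. f (x + 1) * y) =
      - 2 * Re (winding_number g 0) * oval_integral 1 G h" by (simp add: k(2))
qed

section \<open>Three polynomials and their Wronskians\<close>

text \<open>These polynomials arise in \<open>branch_combinations\<close>, from which their coefficients were computed.\<close>

definition p0 :: "real poly" where "p0 = [:442368, 3681792, 10738816, 17090112, 17375616, 12137296, 6030152, 2157148, 552784, 99097, 11807,
    840, 27:]"
definition p1 :: "real poly" where "p1 = [:663552, 4029696, 9324096, 12077376, 10091328, 5791568, 2341196, 667444, 131500, 17046, 1308, 45:]"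
definition p2 :: "real poly" where "p2 = [:124416, 522288, 921528, 945168, 634974, 292979, 93803, 20497, 2915, 243, 9:]"

text \<open>The Wronskians of \<open>p0, p1\<close>, of \<open>p0, p2\<close> and of \<open>p0, p1, p2\<close>.\<close>

definition W01 :: "real poly" where "W01 = p0 * pderiv p1 - pderiv p0 * p1"
definition W02 :: "real poly" where "W02 = p0 * pderiv p2 - pderiv p0 * p2"
definition W012 :: "real poly" where
  "W012 = p0 * (pderiv p1 * pderiv (pderiv p2) - pderiv (pderiv p1) * pderiv p2)
        - p1 * (pderiv p0 * pderiv (pderiv p2) - pderiv (pderiv p0) * pderiv p2)
        + p2 * (pderiv p0 * pderiv (pderiv p1) - pderiv (pderiv p0) * pderiv p1)"

lemma W01_eval: "W01 = - [:660451885056, 6002162270208, 26937381814272, 77065315909632, 155704578502656, 235424947126272,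
    276666393326592, 259433056012288, 197757900032512, 124146484921344, 64743441412736, 28192168039808,
    10270034252400, 3126611125376, 792259782164, 165854315592, 28356229960, 3892757008, 418502346,
    33920550, 1948131, 70632, 1215:]"
  by (simp add: W01_def p0_def p1_def pderiv_pCons)

lemma W012_eval: "W012 = - [:308140431491727360, 3166463913193635840, 15809282591434997760, 51155276157759651840,
    120585549790111334400, 220520130066243256320, 325221928572107243520, 396946453388929966080,
    408345417190450114560, 358805353554858147840, 271992922813840250880, 179223503415587873280,
    103234626282956183040, 52195955324531473920, 23229603190510440000, 9114405599379235680,
    3154157654026252080, 962041147122261120, 258123302270159520, 60728732538650040, 12470421570601080,
    2220997755012540, 340228384661940, 44339643588060, 4845421103460, 435439878840, 31317959880,
    1732235220, 69138360, 1771470, 21870:]"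
  by (simp add: W012_def p0_def p1_def p2_def pderiv_pCons)

lemma p0_pos: "t > 0 \<Longrightarrow> poly p0 t > 0"
  unfolding p0_def poly_pCons poly_0 mult_zero_right add_0_right
  by (intro add_pos_pos mult_pos_pos) simp_all

lemma W01_neg: "t > 0 \<Longrightarrow> poly W01 t < 0"
  unfolding W01_eval poly_minus neg_less_0_iff_less poly_pCons poly_0 mult_zero_right add_0_right
  by (intro add_pos_pos mult_pos_pos) simp_all

lemma W012_neg: "t > 0 \<Longrightarrow> poly W012 t < 0"
  unfolding W012_eval poly_minus neg_less_0_iff_less poly_pCons poly_0 mult_zero_right add_0_right
  by (intro add_pos_pos mult_pos_pos) simp_all

text \<open>Sylvester's identity for Wronskians: it makes \<open>W02 / W01\<close> monotone.\<close>

lemma Wronskian_identity: "W01 * pderiv W02 - pderiv W01 * W02 = p0 * W012"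
  unfolding W01_def W02_def W012_def pderiv_diff pderiv_mult by (simp add: algebra_simps)

section \<open>Sign changes of combinations of the polynomials\<close>

text \<open>Sign changes are recorded by initial segments of the positive half-line, which avoids a case
distinction on whether a sign change takes place at an end of the interval; moreover,
initial segments pull back along increasing maps.\<close>

definition initial_segment :: "real set \<Rightarrow> bool" where
  "initial_segment A \<longleftrightarrow> (\<forall>x y. 0 < x \<longrightarrow> x < y \<longrightarrow> y \<in> A \<longrightarrow> x \<in> A)"

lemma one_sign_change_if_mono:
  fixes f :: "real \<Rightarrow> real"
  assumes "\<And>x y. 0 < x \<Longrightarrow> x < y \<Longrightarrow> f x \<le> f y"
  shows "\<exists>A. initial_segment A \<and> (\<forall>x>0. (x \<in> A \<longrightarrow> f x \<le> 0) \<and> (x \<notin> A \<longrightarrow> 0 \<le> f x))"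
proof (intro exI[of _ "{x. f x \<le> 0}"] conjI)
  show "initial_segment {x. f x \<le> 0}"
    using assms unfolding initial_segment_def by force
qed auto

text \<open>A function that decreases and then increases can change sign once on either part.\<close>

lemma two_sign_changes_if_unimodal:
  fixes f f' :: "real \<Rightarrow> real"
  assumes A: "initial_segment A"
    and der: "\<And>x. x > 0 \<Longrightarrow> (f has_real_derivative f' x) (at x)"
    and sgn: "\<And>x. x > 0 \<Longrightarrow> x \<in> A \<Longrightarrow> f' x \<le> 0" "\<And>x. x > 0 \<Longrightarrow> x \<notin> A \<Longrightarrow> f' x \<ge> 0"
  shows "\<exists>B C. initial_segment B \<and> initial_segment C \<and> B \<subseteq> C \<and>
    (\<forall>x>0. (x \<in> B \<longrightarrow> 0 \<le> f x) \<and> (x \<in> C \<and> x \<notin> B \<longrightarrow> f x \<le> 0) \<and> (x \<notin> C \<longrightarrow> 0 \<le> f x))"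
proof -
  have dec: "f y \<le> f x" if "0 < x" "x < y" "y \<in> A" for x y
  proof (rule DERIV_nonpos_imp_nonincreasing[of x y f])
    fix t assume t: "x \<le> t" "t \<le> y"
    have "0 < t" "t < y \<or> t = y" using t that by auto
    hence "t \<in> A" using A that(3) unfolding initial_segment_def by blast
    thus "\<exists>d. (f has_real_derivative d) (at t) \<and> d \<le> 0" using der[of t] sgn(1)[of t] t that by auto
  qed (use that in simp)
  have inc: "f x \<le> f y" if "0 < x" "x < y" "x \<notin> A" for x y
  proof (rule DERIV_nonneg_imp_nondecreasing[of x y f])
    fix t assume t: "x \<le> t" "t \<le> y"
    have "x < t \<or> x = t" using t by auto
    hence "t \<notin> A" using A that(1,3) unfolding initial_segment_def by blast
    thus "\<exists>d. (f has_real_derivative d) (at t) \<and> 0 \<le> d" using der[of t] sgn(2)[of t] t that by auto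
  qed (use that in simp)
  define B where "B = {x\<in>A. 0 \<le> f x}"
  define C where "C = A \<union> {x. f x \<le> 0}"
  have "initial_segment B"
    unfolding initial_segment_def
  proof (intro allI impI)
    fix x y :: real assume xy: "0 < x" "x < y" "y \<in> B"
    hence "x \<in> A" using A by (auto simp: B_def initial_segment_def)
    moreover have "f y \<le> f x" using dec xy by (auto simp: B_def)
    ultimately show "x \<in> B" using xy by (auto simp: B_def)
  qed
  moreover have "initial_segment C"
    unfolding initial_segment_def
  proof (intro allI impI)
    fix x y :: real assume xy: "0 < x" "x < y" "y \<in> C"
    show "x \<in> C"
    proof (cases "x \<in> A")
      case False
      hence "y \<notin> A" using A xy by (auto simp: initial_segment_def)
      hence "f y \<le> 0" using xy by (auto simp: C_def)
      moreover have "f x \<le> f y" using inc xy False by auto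
      ultimately show ?thesis by (auto simp: C_def)
    qed (auto simp: C_def)
  qed
  ultimately show ?thesis by (intro exI[of _ B] exI[of _ C]) (auto simp: B_def C_def)
qed

lemma poly_quotient_DERIV:
  fixes p q :: "real poly"
  assumes "poly q t \<noteq> 0"
  shows "((\<lambda>t. poly p t / poly q t) has_real_derivative
    poly (q * pderiv p - pderiv q * p) t / (poly q t)\<^sup>2) (at t)"
  using assms by (auto intro!: derivative_eq_intros simp: field_simps power2_eq_square)

text \<open>The derivative of \<open>Q / p0\<close> is \<open>W01 (b + c W02 / W01) / p0\<^sup>2\<close>.  By \<open>Wronskian_identity\<close> the bracket is
monotone, so \<open>Q / p0\<close> is monotone or changes its direction once.\<close>

lemma combination_two_sign_changes:
  fixes a b c :: real
  defines "Q \<equiv> smult a p0 + smult b p1 + smult c p2"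
  shows "\<exists>\<sigma> B C. \<sigma> \<in> {1, -1} \<and> initial_segment B \<and> initial_segment C \<and> B \<subseteq> C \<and>
    (\<forall>t>0. (t \<in> B \<longrightarrow> 0 \<le> \<sigma> * poly Q t) \<and> (t \<in> C \<and> t \<notin> B \<longrightarrow> \<sigma> * poly Q t \<le> 0)
      \<and> (t \<notin> C \<longrightarrow> 0 \<le> \<sigma> * poly Q t))"
proof -
  define \<rho> where "\<rho> = (\<lambda>t. poly W02 t / poly W01 t)"
  have \<rho>: "(\<rho> has_real_derivative poly p0 t * poly W012 t / (poly W01 t)\<^sup>2) (at t)" if "t > 0" for t
    using poly_quotient_DERIV[of W01 t W02] W01_neg[OF that] unfolding Wronskian_identity \<rho>_def
    by (simp add: poly_mult)
  have \<rho>_dec: "\<rho> y \<le> \<rho> x" if "0 < x" "x < y" for x y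
  proof (rule DERIV_nonpos_imp_nonincreasing[of x y \<rho>])
    fix t assume t: "x \<le> t" "t \<le> y"
    hence "t > 0" using that by simp
    moreover have "poly p0 t * poly W012 t / (poly W01 t)\<^sup>2 \<le> 0"
      using p0_pos[OF \<open>t > 0\<close>] W012_neg[OF \<open>t > 0\<close>] by (simp add: divide_nonpos_nonneg mult_nonneg_nonpos)
    ultimately show "\<exists>d. (\<rho> has_real_derivative d) (at t) \<and> d \<le> 0" using \<rho> by blast
  qed (use that in simp)
  \<comment> \<open>the sign for which the bracket becomes nondecreasing, as \<open>\<rho>\<close> decreases\<close>
  obtain \<tau> :: real where \<tau>: "\<tau> \<in> {1, -1}" "\<tau> * c \<le> 0" by (cases "c \<le> 0") (force intro: that[of 1] that[of "-1"])+
  have "\<tau> * (b + c * \<rho> x) \<le> \<tau> * (b + c * \<rho> y)" if "0 < x" "x < y" for x y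
    using mult_left_mono_neg[OF \<rho>_dec[OF that] \<tau>(2)] by (simp add: algebra_simps)
  from one_sign_change_if_mono[of "\<lambda>x. \<tau> * (b + c * \<rho> x)", OF this]
  obtain A where A: "initial_segment A" "\<And>x. x > 0 \<Longrightarrow> x \<in> A \<Longrightarrow> \<tau> * (b + c * \<rho> x) \<le> 0"
    "\<And>x. x > 0 \<Longrightarrow> x \<notin> A \<Longrightarrow> 0 \<le> \<tau> * (b + c * \<rho> x)" by blast
  define f where "f = (\<lambda>t. - \<tau> * (poly Q t / poly p0 t))"
  define f' where "f' = (\<lambda>t. - (poly W01 t * (\<tau> * (b + c * \<rho> t))) / (poly p0 t)\<^sup>2)"
  have "(f has_real_derivative f' t) (at t)" if "t > 0" for t
  proof -
    have "p0 * pderiv Q - pderiv p0 * Q = smult b W01 + smult c W02"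
      unfolding Q_def W01_def W02_def pderiv_add pderiv_smult by (simp add: algebra_simps smult_diff_right)
    hence "((\<lambda>t. poly Q t / poly p0 t) has_real_derivative
       (b * poly W01 t + c * poly W02 t) / (poly p0 t)\<^sup>2) (at t)"
      using poly_quotient_DERIV[of p0 t Q] p0_pos[OF that] by simp
    note d = DERIV_cmult[OF this, of "- \<tau>"]
    have "poly W01 t * \<rho> t = poly W02 t" using W01_neg[OF that] by (simp add: \<rho>_def)
    hence "poly W01 t * (\<tau> * (b + c * \<rho> t)) = \<tau> * (b * poly W01 t + c * poly W02 t)"
      by (simp add: algebra_simps)
    hence "f' t = - \<tau> * ((b * poly W01 t + c * poly W02 t) / (poly p0 t)\<^sup>2)"
      unfolding f'_def by simp
    with d show ?thesis unfolding f_def by simp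
  qed
  moreover have "f' t \<ge> 0 \<longleftrightarrow> \<tau> * (b + c * \<rho> t) \<ge> 0" "f' t \<le> 0 \<longleftrightarrow> \<tau> * (b + c * \<rho> t) \<le> 0" if "t > 0" for t
    using W01_neg[OF that] p0_pos[OF that]
    by (auto simp: f'_def divide_le_0_iff zero_le_divide_iff mult_le_0_iff zero_le_mult_iff)
  ultimately have "\<exists>B C. initial_segment B \<and> initial_segment C \<and> B \<subseteq> C \<and>
    (\<forall>x>0. (x \<in> B \<longrightarrow> 0 \<le> f x) \<and> (x \<in> C \<and> x \<notin> B \<longrightarrow> f x \<le> 0) \<and> (x \<notin> C \<longrightarrow> 0 \<le> f x))"
    using A by (intro two_sign_changes_if_unimodal[OF A(1), of f f']) auto
  moreover have "0 \<le> f t \<longleftrightarrow> 0 \<le> - \<tau> * poly Q t" "f t \<le> 0 \<longleftrightarrow> - \<tau> * poly Q t \<le> 0" if "t > 0" for t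
    using p0_pos[OF that] by (auto simp: f_def divide_le_0_iff zero_le_divide_iff mult_le_0_iff zero_le_mult_iff)
  moreover have "- \<tau> \<in> {1, -1}" using \<tau> by auto
  ultimately show ?thesis by (intro exI[of _ "- \<tau>"]) auto
qed

lemma combination_one_sign_change:
  fixes a b :: real
  defines "Q \<equiv> smult a p0 + smult b p1"
  shows "\<exists>\<sigma> B. \<sigma> \<in> {1, -1} \<and> initial_segment B \<and>
    (\<forall>t>0. (t \<in> B \<longrightarrow> \<sigma> * poly Q t \<le> 0) \<and> (t \<notin> B \<longrightarrow> 0 \<le> \<sigma> * poly Q t))"
proof -
  obtain \<tau> :: real where \<tau>: "\<tau> \<in> {1, -1}" "\<tau> * b \<le> 0" by (cases "b \<le> 0") (force intro: that[of 1] that[of "-1"])+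
  define f where "f = (\<lambda>t. \<tau> * (poly Q t / poly p0 t))"
  have "f x \<le> f y" if "0 < x" "x < y" for x y
  proof (rule DERIV_nonneg_imp_nondecreasing[of x y f])
    fix t assume t: "x \<le> t" "t \<le> y"
    hence t0: "t > 0" using that by simp
    have "p0 * pderiv Q - pderiv p0 * Q = smult b W01"
      unfolding Q_def W01_def pderiv_add pderiv_smult by (simp add: algebra_simps smult_diff_right)
    hence "((\<lambda>t. poly Q t / poly p0 t) has_real_derivative (b * poly W01 t) / (poly p0 t)\<^sup>2) (at t)"
      using poly_quotient_DERIV[of p0 t Q] p0_pos[OF t0] by simp
    from DERIV_cmult[OF this, of \<tau>]
    have "(f has_real_derivative \<tau> * ((b * poly W01 t) / (poly p0 t)\<^sup>2)) (at t)" unfolding f_def .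
    moreover have "\<tau> * b * poly W01 t \<ge> 0" using \<tau>(2) W01_neg[OF t0] by (intro mult_nonpos_nonpos) auto
    hence "0 \<le> \<tau> * ((b * poly W01 t) / (poly p0 t)\<^sup>2)" by (simp add: mult.assoc)
    ultimately show "\<exists>d. (f has_real_derivative d) (at t) \<and> 0 \<le> d" by blast
  qed (use that in simp)
  from one_sign_change_if_mono[of f, OF this]
  obtain B where B: "initial_segment B" "\<forall>x>0. (x \<in> B \<longrightarrow> f x \<le> 0) \<and> (x \<notin> B \<longrightarrow> 0 \<le> f x)" by blast
  moreover have "0 \<le> f t \<longleftrightarrow> 0 \<le> \<tau> * poly Q t" "f t \<le> 0 \<longleftrightarrow> \<tau> * poly Q t \<le> 0" if "t > 0" for t
    using p0_pos[OF that] by (auto simp: f_def divide_le_0_iff zero_le_divide_iff mult_le_0_iff zero_le_mult_iff)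
  ultimately show ?thesis using \<tau>(1) by (intro exI[of _ \<tau>] exI[of _ B]) auto
qed

text \<open>The polynomials have degrees 12, 11 and 10.\<close>

lemma combination_nonzero:
  assumes "a \<noteq> 0 \<or> b \<noteq> 0 \<or> c \<noteq> (0::real)"
  shows "smult a p0 + smult b p1 + smult c p2 \<noteq> 0"
proof
  assume 0: "smult a p0 + smult b p1 + smult c p2 = 0"
  have "a * coeff p0 n + b * coeff p1 n + c * coeff p2 n = 0" for n
    using arg_cong[OF 0, of "\<lambda>p. coeff p n"] by simp
  from this[of 12] this[of 11] this[of 10] show False
    using assms by (simp add: p0_def p1_def p2_def coeff_pCons numeral_eq_Suc)
qed

section \<open>Pairs of points of equal potential\<close>

text \<open>Equality of the potentials at \<open>u \<noteq> v\<close> is a homogeneous cubic in \<open>u, v\<close> equated to a homogeneous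
quadratic, so the ratio of \<open>u\<close> and \<open>v\<close>, and hence \<open>t\<close>, determines the pair up to order.\<close>

lemma oval_endpoints_param:
  fixes u v t :: real
  assumes uv: "0 < u" "0 < v" "u \<noteq> v" and lev: "3 * v ^ 4 - 4 * v ^ 3 = 3 * u ^ 4 - 4 * u ^ 3"
    and t: "t = (v - u)\<^sup>2 / (u * v)"
  shows "t > 0" "(u + v)\<^sup>2 = (t + 4) * (u * v)" "3 * (t + 2) * (u + v) = 4 * (t + 3)"
proof -
  show t0: "t > 0" using uv by (simp add: t)
  have tp: "t * (u * v) = (v - u)\<^sup>2" using uv by (simp add: t)
  thus s2: "(u + v)\<^sup>2 = (t + 4) * (u * v)" by (simp add: power2_eq_square algebra_simps)
  have "(v - u) * (3 * (u + v) * (u\<^sup>2 + v\<^sup>2) - 4 * (u\<^sup>2 + u * v + v\<^sup>2)) = 0"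
    using lev by algebra
  hence "3 * (u + v) * (u\<^sup>2 + v\<^sup>2) = 4 * (u\<^sup>2 + u * v + v\<^sup>2)" using uv by simp
  moreover have "u\<^sup>2 + v\<^sup>2 = (t + 2) * (u * v)" "u\<^sup>2 + u * v + v\<^sup>2 = (t + 3) * (u * v)"
    using s2 by (simp_all add: power2_eq_square algebra_simps)
  ultimately have "(u * v) * (3 * (t + 2) * (u + v)) = (u * v) * (4 * (t + 3))"
    by (simp add: algebra_simps)
  thus "3 * (t + 2) * (u + v) = 4 * (t + 3)" using uv by simp
qed

lemma oval_endpoints_level:
  fixes u v t :: real
  assumes uv: "0 < u" "0 < v" "u \<noteq> v" and lev: "3 * v ^ 4 - 4 * v ^ 3 = 3 * u ^ 4 - 4 * u ^ 3"
    and t: "t = (v - u)\<^sup>2 / (u * v)"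
  shows "3 * v ^ 4 - 4 * v ^ 3 = - 256 / 27 * ((t + 3) ^ 3 / ((t + 2) ^ 4 * (t + 4)\<^sup>2))"
proof -
  define s where "s = u + v"
  note P = oval_endpoints_param[OF assms]
  have t0: "t > 0" and s: "s = 4 * (t + 3) / (3 * (t + 2))" and p: "u * v = s\<^sup>2 / (t + 4)"
    using P by (auto simp: s_def field_simps)
  have "2 * (3 * v ^ 4 - 4 * v ^ 3) = 3 * (u ^ 4 + v ^ 4) - 4 * (u ^ 3 + v ^ 3)" using lev by simp
  also have "\<dots> = 3 * (s ^ 4 - 4 * (u * v) * s\<^sup>2 + 2 * (u * v)\<^sup>2) - 4 * (s ^ 3 - 3 * (u * v) * s)"
    unfolding s_def by algebra
  also have "\<dots> = s ^ 3 / (t + 4)\<^sup>2 * (3 * s * (t\<^sup>2 + 4 * t + 2) - 4 * (t + 1) * (t + 4))"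
  proof -
    obtain y where y: "(t + 4) * y = 1" "s\<^sup>2 / (t + 4) = s\<^sup>2 * y" "s ^ 3 / (t + 4)\<^sup>2 = s ^ 3 * y\<^sup>2"
      using t0 by (intro that[of "1 / (t + 4)"]) (auto simp: power_divide)
    show ?thesis unfolding p y(2,3) using y(1) by algebra
  qed
  also have "3 * s * (t\<^sup>2 + 4 * t + 2) - 4 * (t + 1) * (t + 4) = - 8 / (t + 2)"
    unfolding s using t0 by (simp add: field_simps) algebra
  also have "s ^ 3 / (t + 4)\<^sup>2 * (- 8 / (t + 2)) = 2 * (- 256 / 27 * ((t + 3) ^ 3 / ((t + 2) ^ 4 * (t + 4)\<^sup>2)))"
  proof -
    define x where "x = 1 / (t + 2)"
    define y where "y = 1 / (t + 4)"
    have sx: "s = 4 / 3 * (t + 3) * x" unfolding s by (simp add: x_def)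
    have e: "s ^ 3 / (t + 4)\<^sup>2 = s ^ 3 * y\<^sup>2" "- 8 / (t + 2) = - 8 * x"
      "(t + 3) ^ 3 / ((t + 2) ^ 4 * (t + 4)\<^sup>2) = (t + 3) ^ 3 * (x ^ 4 * y\<^sup>2)"
      by (simp_all add: x_def y_def power_divide)
    show ?thesis unfolding e unfolding sx power_mult_distrib power_divide
      by (simp add: eval_nat_numeral)
  qed
  finally show ?thesis by simp
qed

lemma level_strict_antimono:
  fixes a b :: real
  assumes "0 < a" "a < b"
  shows "(b + 3) ^ 3 / ((b + 2) ^ 4 * (b + 4)\<^sup>2) < (a + 3) ^ 3 / ((a + 2) ^ 4 * (a + 4)\<^sup>2)"
proof -
  have e: "(t + 3) ^ 3 / ((t + 2) ^ 4 * (t + 4)\<^sup>2) = (1 + 1 / (t + 2)) ^ 3 * (1 / ((t + 2) * (t + 4)\<^sup>2))"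
    if "t > 0" for t :: real
  proof -
    have "1 + 1 / (t + 2) = (t + 3) / (t + 2)" using that by (simp add: field_simps)
    thus ?thesis using that by (simp add: power_divide power4_eq_xxxx power3_eq_cube)
  qed
  have "1 / (b + 2) < 1 / (a + 2)" using assms by (simp add: frac_less2)
  hence "(1 + 1 / (b + 2)) ^ 3 < (1 + 1 / (a + 2)) ^ 3" using assms by (intro power_strict_mono) auto
  moreover have "(a + 2) * (a + 4)\<^sup>2 < (b + 2) * (b + 4)\<^sup>2"
    using assms by (intro mult_strict_mono power_strict_mono) auto
  hence "1 / ((b + 2) * (b + 4)\<^sup>2) < 1 / ((a + 2) * (a + 4)\<^sup>2)"
    using assms by (intro divide_strict_left_mono) auto
  ultimately have "(1 + 1 / (b + 2)) ^ 3 * (1 / ((b + 2) * (b + 4)\<^sup>2)) < (1 + 1 / (a + 2)) ^ 3 * (1 / ((a + 2) * (a + 4)\<^sup>2))"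
    using assms by (intro mult_strict_mono) (auto intro: add_pos_pos)
  thus ?thesis using e[of a] e[of b] assms by simp
qed

text \<open>For \<open>s = u + v\<close> and \<open>w = u v / s\<close>, the differences
\<open>D n = v\<^sup>-\<^sup>n / (v - 1) - u\<^sup>-\<^sup>n / (u - 1)\<close> satisfy a linear recurrence
with characteristic roots \<open>1/u\<close> and \<open>1/v\<close>.  The numbers \<open>branch_num t n\<close> are
\<open>4 (t + 3) w\<^sup>n D n / D 0\<close>, for which the recurrence depends on \<open>t\<close> only.\<close>

fun branch_num :: "real \<Rightarrow> nat \<Rightarrow> real" where
  "branch_num t 0 = 4 * (t + 3)"
| "branch_num t (Suc 0) = t + 6"
| "branch_num t (Suc (Suc n)) = branch_num t (Suc n) - branch_num t n / (t + 4)"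

lemma branch_num_values:
  fixes t :: real
  assumes "t > 0"
  shows "(t + 4) ^ 4 * branch_num t 4 = 192 + 416 * t + 300 * t ^ 2 + 100 * t ^ 3 + 16 * t ^ 4 + t ^ 5"
    and "(t + 4) ^ 4 * branch_num t 5 = 96 + 288 * t + 238 * t ^ 2 + 87 * t ^ 3 + 15 * t ^ 4 + t ^ 5"
    and "(t + 4) ^ 4 * branch_num t 6 = 48 + 196 * t + 186 * t ^ 2 + 75 * t ^ 3 + 14 * t ^ 4 + t ^ 5"
    and "(t + 4) ^ 4 * branch_num t 7 = 24 + 130 * t + 143 * t ^ 2 + 64 * t ^ 3 + 13 * t ^ 4 + t ^ 5"
    and "(t + 4) ^ 4 * branch_num t 8 = 12 + 84 * t + 108 * t ^ 2 + 54 * t ^ 3 + 12 * t ^ 4 + t ^ 5"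
    and "(t + 4) ^ 4 * branch_num t 9 = 6 + 53 * t + 80 * t ^ 2 + 45 * t ^ 3 + 11 * t ^ 4 + t ^ 5"
proof -
  define X where "X = (\<lambda>n. (t + 4) ^ 4 * branch_num t n)"
  have step: "X m = h2"
    if "X n = h0" "X k = h1" "k = Suc n" "m = Suc k" "(t + 4) * h2 = (t + 4) * h1 - h0" for m n k h0 h1 h2
  proof -
    have "(t + 4) * X (Suc (Suc n)) = (t + 4) * X (Suc n) - X n"
      using assms by (simp add: X_def field_simps)
    also have "\<dots> = (t + 4) * h2" using that by simp
    finally show ?thesis using assms that(3,4) by simp
  qed
  have X0: "X 0 = 3072 + 4096 * t + 2176 * t ^ 2 + 576 * t ^ 3 + 76 * t ^ 4 + 4 * t ^ 5"
    unfolding X_def branch_num.simps by algebra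
  have X1: "X 1 = 1536 + 1792 * t + 832 * t ^ 2 + 192 * t ^ 3 + 22 * t ^ 4 + t ^ 5"
    unfolding X_def One_nat_def branch_num.simps by algebra
  have X2: "X 2 = 768 + 960 * t + 496 * t ^ 2 + 132 * t ^ 3 + 18 * t ^ 4 + t ^ 5"
    by (rule step[OF X0 X1]) (simp, simp, algebra)
  have X3: "X 3 = 384 + 608 * t + 376 * t ^ 2 + 114 * t ^ 3 + 17 * t ^ 4 + t ^ 5"
    by (rule step[OF X1 X2]) (simp, simp, algebra)
  have X4: "X 4 = 192 + 416 * t + 300 * t ^ 2 + 100 * t ^ 3 + 16 * t ^ 4 + t ^ 5"
    by (rule step[OF X2 X3]) (simp, simp, algebra)
  have X5: "X 5 = 96 + 288 * t + 238 * t ^ 2 + 87 * t ^ 3 + 15 * t ^ 4 + t ^ 5"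
    by (rule step[OF X3 X4]) (simp, simp, algebra)
  have X6: "X 6 = 48 + 196 * t + 186 * t ^ 2 + 75 * t ^ 3 + 14 * t ^ 4 + t ^ 5"
    by (rule step[OF X4 X5]) (simp, simp, algebra)
  have X7: "X 7 = 24 + 130 * t + 143 * t ^ 2 + 64 * t ^ 3 + 13 * t ^ 4 + t ^ 5"
    by (rule step[OF X5 X6]) (simp, simp, algebra)
  have X8: "X 8 = 12 + 84 * t + 108 * t ^ 2 + 54 * t ^ 3 + 12 * t ^ 4 + t ^ 5"
    by (rule step[OF X6 X7]) (simp, simp, algebra)
  have X9: "X 9 = 6 + 53 * t + 80 * t ^ 2 + 45 * t ^ 3 + 11 * t ^ 4 + t ^ 5"
    by (rule step[OF X7 X8]) (simp, simp, algebra)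
  show "(t + 4) ^ 4 * branch_num t 4 = 192 + 416 * t + 300 * t ^ 2 + 100 * t ^ 3 + 16 * t ^ 4 + t ^ 5"
    using X4 by (simp only: X_def)
  show "(t + 4) ^ 4 * branch_num t 5 = 96 + 288 * t + 238 * t ^ 2 + 87 * t ^ 3 + 15 * t ^ 4 + t ^ 5"
    using X5 by (simp only: X_def)
  show "(t + 4) ^ 4 * branch_num t 6 = 48 + 196 * t + 186 * t ^ 2 + 75 * t ^ 3 + 14 * t ^ 4 + t ^ 5"
    using X6 by (simp only: X_def)
  show "(t + 4) ^ 4 * branch_num t 7 = 24 + 130 * t + 143 * t ^ 2 + 64 * t ^ 3 + 13 * t ^ 4 + t ^ 5"
    using X7 by (simp only: X_def)
  show "(t + 4) ^ 4 * branch_num t 8 = 12 + 84 * t + 108 * t ^ 2 + 54 * t ^ 3 + 12 * t ^ 4 + t ^ 5"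
    using X8 by (simp only: X_def)
  show "(t + 4) ^ 4 * branch_num t 9 = 6 + 53 * t + 80 * t ^ 2 + 45 * t ^ 3 + 11 * t ^ 4 + t ^ 5"
    using X9 by (simp only: X_def)
qed

text \<open>The left-hand sides are those that occur in \<open>even_density_factor\<close>.  Multiplication by
\<open>N = 4 (t + 3) (t + 4)\<^sup>4 w\<^sup>9 W\<^sup>5\<close>, where \<open>w W = 4 (t + 3)\<close>, turns every \<open>D n\<close> with \<open>4 \<le> n \<le> 9\<close>
into \<open>D 0\<close> times a polynomial in \<open>t\<close>.\<close>

lemma branch_combinations:
  fixes u v t :: real
  assumes uv: "0 < u" "u < 1" "1 < v" and lev: "3 * v ^ 4 - 4 * v ^ 3 = 3 * u ^ 4 - 4 * u ^ 3"
    and t: "t = (v - u)\<^sup>2 / (u * v)"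
  defines "D \<equiv> \<lambda>n. inverse v ^ n / (v - 1) - inverse u ^ n / (u - 1)"
  shows "\<exists>M>0. 6 * D 9 + 5 * D 8 + 4 * D 7 + 9 * D 6 = M * (54 * poly p0 t)
    \<and> 5 * D 8 + 4 * D 7 + 3 * D 6 + 12 * D 5 = M * (36 * poly p1 t)
    \<and> 4 * D 7 + 3 * D 6 + 2 * D 5 + 15 * D 4 = M * (192 * poly p2 t)"
proof -
  define s where "s = u + v"
  define p where "p = u * v"
  define w where "w = p / s"
  have v0: "0 < v" "u \<noteq> v" using uv by auto
  note P = oval_endpoints_param[OF uv(1) v0 lev t, folded s_def p_def]
  have t0: "t > 0" by (rule P(1))
  have s0: "s > 0" "p > 0" "w > 0" using uv by (auto simp: s_def p_def w_def)
  have sw: "p = s * w" using s0 by (simp add: w_def)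
  have sw4: "s = (t + 4) * w"
    using P(2) s0 by (simp add: w_def power2_eq_square field_simps)
  have D0: "D 0 > 0" 
  proof -
    have "1 / (v - 1) > 0" "1 / (u - 1) < 0" using uv by auto
    hence "1 / (v - 1) - 1 / (u - 1) > 0" by linarith
    thus ?thesis by (simp only: D_def power_0)
  qed
  have rec: "p * D (Suc (Suc n)) = s * D (Suc n) - D n" for n
  proof -
    have "p * inverse x ^ Suc (Suc n) = s * inverse x ^ Suc n - inverse x ^ n" if "x = u \<or> x = v" for x
    proof -
      have x: "x > 0" using that uv by auto
      have "p = s * x - x\<^sup>2" using that by (auto simp: s_def p_def power2_eq_square algebra_simps)
      hence "p * inverse x * inverse x = s * inverse x - 1"
        using x by (simp add: field_simps power2_eq_square)
      hence "p * inverse x * inverse x * inverse x ^ n = (s * inverse x - 1) * inverse x ^ n" by (rule arg_cong)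
      thus ?thesis by (simp add: algebra_simps)
    qed
    from this[of u] this[of v] show ?thesis
      unfolding D_def right_diff_distrib times_divide_eq_right by (simp add: diff_divide_distrib)
  qed
  have D1: "p * D (Suc 0) = (s - 1) * D 0"
  proof -
    obtain c d where cd: "(v - 1) * c = 1" "(u - 1) * d = 1" and D: "D n = inverse v ^ n * c - inverse u ^ n * d" for n
      by (rule that[of "1 / (v - 1)" "1 / (u - 1)"]) (use uv in \<open>auto simp: D_def\<close>)
    have "v * inverse v = 1" "u * inverse u = 1" using uv by auto
    thus ?thesis using cd unfolding p_def s_def D power_0 power_Suc0_right by algebra
  qed
  define E where "E = (\<lambda>n. D n * w ^ n)"
  have E2: "E (Suc (Suc n)) = E (Suc n) - E n / (t + 4)" for n
  proof -
    have "s * w * D (Suc (Suc n)) = s * D (Suc n) - D n" using rec[of n] sw by simp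
    hence "w ^ Suc n * (s * w * D (Suc (Suc n))) = w ^ Suc n * (s * D (Suc n) - D n)" by (rule arg_cong)
    hence "s * E (Suc (Suc n)) = s * E (Suc n) - w * E n" by (simp add: E_def algebra_simps)
    also have "w * E n = s * (E n / (t + 4))" using sw4 t0 by simp
    finally have "s * E (Suc (Suc n)) = s * (E (Suc n) - E n / (t + 4))" by (simp add: algebra_simps)
    thus ?thesis using s0 by simp
  qed
  have E1: "4 * (t + 3) * E (Suc 0) = D 0 * (t + 6)"
  proof -
    have "s * E (Suc 0) = (s - 1) * D 0" using D1[unfolded sw] by (simp add: E_def mult_ac)
    hence "3 * (t + 2) * (s * E (Suc 0)) = 3 * (t + 2) * ((s - 1) * D 0)" by simp
    hence "(3 * (t + 2) * s) * E (Suc 0) = (3 * (t + 2) * s - 3 * (t + 2)) * D 0" by (simp add: algebra_simps)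
    thus ?thesis unfolding P(3) by (simp add: algebra_simps)
  qed
  have E: "4 * (t + 3) * E n = D 0 * branch_num t n \<and> 4 * (t + 3) * E (Suc n) = D 0 * branch_num t (Suc n)" for n
  proof (induction n)
    case 0
    show ?case using E1 by (simp add: E_def)
  next
    case (Suc n)
    have "4 * (t + 3) * E (Suc (Suc n)) = 4 * (t + 3) * E (Suc n) - 4 * (t + 3) * E n / (t + 4)"
      unfolding E2 by (simp only: right_diff_distrib times_divide_eq_right)
    also have "\<dots> = D 0 * branch_num t (Suc (Suc n))"
      using Suc by (simp only: branch_num.simps right_diff_distrib times_divide_eq_right)
    finally show ?case using Suc by simp
  qed
  define W where "W = 3 * (t + 2) * (t + 4)"
  have wW: "w * W = 4 * (t + 3)" using P(3) unfolding sw4 W_def by (simp add: algebra_simps)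
  define N where "N = 4 * (t + 3) * (t + 4) ^ 4 * w ^ 9 * W ^ 5"
  have N: "N > 0" using t0 s0 by (simp add: N_def W_def)
  have DN: "N * D n = D 0 * ((4 * (t + 3)) ^ j * W ^ (5 - j) * ((t + 4) ^ 4 * branch_num t n))"
    if "n + j = 9" "j \<le> 5" for n j
  proof -
    have "w ^ 9 = w ^ n * w ^ j" "W ^ 5 = W ^ j * W ^ (5 - j)"
      using that by (simp_all flip: power_add)
    hence "N * D n = (w * W) ^ j * W ^ (5 - j) * (t + 4) ^ 4 * (4 * (t + 3) * E n)"
      by (simp add: N_def E_def power_mult_distrib)
    also have "4 * (t + 3) * E n = D 0 * branch_num t n" using E by blast
    finally show ?thesis unfolding wW by simp
  qed
  define M where "M = D 0 * (t + 3) * (t + 4)\<^sup>2 / N"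
  have M: "M > 0" using D0 N t0 by (simp add: M_def)
  note V = branch_num_values[OF t0]
  note DNs = DN[of 9 0, simplified, unfolded V] DN[of 8 1, simplified, unfolded V]
    DN[of 7 2, simplified, unfolded V] DN[of 6 3, simplified, unfolded V]
    DN[of 5 4, simplified, unfolded V] DN[of 4 5, simplified, unfolded V]
  have "N * (6 * D 9 + 5 * D 8 + 4 * D 7 + 9 * D 6) = N * (M * (54 * poly p0 t))"
  proof -
    have "N * (6 * D 9 + 5 * D 8 + 4 * D 7 + 9 * D 6) = 6 * (N * D 9) + 5 * (N * D 8) + 4 * (N * D 7) + 9 * (N * D 6)"
      by (simp add: algebra_simps)
    also have "\<dots> = D 0 * (t + 3) * (t + 4)\<^sup>2 * (54 * poly p0 t)"
      unfolding DNs W_def p0_def poly_pCons poly_0 by algebra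
    also have "\<dots> = N * (M * (54 * poly p0 t))" using N by (simp add: M_def)
    finally show ?thesis .
  qed
  moreover have "N * (5 * D 8 + 4 * D 7 + 3 * D 6 + 12 * D 5) = N * (M * (36 * poly p1 t))"
  proof -
    have "N * (5 * D 8 + 4 * D 7 + 3 * D 6 + 12 * D 5) = 5 * (N * D 8) + 4 * (N * D 7) + 3 * (N * D 6) + 12 * (N * D 5)"
      by (simp add: algebra_simps)
    also have "\<dots> = D 0 * (t + 3) * (t + 4)\<^sup>2 * (36 * poly p1 t)"
      unfolding DNs W_def p1_def poly_pCons poly_0 by algebra
    also have "\<dots> = N * (M * (36 * poly p1 t))" using N by (simp add: M_def)
    finally show ?thesis .
  qed
  moreover have "N * (4 * D 7 + 3 * D 6 + 2 * D 5 + 15 * D 4) = N * (M * (192 * poly p2 t))"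
  proof -
    have "N * (4 * D 7 + 3 * D 6 + 2 * D 5 + 15 * D 4) = 4 * (N * D 7) + 3 * (N * D 6) + 2 * (N * D 5) + 15 * (N * D 4)"
      by (simp add: algebra_simps)
    also have "\<dots> = D 0 * (t + 3) * (t + 4)\<^sup>2 * (192 * poly p2 t)"
      unfolding DNs W_def p2_def poly_pCons poly_0 by algebra
    also have "\<dots> = N * (M * (192 * poly p2 t))" using N by (simp add: M_def)
    finally show ?thesis .
  qed
  ultimately show ?thesis using M N by (intro exI[of _ M]) simp
qed

section \<open>The densities of the three integrals\<close>

definition normal_coord_inv_deriv :: "real \<Rightarrow> real" where
  "normal_coord_inv_deriv z = sqrt ((3 * (normal_coord_inv z)\<^sup>2 + 2 * normal_coord_inv z + 1) / 6) / (normal_coord_inv z)\<^sup>2"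

lemma normal_coord_inv_deriv_real_holomorphic: "real_holomorphic radius normal_coord_inv_deriv"
proof -
  obtain U' where U': "real_holomorphic radius U'" "\<And>z. \<bar>z\<bar> < radius \<Longrightarrow> (normal_coord_inv has_real_derivative U' z) (at z)"
    using real_holomorphic_deriv[OF normal_coord_inv_real_holomorphic] by metis
  show ?thesis
    by (rule real_holomorphic_cong[OF U'(1)])
      (use U'(2) normal_coord_inv_DERIV in \<open>auto simp: normal_coord_inv_deriv_def intro: DERIV_unique\<close>)
qed

lemma inverse_normal_coord_inv_real_holomorphic: "real_holomorphic radius (\<lambda>z. inverse (normal_coord_inv z))"
  by (rule real_holomorphic_inverse[OF normal_coord_inv_real_holomorphic]) (use normal_coord_inv(1) in force)

lemma inverse_normal_coord_inv_DERIV: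
  assumes "\<bar>z\<bar> < radius"
  shows "((\<lambda>z. inverse (normal_coord_inv z)) has_real_derivative - ((inverse (normal_coord_inv z))\<^sup>2 * normal_coord_inv_deriv z)) (at z)"
  using DERIV_inverse'[OF normal_coord_inv_DERIV[OF assms]] normal_coord_inv(1)[OF assms]
  by (simp add: normal_coord_inv_deriv_def power2_eq_square field_simps)

text \<open>The density of the integral of \<open>(a u\<^sup>-\<^sup>4 + b u\<^sup>-\<^sup>3 + c u\<^sup>-\<^sup>2) y dx\<close>.\<close>

definition form_density :: "real \<Rightarrow> real \<Rightarrow> real \<Rightarrow> real \<Rightarrow> real" where
  "form_density a b c z = (a * inverse (normal_coord_inv z) ^ 4 + b * inverse (normal_coord_inv z) ^ 3 + c * inverse (normal_coord_inv z) ^ 2) * normal_coord_inv_deriv z"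

text \<open>For \<open>G = form_density a b c\<close> this is \<open>G + (z G)' / 3\<close>, in closed form; see \<open>mult_density_DERIV\<close>.\<close>

definition raised_density :: "real \<Rightarrow> real \<Rightarrow> real \<Rightarrow> real \<Rightarrow> real" where
  "raised_density a b c z = (let y = inverse (normal_coord_inv z) in
     1 / 18 * (a * (6 * y ^ 7 + 5 * y ^ 6 + 4 * y ^ 5 + 9 * y ^ 4) + b * (5 * y ^ 6 + 4 * y ^ 5 + 3 * y ^ 4 + 12 * y ^ 3)
      + c * (4 * y ^ 5 + 3 * y ^ 4 + 2 * y ^ 3 + 15 * y\<^sup>2)) * normal_coord_inv_deriv z)"

lemmas real_holomorphic_intros = real_holomorphic_const real_holomorphic_add real_holomorphic_mult
  real_holomorphic_power inverse_normal_coord_inv_real_holomorphic normal_coord_inv_deriv_real_holomorphic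

lemma density_real_holomorphic: "real_holomorphic radius (form_density a b c)"
  unfolding form_density_def by (intro real_holomorphic_intros)

lemma raised_density_real_holomorphic: "real_holomorphic radius (raised_density a b c)"
  unfolding raised_density_def Let_def by (intro real_holomorphic_intros)

text \<open>Since \<open>z = (u - 1) sqrt q\<close> and \<open>du/dz = sqrt q / u\<^sup>2\<close> with \<open>q = (3u\<^sup>2 + 2u + 1) / 6\<close>, the square roots
cancel in \<open>z G\<close>, which is a polynomial \<open>B\<close> in \<open>1/u\<close>.\<close>

lemma mult_density_DERIV:
  assumes z: "\<bar>z\<bar> < radius"
  shows "((\<lambda>z. z * form_density a b c z) has_real_derivative 3 * (raised_density a b c z - form_density a b c z)) (at z)"
proof -
  define B where "B = (\<lambda>y::real. (a * (3 * y ^ 3 - y ^ 4 - y ^ 5 - y ^ 6) + b * (3 * y\<^sup>2 - y ^ 3 - y ^ 4 - y ^ 5)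
     + c * (3 * y - y\<^sup>2 - y ^ 3 - y ^ 4)) / 6)"
  define B' where "B' = (\<lambda>y::real. (a * (9 * y\<^sup>2 - 4 * y ^ 3 - 5 * y ^ 4 - 6 * y ^ 5) + b * (6 * y - 3 * y\<^sup>2 - 4 * y ^ 3 - 5 * y ^ 4)
     + c * (3 - 2 * y - 3 * y\<^sup>2 - 4 * y ^ 3)) / 6)"
  define y where "y = inverse (normal_coord_inv z)"
  have "(B has_real_derivative B' y) (at y)"
    unfolding B_def B'_def by (rule derivative_eq_intros refl | simp)+
  from DERIV_chain2[OF this[unfolded y_def] inverse_normal_coord_inv_DERIV[OF z]]
  have "((\<lambda>z. B (inverse (normal_coord_inv z))) has_real_derivative B' y * - (y\<^sup>2 * normal_coord_inv_deriv z)) (at z)"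
    by (simp add: y_def)
  hence "((\<lambda>z. z * form_density a b c z) has_real_derivative B' y * - (y\<^sup>2 * normal_coord_inv_deriv z)) (at z)"
  proof (rule has_field_derivative_transform_within_open[where S = "{-radius<..<radius}"])
    fix x :: real assume "x \<in> {-radius<..<radius}"
    hence x: "\<bar>x\<bar> < radius" by auto
    define v where "v = normal_coord_inv x"
    have v: "v > 0" using normal_coord_inv(1)[OF x] by (simp add: v_def)
    have iv: "v * inverse v = 1" using v by simp
    define q where "q = sqrt ((3 * v\<^sup>2 + 2 * v + 1) / 6)"
    have "x = (v - 1) * q" using normal_coord_inv(3)[OF x] by (simp add: normal_coord_def v_def q_def)
    moreover have "q * q = (3 * v\<^sup>2 + 2 * v + 1) / 6" using quad_pos[of v] by (simp add: q_def)
    moreover have "normal_coord_inv_deriv x = q * (inverse v)\<^sup>2"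
      by (simp only: normal_coord_inv_deriv_def q_def v_def divide_inverse power_inverse)
    ultimately have "x * normal_coord_inv_deriv x = (v - 1) * ((3 * v\<^sup>2 + 2 * v + 1) / 6) * (inverse v)\<^sup>2" by algebra
    note xd = this
    let ?f = "a * inverse v ^ 4 + b * inverse v ^ 3 + c * inverse v ^ 2"
    have "x * form_density a b c x = ?f * (x * normal_coord_inv_deriv x)"
      unfolding form_density_def v_def[symmetric] by (simp only: mult.left_commute)
    also have "\<dots> = ?f * ((v - 1) * (3 * v\<^sup>2 + 2 * v + 1) * (inverse v)\<^sup>2) / 6"
      unfolding xd by simp
    also have "?f * ((v - 1) * (3 * v\<^sup>2 + 2 * v + 1) * (inverse v)\<^sup>2) = 6 * B (inverse v)"
    proof -
      have "6 * B y = a * (3 * y ^ 3 - y ^ 4 - y ^ 5 - y ^ 6) + b * (3 * y\<^sup>2 - y ^ 3 - y ^ 4 - y ^ 5)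
        + c * (3 * y - y\<^sup>2 - y ^ 3 - y ^ 4)" for y by (simp add: B_def)
      moreover have "(a * y ^ 4 + b * y ^ 3 + c * y ^ 2) * ((v - 1) * (3 * v\<^sup>2 + 2 * v + 1) * y\<^sup>2)
        = a * (3 * y ^ 3 - y ^ 4 - y ^ 5 - y ^ 6) + b * (3 * y\<^sup>2 - y ^ 3 - y ^ 4 - y ^ 5)
        + c * (3 * y - y\<^sup>2 - y ^ 3 - y ^ 4)" if "v * y = 1" for y
        using that by algebra
      ultimately show ?thesis using iv by simp
    qed
    also have "6 * B (inverse v) / 6 = B (inverse v)" by simp
    finally show "B (inverse (normal_coord_inv x)) = x * form_density a b c x" by (simp add: v_def)
  qed (use z in auto)
  moreover have "B' y * - (y\<^sup>2 * normal_coord_inv_deriv z) = 3 * (raised_density a b c z - form_density a b c z)"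
    unfolding B'_def raised_density_def form_density_def Let_def y_def[symmetric]
    by (simp add: field_simps) algebra
  ultimately show ?thesis by simp
qed

definition even_density :: "real \<Rightarrow> real \<Rightarrow> real \<Rightarrow> real \<Rightarrow> real" where
  "even_density a b c z = raised_density a b c z + raised_density a b c (- z)"

lemma even_density_real_holomorphic: "real_holomorphic radius (even_density a b c)"
  unfolding even_density_def
  by (intro real_holomorphic_add real_holomorphic_reflect raised_density_real_holomorphic)

lemma level_bounds:
  assumes "h \<in> {0<..<1 / 12}"
  shows "0 < h" "h < radius\<^sup>2 / 2" "radius > 0"
  using assms by auto

text \<open>With \<open>N k\<close> for \<open>oval_integral k\<close>, the shift rule gives \<open>2h N 1 G = N 2 G + N 1 (z\<^sup>2 G)\<close>, and
integration by parts gives \<open>3 N 1 (z\<^sup>2 G) = N 2 ((z G)')\<close>.\<close>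

lemma oval_integral_density:
  assumes "h \<in> {0<..<1 / 12}"
  shows "4 * h * oval_integral 1 (form_density a b c) h = oval_integral 2 (even_density a b c) h"
proof -
  note h = level_bounds[OF assms]
  let ?G = "form_density a b c" and ?S = "raised_density a b c"
  note hG = density_real_holomorphic[of a b c] and hS = raised_density_real_holomorphic[of a b c]
  define K' where "K' = (\<lambda>z. 3 * ?S z + - 3 * ?G z)"
  have K': "real_holomorphic radius K'"
    unfolding K'_def by (intro real_holomorphic_intros hG hS)
  have "oval_integral (Suc 1) K' h = (2 * real 1 + 1) * oval_integral 1 (\<lambda>z. z * (z * ?G z)) h"
    using mult_density_DERIV by (intro oval_integral_by_parts[OF K' _ h, THEN trans]) (auto simp: K'_def)
  hence "oval_integral 2 K' h = 3 * oval_integral 1 (\<lambda>z. (z\<^sup>2 - 0) * ?G z) h"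
    by (simp add: numeral_2_eq_2 power2_eq_square mult.assoc)
  moreover have "oval_integral 2 K' h = 3 * oval_integral 2 ?S h + - 3 * oval_integral 2 ?G h"
    unfolding K'_def by (rule oval_integral_add[OF hS hG h])
  moreover have "oval_integral 1 (\<lambda>z. (z\<^sup>2 - 0) * ?G z) h = (2 * h - 0) * oval_integral 1 ?G h - oval_integral 2 ?G h"
    using oval_integral_shift[OF hG h, of 1 0] by (simp add: numeral_2_eq_2)
  ultimately have 1: "2 * h * oval_integral 1 ?G h = oval_integral 2 ?S h" by simp
  have "oval_integral 2 (\<lambda>z. 1 * ?S z + 1 * ?S (- z)) h = 1 * oval_integral 2 ?S h + 1 * oval_integral 2 (\<lambda>z. ?S (- z)) h"
    by (rule oval_integral_add[OF hS real_holomorphic_reflect[OF hS] h])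
  hence "oval_integral 2 (even_density a b c) h = 2 * oval_integral 2 ?S h"
    by (simp add: even_density_def[abs_def] oval_integral_reflect)
  thus ?thesis using 1 by simp
qed

lemma normal_coord_inv_sides:
  assumes "0 < z" "z < radius"
  shows "normal_coord_inv z > 1" "normal_coord_inv (- z) < 1" "normal_coord_inv (- z) > 0"
    and "3 * (normal_coord_inv z) ^ 4 - 4 * (normal_coord_inv z) ^ 3 = 6 * z\<^sup>2 - 1"
    and "3 * (normal_coord_inv (- z)) ^ 4 - 4 * (normal_coord_inv (- z)) ^ 3 = 6 * z\<^sup>2 - 1"
proof -
  have z: "\<bar>z\<bar> < radius" "\<bar>- z\<bar> < radius" using assms by auto
  note v = normal_coord_inv[OF z(1)] and u = normal_coord_inv[OF z(2)]
  have lev: "3 * x ^ 4 - 4 * x ^ 3 = 6 * (normal_coord x)\<^sup>2 - 1" for x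
  proof -
    have "(normal_coord x)\<^sup>2 = (x - 1)\<^sup>2 * ((3 * x\<^sup>2 + 2 * x + 1) / 6)"
      using quad_pos[of x] by (simp add: normal_coord_def power_mult_distrib)
    hence "6 * (normal_coord x)\<^sup>2 = (x - 1)\<^sup>2 * (3 * x\<^sup>2 + 2 * x + 1)" by simp
    also have "\<dots> = 3 * x ^ 4 - 4 * x ^ 3 + 1" by algebra
    finally show ?thesis by simp
  qed
  show "3 * (normal_coord_inv z) ^ 4 - 4 * (normal_coord_inv z) ^ 3 = 6 * z\<^sup>2 - 1"
    "3 * (normal_coord_inv (- z)) ^ 4 - 4 * (normal_coord_inv (- z)) ^ 3 = 6 * z\<^sup>2 - 1"
    using lev[of "normal_coord_inv z"] lev[of "normal_coord_inv (- z)"] unfolding v(3) u(3) by simp_all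
  have pos: "sqrt ((3 * x\<^sup>2 + 2 * x + 1) / 6) > 0" for x using quad_pos[of x] by simp
  have "0 < normal_coord (normal_coord_inv z)" using v(3) assms by simp
  thus "normal_coord_inv z > 1" using pos[of "normal_coord_inv z"] unfolding normal_coord_def by (simp add: zero_less_mult_iff)
  have "normal_coord (normal_coord_inv (- z)) < 0" using u(3) assms by simp
  thus "normal_coord_inv (- z) < 1" using pos[of "normal_coord_inv (- z)"] unfolding normal_coord_def by (simp add: mult_less_0_iff)
  show "normal_coord_inv (- z) > 0" by (rule u(1))
qed

text \<open>The parameter \<open>t\<close> of the pair of points of potential \<open>z\<^sup>2 / 2\<close>.\<close>

definition spread :: "real \<Rightarrow> real" where
  "spread z = (normal_coord_inv z - normal_coord_inv (- z))\<^sup>2 / (normal_coord_inv (- z) * normal_coord_inv z)"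

text \<open>The potential of the pair is a strictly monotone function of its parameter by
\<open>oval_endpoints_level\<close> and \<open>level_strict_antimono\<close>.\<close>

lemma spread_strict_mono:
  assumes "0 < z" "z < z'" "z' < radius"
  shows "0 < spread z" "spread z < spread z'"
proof -
  have *: "0 < spread z \<and> 6 * z\<^sup>2 - 1 = - 256 / 27 * ((spread z + 3) ^ 3 / ((spread z + 2) ^ 4 * (spread z + 4)\<^sup>2))"
    if "0 < z" "z < radius" for z
  proof -
    note U = normal_coord_inv_sides[OF that]
    have uv: "0 < normal_coord_inv (- z)" "0 < normal_coord_inv z" "normal_coord_inv (- z) \<noteq> normal_coord_inv z" using U by auto
    have lev: "3 * normal_coord_inv z ^ 4 - 4 * normal_coord_inv z ^ 3 = 3 * normal_coord_inv (- z) ^ 4 - 4 * normal_coord_inv (- z) ^ 3"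
      using U by simp
    from oval_endpoints_level[OF uv lev spread_def] oval_endpoints_param(1)[OF uv lev spread_def]
    show ?thesis using U(4) by simp
  qed
  have z: "z < radius" "0 < z'" using assms by auto
  show "0 < spread z" using *[OF assms(1) z(1)] by simp
  have sq: "z\<^sup>2 < z'\<^sup>2" using assms by (simp add: power_strict_mono)
  show "spread z < spread z'"
  proof (rule ccontr)
    assume "\<not> ?thesis"
    hence "(spread z + 3) ^ 3 / ((spread z + 2) ^ 4 * (spread z + 4)\<^sup>2)
      \<le> (spread z' + 3) ^ 3 / ((spread z' + 2) ^ 4 * (spread z' + 4)\<^sup>2)"
      using level_strict_antimono[of "spread z'" "spread z"] *[OF z(2) assms(3)]
      by (cases "spread z = spread z'") auto
    thus False using *[OF z(2) assms(3)] *[OF assms(1) z(1)] sq by simp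
  qed
qed

lemma spread_pos: "0 < z \<Longrightarrow> z < radius \<Longrightarrow> 0 < spread z"
  using spread_strict_mono(1)[of z "(z + radius) / 2"] by simp

text \<open>Since \<open>du/dz = z / (u\<^sup>2 (u - 1))\<close> away from the minimum, the contributions of \<open>z\<close> and \<open>-z\<close> are
values at \<open>v\<close> and \<open>u\<close> of the same combination of functions \<open>u\<^sup>-\<^sup>n / (u - 1)\<close>, with
opposite signs.\<close>

lemma even_density_factor:
  assumes z: "0 < z" "z < radius"
  shows "\<exists>M>0. even_density a b c z =
    M * poly (smult (54 * a) p0 + smult (36 * b) p1 + smult (192 * c) p2) (spread z)"
proof -
  define v where "v = normal_coord_inv z"
  define u where "u = normal_coord_inv (- z)"
  note U = normal_coord_inv_sides[OF z, folded u_def v_def]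
  define D where "D = (\<lambda>n. inverse v ^ n / (v - 1) - inverse u ^ n / (u - 1))"
  have lev: "3 * v ^ 4 - 4 * v ^ 3 = 3 * u ^ 4 - 4 * u ^ 3" using U by simp
  have t: "spread z = (v - u)\<^sup>2 / (u * v)" by (simp add: spread_def u_def v_def)
  obtain M where M: "M > 0"
    "6 * D 9 + 5 * D 8 + 4 * D 7 + 9 * D 6 = M * (54 * poly p0 (spread z))"
    "5 * D 8 + 4 * D 7 + 3 * D 6 + 12 * D 5 = M * (36 * poly p1 (spread z))"
    "4 * D 7 + 3 * D 6 + 2 * D 5 + 15 * D 4 = M * (192 * poly p2 (spread z))"
    using branch_combinations[OF U(3,2,1) lev t] unfolding D_def by blast
  have dU: "normal_coord_inv_deriv x = x * (inverse (normal_coord_inv x))\<^sup>2 * (1 / (normal_coord_inv x - 1))"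
    if "\<bar>x\<bar> < radius" "normal_coord_inv x \<noteq> 1" for x
  proof -
    have "x = (normal_coord_inv x - 1) * sqrt ((3 * (normal_coord_inv x)\<^sup>2 + 2 * normal_coord_inv x + 1) / 6)"
      using normal_coord_inv(3)[OF that(1)] by (simp add: normal_coord_def)
    hence "sqrt ((3 * (normal_coord_inv x)\<^sup>2 + 2 * normal_coord_inv x + 1) / 6) = x * (1 / (normal_coord_inv x - 1))"
      using that(2) by (simp add: field_simps)
    thus ?thesis by (simp only: normal_coord_inv_deriv_def divide_inverse power_inverse mult_ac)
  qed
  define c1 where "c1 = 1 / (v - 1)"
  define c2 where "c2 = 1 / (u - 1)"
  define y where "y = inverse v"
  define x where "x = inverse u"
  have D: "D n = y ^ n * c1 - x ^ n * c2" for n by (simp add: D_def c1_def c2_def x_def y_def)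
  have d: "normal_coord_inv_deriv z = z * y\<^sup>2 * c1" "normal_coord_inv_deriv (- z) = - z * x\<^sup>2 * c2"
    using dU[of z] dU[of "- z"] z U(1,2) by (auto simp: v_def u_def c1_def c2_def x_def y_def)
  have "18 * even_density a b c z = z * (a * (6 * D 9 + 5 * D 8 + 4 * D 7 + 9 * D 6)
      + b * (5 * D 8 + 4 * D 7 + 3 * D 6 + 12 * D 5) + c * (4 * D 7 + 3 * D 6 + 2 * D 5 + 15 * D 4))"
    unfolding even_density_def raised_density_def Let_def u_def[symmetric] v_def[symmetric]
      x_def[symmetric] y_def[symmetric] d D
    by (simp add: field_simps)
  hence "even_density a b c z = (z * M / 18) *
      poly (smult (54 * a) p0 + smult (36 * b) p1 + smult (192 * c) p2) (spread z)"
    unfolding M(2-4) by (simp add: algebra_simps)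
  thus ?thesis using M(1) z by (intro exI[of _ "z * M / 18"]) simp
qed

lemma even_density_finite_zeros:
  assumes "a \<noteq> 0 \<or> b \<noteq> 0 \<or> c \<noteq> 0"
  shows "finite {z \<in> {0<..<radius}. even_density a b c z = 0}"
proof -
  define Q where "Q = smult (54 * a) p0 + smult (36 * b) p1 + smult (192 * c) p2"
  have "Q \<noteq> 0" unfolding Q_def by (rule combination_nonzero) (use assms in auto)
  hence fin: "finite {t. poly Q t = 0}" by (rule poly_roots_finite)
  have "inj_on spread {0<..<radius}"
  proof (rule linorder_inj_onI)
    fix x y assume "x < y" "x \<in> {0<..<radius}" "y \<in> {0<..<radius}"
    thus "spread x \<noteq> spread y" using spread_strict_mono(2)[of x y] by auto
  qed auto
  hence "finite (spread -` {t. poly Q t = 0} \<inter> {0<..<radius})"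
    by (rule finite_vimage_IntI[OF fin])
  moreover have "poly Q (spread z) = 0" if "0 < z" "z < radius" "even_density a b c z = 0" for z
    using even_density_factor[OF that(1,2), of a b c] that(3) by (auto simp: Q_def)
  ultimately show ?thesis by (auto elim!: finite_subset[rotated])
qed

section \<open>The Chebyshev property\<close>

text \<open>The place in \<open>[0, radius]\<close> where \<open>spread z\<close> leaves an initial segment; the inserted \<open>0\<close> is the
value for a segment that is never entered.\<close>

definition cut :: "real set \<Rightarrow> real" where
  "cut B = Sup (insert 0 {z. 0 < z \<and> z < radius \<and> spread z \<in> B})"

lemma cut:
  assumes "initial_segment B"
  shows "0 \<le> cut B"
    and "\<And>z. 0 < z \<Longrightarrow> z < radius \<Longrightarrow> z < cut B \<Longrightarrow> spread z \<in> B"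
    and "\<And>z. 0 < z \<Longrightarrow> z < radius \<Longrightarrow> cut B < z \<Longrightarrow> spread z \<notin> B"
proof -
  let ?X = "insert 0 {z. 0 < z \<and> z < radius \<and> spread z \<in> B}"
  have bdd: "bdd_above ?X" by (rule bdd_aboveI[of _ radius]) auto
  show "0 \<le> cut B" unfolding cut_def by (rule cSup_upper[OF _ bdd]) simp
  show "spread z \<in> B" if z: "0 < z" "z < radius" "z < cut B" for z
  proof -
    obtain z' where z': "z' \<in> ?X" "z < z'"
      using z(3) less_cSup_iff[OF _ bdd, of z] unfolding cut_def by blast
    hence "0 < z'" "z' < radius" "spread z' \<in> B" using z by auto
    moreover have "0 < spread z" "spread z < spread z'"
      using spread_strict_mono[OF z(1) z'(2)] \<open>z' < radius\<close> by auto
    ultimately show ?thesis using assms unfolding initial_segment_def by blast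
  qed
  show "spread z \<notin> B" if z: "0 < z" "z < radius" "cut B < z" for z
  proof
    assume "spread z \<in> B"
    hence "z \<le> cut B" unfolding cut_def using z by (intro cSup_upper[OF _ bdd]) simp
    thus False using z by simp
  qed
qed

lemma cut_mono: "B \<subseteq> C \<Longrightarrow> cut B \<le> cut C"
  unfolding cut_def by (intro cSup_subset_mono bdd_aboveI[of _ radius]) auto

lemma at_most_zeros_density:
  fixes a b c :: real
  assumes sgn: "\<sigma> \<in> {1, -1}"
    and z: "at_most_zeros n (oval_integral 2 (\<lambda>z. \<sigma> * even_density a b c z)) {0<..<1 / 12}"
  shows "at_most_zeros n (oval_integral 1 (form_density a b c)) {0<..<1 / 12}"
proof (rule at_most_zeros_cong[OF z])
  fix h :: real assume h: "h \<in> {0<..<1 / 12}"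
  have "oval_integral 2 (\<lambda>z. \<sigma> * even_density a b c z + 0 * even_density a b c z) h = \<sigma> * oval_integral 2 (even_density a b c) h + 0 * oval_integral 2 (even_density a b c) h"
    by (rule oval_integral_add[OF even_density_real_holomorphic even_density_real_holomorphic level_bounds[OF h]])
  thus "oval_integral 2 (\<lambda>z. \<sigma> * even_density a b c z) h = (4 * \<sigma> * h + 0) * oval_integral 1 (form_density a b c) h"
    unfolding oval_integral_density[OF h, symmetric] by simp
qed simp

lemma signed_density:
  assumes "a \<noteq> 0 \<or> b \<noteq> 0 \<or> c \<noteq> 0" "\<sigma> \<in> {1, -1}"
  shows "real_holomorphic radius (\<lambda>z. \<sigma> * even_density a b c z)"
    "finite {z \<in> {0<..<radius}. \<sigma> * even_density a b c z = 0}"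
    "\<And>z. \<sigma> * even_density a b c (- z) = \<sigma> * even_density a b c z"
proof -
  show "real_holomorphic radius (\<lambda>z. \<sigma> * even_density a b c z)"
    by (intro real_holomorphic_mult real_holomorphic_const even_density_real_holomorphic)
  show "finite {z \<in> {0<..<radius}. \<sigma> * even_density a b c z = 0}"
    using even_density_finite_zeros[OF assms(1)] assms(2) by auto
qed (simp add: even_density_def add.commute)

lemma density_at_most_zeros_0:
  assumes "a \<noteq> 0"
  shows "at_most_zeros 0 (oval_integral 1 (form_density a 0 0)) {0<..<1 / 12}"
proof -
  define \<sigma> where "\<sigma> = sgn a"
  have \<sigma>: "\<sigma> \<in> {1, -1}" "\<sigma> * a > 0" using assms by (auto simp: \<sigma>_def sgn_if)
  note S = signed_density[of a 0 0 \<sigma>]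
  show ?thesis
  proof (rule at_most_zeros_density[OF \<sigma>(1)], rule at_most_zerosI_nonzero)
    fix h :: real assume h: "h \<in> {0<..<1 / 12}"
    have "oval_integral 2 (\<lambda>z. \<sigma> * even_density a 0 0 z) h > 0"
    proof (rule oval_integral_even_pos[OF S(1,3,2) level_bounds[OF h]])
      fix z assume z: "0 < z" "z < sqrt (2 * h)"
      have zr: "z < radius" using z sqrt_level_less[OF level_bounds[OF h]] by auto
      obtain M where "M > 0" "even_density a 0 0 z = M * (54 * a * poly p0 (spread z))"
        using even_density_factor[OF z(1) zr, of a 0 0] by auto
      hence e: "\<sigma> * even_density a 0 0 z = M * 54 * (\<sigma> * a) * poly p0 (spread z)" by simp
      show "0 \<le> \<sigma> * even_density a 0 0 z"
        unfolding e using \<open>M > 0\<close>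
        by (intro less_imp_le[OF mult_pos_pos[OF mult_pos_pos[OF _ \<sigma>(2)] p0_pos[OF spread_pos[OF z(1) zr]]]]) simp
    qed (use assms \<sigma> in auto)
    thus "oval_integral 2 (\<lambda>z. \<sigma> * even_density a 0 0 z) h \<noteq> 0" by simp
  qed
qed

lemma density_at_most_zeros_1:
  assumes "a \<noteq> 0 \<or> b \<noteq> 0"
  shows "at_most_zeros 1 (oval_integral 1 (form_density a b 0)) {0<..<1 / 12}"
proof -
  obtain \<sigma> B where \<sigma>: "\<sigma> \<in> {1, -1}" and B: "initial_segment B"
    "\<And>t. t > 0 \<Longrightarrow> t \<in> B \<Longrightarrow> \<sigma> * poly (smult (54 * a) p0 + smult (36 * b) p1) t \<le> 0"
    "\<And>t. t > 0 \<Longrightarrow> t \<notin> B \<Longrightarrow> 0 \<le> \<sigma> * poly (smult (54 * a) p0 + smult (36 * b) p1) t"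
    using combination_one_sign_change[of "54 * a" "36 * b"] by metis
  note S = signed_density[of a b 0 \<sigma>]
  note C = cut[OF B(1)]
  have "at_most_zeros 1 (oval_integral (Suc 1) (\<lambda>z. \<sigma> * even_density a b 0 z)) {0<..<radius\<^sup>2 / 2}"
  proof (rule one_sign_change[OF S(1,3,2) _ C(1)])
    fix z assume z: "0 < z" "z < radius"
    obtain M where M: "M > 0" "even_density a b 0 z = M * poly (smult (54 * a) p0 + smult (36 * b) p1) (spread z)"
      using even_density_factor[OF z, of a b 0] by auto
    define P where "P = \<sigma> * poly (smult (54 * a) p0 + smult (36 * b) p1) (spread z)"
    have P: "spread z \<in> B \<Longrightarrow> P \<le> 0" "spread z \<notin> B \<Longrightarrow> 0 \<le> P"
      using B(2,3)[OF spread_pos[OF z]] by (auto simp: P_def)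
    consider "z < cut B" | "z = cut B" | "cut B < z" by linarith
    hence "(z\<^sup>2 - (cut B)\<^sup>2) * P \<ge> 0"
    proof cases
      case 1
      hence "z\<^sup>2 \<le> (cut B)\<^sup>2" using z by (intro power_mono) auto
      thus ?thesis using P(1) C(2)[OF z 1] by (intro mult_nonpos_nonpos) auto
    next
      case 3
      hence "(cut B)\<^sup>2 \<le> z\<^sup>2" using C(1) by (intro power_mono) auto
      thus ?thesis using P(2) C(3)[OF z 3] by (intro mult_nonneg_nonneg) auto
    qed simp
    hence "M * ((z\<^sup>2 - (cut B)\<^sup>2) * P) \<ge> 0" using M(1) by simp
    thus "(z\<^sup>2 - (cut B)\<^sup>2) * (\<sigma> * even_density a b 0 z) \<ge> 0"
      unfolding M(2) P_def by (simp only: mult_ac)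
  qed (use assms \<sigma> in auto)
  hence "at_most_zeros 1 (oval_integral 2 (\<lambda>z. \<sigma> * even_density a b 0 z)) {0<..<1 / 12}"
    by (simp add: numeral_2_eq_2)
  thus ?thesis by (rule at_most_zeros_density[OF \<sigma>])
qed

lemma density_at_most_zeros_2:
  assumes "a \<noteq> 0 \<or> b \<noteq> 0 \<or> c \<noteq> 0"
  shows "at_most_zeros 2 (oval_integral 1 (form_density a b c)) {0<..<1 / 12}"
proof -
  define Q where "Q = smult (54 * a) p0 + smult (36 * b) p1 + smult (192 * c) p2"
  obtain \<sigma> A B where \<sigma>: "\<sigma> \<in> {1, -1}" and AB: "initial_segment A" "initial_segment B" "A \<subseteq> B"
    and sg: "\<And>t. t > 0 \<Longrightarrow> (t \<in> A \<longrightarrow> 0 \<le> \<sigma> * poly Q t) \<and> (t \<in> B \<and> t \<notin> A \<longrightarrow> \<sigma> * poly Q t \<le> 0)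
      \<and> (t \<notin> B \<longrightarrow> 0 \<le> \<sigma> * poly Q t)"
    using combination_two_sign_changes[of "54 * a" "36 * b" "192 * c", folded Q_def] by auto
  note S = signed_density[of a b c \<sigma>]
  note CA = cut[OF AB(1)] and CB = cut[OF AB(2)]
  have "at_most_zeros 2 (oval_integral (Suc (Suc 0)) (\<lambda>z. \<sigma> * even_density a b c z)) {0<..<radius\<^sup>2 / 2}"
  proof (rule two_sign_changes[OF S(1,3,2) _ CA(1) cut_mono[OF AB(3)]])
    fix z assume z: "0 < z" "z < radius"
    obtain M where M: "M > 0" "even_density a b c z = M * poly Q (spread z)"
      using even_density_factor[OF z, of a b c] by (auto simp: Q_def)
    define P where "P = \<sigma> * poly Q (spread z)"
    have P: "spread z \<in> A \<Longrightarrow> 0 \<le> P" "spread z \<in> B \<Longrightarrow> spread z \<notin> A \<Longrightarrow> P \<le> 0" "spread z \<notin> B \<Longrightarrow> 0 \<le> P"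
      using sg[OF spread_pos[OF z]] by (auto simp: P_def)
    have sq: "z < cut X \<Longrightarrow> z\<^sup>2 - (cut X)\<^sup>2 \<le> 0" for X
      using z by (simp add: power_mono)
    have sq': "cut X < z \<Longrightarrow> z\<^sup>2 - (cut X)\<^sup>2 \<ge> 0" if "initial_segment X" for X
      using cut(1)[OF that] by (simp add: power_mono)
    note le = cut_mono[OF AB(3)]
    consider "z < cut A" | "z = cut A \<or> z = cut B" | "cut A < z" "z < cut B" | "cut B < z" by linarith
    hence "(z\<^sup>2 - (cut A)\<^sup>2) * (z\<^sup>2 - (cut B)\<^sup>2) * P \<ge> 0"
    proof cases
      case 1
      thus ?thesis using P(1) CA(2)[OF z 1] sq[of A] sq[of B] le
        by (intro mult_nonneg_nonneg mult_nonpos_nonpos) auto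
    next
      case 3
      thus ?thesis using P(2) CA(3)[OF z] CB(2)[OF z] sq'[OF AB(1)] sq[of B]
        by (intro mult_nonpos_nonpos mult_nonneg_nonpos) auto
    next
      case 4
      thus ?thesis using P(3) CB(3)[OF z] sq'[OF AB(1)] sq'[OF AB(2)] le
        by (intro mult_nonneg_nonneg) auto
    qed auto
    hence "M * ((z\<^sup>2 - (cut A)\<^sup>2) * (z\<^sup>2 - (cut B)\<^sup>2) * P) \<ge> 0" using M(1) by simp
    thus "(z\<^sup>2 - (cut A)\<^sup>2) * (z\<^sup>2 - (cut B)\<^sup>2) * (\<sigma> * even_density a b c z) \<ge> 0"
      unfolding M(2) P_def by (simp only: mult_ac)
  qed (use assms \<sigma> in auto)
  hence "at_most_zeros 2 (oval_integral 2 (\<lambda>z. \<sigma> * even_density a b c z)) {0<..<1 / 12}"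
    by (simp add: numeral_2_eq_2)
  thus ?thesis by (rule at_most_zeros_density[OF \<sigma>])
qed

lemma oval_integral_density_linear:
  assumes "h \<in> {0<..<1 / 12}"
  shows "oval_integral 1 (form_density a b c) h = a * oval_integral 1 (form_density 1 0 0) h
    + b * oval_integral 1 (form_density 0 1 0) h + c * oval_integral 1 (form_density 0 0 1) h"
proof -
  note H = density_real_holomorphic and h = level_bounds[OF assms]
  have e: "form_density a b c = (\<lambda>z. 1 * form_density a b 0 z + c * form_density 0 0 1 z)"
    "form_density a b 0 = (\<lambda>z. a * form_density 1 0 0 z + b * form_density 0 1 0 z)"
    by (auto simp: form_density_def algebra_simps)
  have "oval_integral 1 (form_density a b c) h = 1 * oval_integral 1 (form_density a b 0) h + c * oval_integral 1 (form_density 0 0 1) h"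
    by (subst e(1)) (rule oval_integral_add[OF H H h])
  moreover have "oval_integral 1 (form_density a b 0) h = a * oval_integral 1 (form_density 1 0 0) h + b * oval_integral 1 (form_density 0 1 0) h"
    by (subst e(2)) (rule oval_integral_add[OF H H h])
  ultimately show ?thesis by simp
qed

lemma I_tilde_eq:
  assumes ov: "oval Ham h (\<gamma> h)" and h: "h \<in> {0<..<1 / 12}"
    and proj: "Re ` path_image (\<gamma> h) \<subseteq> {-1<..<1 / 3}" and i: "i < 3"
  shows "I_tilde \<gamma> i h = - 2 * Re (winding_number (\<gamma> h) 0) *
      oval_integral 1 (form_density (of_bool (i = 0)) (of_bool (i = 1)) (of_bool (i = 2))) h"
    and "winding_number (\<gamma> h) 0 \<in> {1, -1}"
proof -
  let ?G = "form_density (of_bool (i = 0)) (of_bool (i = 1)) (of_bool (i = 2))"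
  have h': "0 < h" "h < 1 / 12" using h by auto
  have pr: "Re (\<gamma> h t) \<in> {-1<..<1 / 3}" if "t \<in> {0..1}" for t
    using proj that unfolding path_image_def by blast
  have Gf: "?G z = normal_coord_inv z powi (int i - 4) *
      (sqrt ((3 * (normal_coord_inv z)\<^sup>2 + 2 * normal_coord_inv z + 1) / 6) / (normal_coord_inv z)\<^sup>2)" for z
  proof -
    consider "i = 0" | "i = 1" | "i = 2" using i by linarith
    thus ?thesis
      by cases (simp_all add: form_density_def normal_coord_inv_deriv_def power_int_def power_inverse)
  qed
  note L = line_integral_on_oval[OF ov h' pr real_holomorphic_continuous[OF density_real_holomorphic] Gf]
  show "winding_number (\<gamma> h) 0 \<in> {1, -1}" by (rule L(2))
  show "I_tilde \<gamma> i h = - 2 * Re (winding_number (\<gamma> h) 0) * oval_integral 1 ?G h"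
    unfolding I_tilde_def by (rule L(1))
qed

theorem mainTheorem4:
  fixes \<gamma> :: "real \<Rightarrow> real \<Rightarrow> complex"
  assumes ovals: "\<And>h. h \<in> {0<..<1/12} \<Longrightarrow> oval Ham h (\<gamma> h)"
    and orientation: "\<And>h h'. h \<in> {0<..<1/12} \<Longrightarrow> h' \<in> {0<..<1/12} \<Longrightarrow>
      winding_number (\<gamma> h) 0 = winding_number (\<gamma> h') 0"
    and projection: "(\<Union>h\<in>{0<..<1/12}. Re ` path_image (\<gamma> h)) = {-1<..<1/3}"
  shows "ECT_system_unordered {0<..<1/12} 3 (I_tilde \<gamma>)"
proof -
  let ?L = "{0<..<1/12::real}"
  define \<kappa> where "\<kappa> = - 2 * Re (winding_number (\<gamma> (1 / 24)) 0)"
  define N where "N = (\<lambda>i::nat. oval_integral 1 (form_density (of_bool (i = 0)) (of_bool (i = 1)) (of_bool (i = 2))))"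
  have proj: "Re ` path_image (\<gamma> h) \<subseteq> {-1<..<1 / 3}" if "h \<in> ?L" for h
    using projection that by blast
  have I: "I_tilde \<gamma> i h = \<kappa> * N i h" if "h \<in> ?L" "i < 3" for i h
    using I_tilde_eq(1)[of h \<gamma> i, OF ovals[OF that(1)] that(1) proj[OF that(1)] that(2)]
      orientation[OF that(1), of "1 / 24"] by (simp add: \<kappa>_def N_def)
  have "winding_number (\<gamma> (1 / 24)) 0 \<in> {1, -1}"
    using I_tilde_eq(2)[of "1 / 24" \<gamma> 0] ovals[of "1 / 24"] proj[of "1 / 24"] by auto
  hence \<kappa>: "\<kappa> \<noteq> 0" by (auto simp: \<kappa>_def)
  have lin: "(\<Sum>j<k. \<alpha> j * I_tilde \<gamma> j h) = oval_integral 1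
      (form_density (\<kappa> * of_bool (0 < k) * \<alpha> 0) (\<kappa> * of_bool (1 < k) * \<alpha> 1) (\<kappa> * of_bool (2 < k) * \<alpha> 2)) h"
    if h: "h \<in> ?L" and k: "k \<le> 3" for k \<alpha> h
  proof -
    have "(\<Sum>j<k. \<alpha> j * I_tilde \<gamma> j h) = (\<Sum>j<k. \<alpha> j * (\<kappa> * N j h))"
      using I[OF h] k by (intro sum.cong) auto
    also have "\<dots> = \<kappa> * of_bool (0 < k) * \<alpha> 0 * N 0 h + \<kappa> * of_bool (1 < k) * \<alpha> 1 * N 1 h + \<kappa> * of_bool (2 < k) * \<alpha> 2 * N 2 h"
    proof -
      consider "k = 0" | "k = 1" | "k = 2" | "k = 3" using k by linarith
      thus ?thesis by cases (simp_all add: eval_nat_numeral lessThan_Suc)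
    qed
    finally show ?thesis
      unfolding oval_integral_density_linear[OF h, of "\<kappa> * of_bool (0 < k) * \<alpha> 0"] by (simp add: N_def)
  qed
  have an: "real_analytic_on (oval_integral 1 (form_density a b c)) ?L" for a b c
    using oval_integral_analytic[OF density_real_holomorphic, of 1] by simp
  have "ECT_system ?L 3 (I_tilde \<gamma>)"
    unfolding ECT_system_def Let_def
  proof (intro conjI ballI allI impI)
    show "open ?L" "is_interval ?L" by (auto simp: is_interval_1)
    fix j :: nat assume j: "j < 3"
    have "(\<Sum>i<Suc j. of_bool (i = j) * I_tilde \<gamma> i h) = I_tilde \<gamma> j h" for h
      by (subst sum.remove[of _ j]) auto
    with lin[of _ "Suc j" "\<lambda>i. of_bool (i = j)"] j show "real_analytic_on (I_tilde \<gamma> j) ?L"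
      by (intro real_analytic_on_cong[OF an]) auto
  next
    fix k and \<alpha> :: "nat \<Rightarrow> real" assume k: "k \<in> {1..3::nat}" and \<alpha>: "\<exists>j<k. \<alpha> j \<noteq> 0"
    define F where "F = (\<lambda>x. \<Sum>j<k. \<alpha> j * I_tilde \<gamma> j x)"
    define a b c where abc: "a = \<kappa> * of_bool (0 < k) * \<alpha> 0" "b = \<kappa> * of_bool (1 < k) * \<alpha> 1"
      "c = \<kappa> * of_bool (2 < k) * \<alpha> 2"
    have F: "oval_integral 1 (form_density a b c) h = F h" if "h \<in> ?L" for h
      using lin[OF that, of k \<alpha>] k by (simp add: F_def abc)
    have "at_most_zeros (k - 1) (oval_integral 1 (form_density a b c)) ?L"
    proof -
      consider "k = 1" | "k = 2" | "k = 3" using k by force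
      thus ?thesis
      proof cases
        case 1
        hence "a \<noteq> 0" "b = 0" "c = 0" using \<alpha> \<kappa> by (auto simp: abc)
        thus ?thesis using density_at_most_zeros_0[of a] 1 by simp
      next
        case 2
        hence "a \<noteq> 0 \<or> b \<noteq> 0" "c = 0" using \<alpha> \<kappa> by (auto simp: abc less_2_cases_iff)
        thus ?thesis using density_at_most_zeros_1[of a b] 2 by simp
      next
        case 3
        hence "a \<noteq> 0 \<or> b \<noteq> 0 \<or> c \<noteq> 0" using \<alpha> \<kappa> by (auto simp: abc numeral_3_eq_3 less_Suc_eq numeral_2_eq_2)
        thus ?thesis using density_at_most_zeros_2[of a b c] 3 by simp
      qed
    qed
    hence z: "at_most_zeros (k - 1) F ?L"
      by (rule at_most_zeros_cong[where c = 0 and d = 1]) (use F in auto)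
    have anF: "real_analytic_on F ?L"
      by (rule real_analytic_on_cong[OF an]) (use F in auto)
    have inf: "infinite ?L" by simp
    note R = at_most_zeros_imp_zero_multiplicity_bound[OF anF z inf]
    show "\<exists>x\<in>?L. (\<Sum>j<k. \<alpha> j * I_tilde \<gamma> j x) \<noteq> 0" using R(1) by (simp add: F_def)
    show "finite {x \<in> ?L. (\<Sum>j<k. \<alpha> j * I_tilde \<gamma> j x) = 0}" using R(2) by (simp add: F_def)
    show "(\<Sum>x\<in>{x \<in> ?L. (\<Sum>j<k. \<alpha> j * I_tilde \<gamma> j x) = 0}.
        zero_multiplicity (\<lambda>x. \<Sum>j<k. \<alpha> j * I_tilde \<gamma> j x) x) \<le> enat (k - 1)"
      using R(3) by (simp add: F_def)
  qed
  thus ?thesis unfolding ECT_system_unordered_def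
    by (intro exI[of _ id]) (simp add: permutes_id)
qed

end
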